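(* Let $b>1$ be fixed, $p=b\log N/N$, and consider majority dynamics with independently resampled update graphs $G_t\sim\mathbb G(N,p)$. Fix $K>K_2^{\mathrm{ER}}(b)$, and let $c_1,C_2,c,\xi>0$ be constants, depending only on $b$ and $K$, having properties (A) and (B) of the context. Let $(h_N)$ satisfy $h_N\to\infty$ and $h_N=o(\sqrt{\log N})$, and fix $C_0>0$. Define $$T_N=\max\Bigl\{0,\Bigl\lceil\frac{\log\bigl(Kh_N\sqrt{N/\log N}\bigr)}{\log\bigl(c_1\sqrt{\log N}\bigr)}\Bigr\rceil\Bigr\},\qquad \mathfrak r_N(C_0)=\rho_N(C_0)+\frac1{h_N}+\eta_N\Bigl(\frac{\sqrt N}{h_N}\Bigr),$$ with $\rho_N$ and $\eta_N$ as defined in the context. Consider deterministic initial configurations $y_0$ satisfying $$x_0:=\Delta_0\sqrt{\frac{2b\log N}{\pi N}},\qquad |x_0|\le C_0.$$ Then, uniformly over all such configurations, $$\mathbb P\bigl(R_{T_N+3}=\emptyset\mid y_0\bigr)=\Phi(x_0)+O\bigl(\mathfrak r_N(C_0)\bigr),\qquad \mathbb P\bigl(B_{T_N+3}=\emptyset\mid y_0\bigr)=\Phi(-x_0)+O\bigl(\mathfrak r_N(C_0)\bigr).$$ In particular, $\mathfrak r_N(C_0)=o(1)$ and $T_N+3=(1+o(1))\log N/\log\log N$ as $N\to\infty$.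
   Context: Majority dynamics with resampling: the vertex set is $[N]=\{1,\dots,N\}$; $y_t\in\{\pm1\}^{[N]}$ is the configuration at day $t$ ($+1$ = blue, $-1$ = red), $B_t=\{v:y_t(v)=+1\}$, $R_t=\{v:y_t(v)=-1\}$, $\Delta_t=|B_t|-|R_t|$. The graphs $G_1,G_2,\dots$ are i.i.d. Erdős–Rényi graphs $\mathbb G(N,p)$ on $[N]$, independent of the fixed initial configuration $y_0$. At day $t+1$ all vertices update synchronously: if in $G_{t+1}$ the vertex $v$ has strictly more neighbors in $B_t$ than in $R_t$ then $y_{t+1}(v)=+1$; if strictly fewer then $y_{t+1}(v)=-1$; if equal then $y_{t+1}(v)=y_t(v)$. Logarithms are natural; $\Phi$ is the standard normal distribution function. Asymptotics are as $N\to\infty$. Constants: $r_*=\frac12\bigl(1-\frac{\sqrt{2b-1}}{b}\bigr)$ and $K_2^{\mathrm{ER}}(b)=\frac1{\sqrt b}\Phi^{-1}(1-r_* )$. Property (A) (stepwise amplification): whenever $\sqrt{N/\log N}\le\Delta_t\le KN/\sqrt{\log N}$, $$\mathbb P\bigl(c_1\sqrt{\log N}\,\Delta_t\le\Delta_{t+1}\le C_2\sqrt{\log N}\,\Delta_t\,\big|\,y_t\bigr)\ge1-2\exp\Bigl(-c\frac{\Delta_t^2\log N}{N}\Bigr).$$ Property (B) (two-day unanimity): for all sufficiently large $N$ and every initial configuration with $\Delta_0\ge KN/\sqrt{\log N}$, $\mathbb P(R_2=\emptyset\mid y_0)\ge1-2\exp(-(\log N)^2)-2N^{-\xi}$. Constants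 depending only on $(b,K)$ with properties (A) and (B) exist (these are separate results of the same paper). Error functions: for $s\ge0$, $$\eta_N(s)=8\exp\Bigl(-c\frac{s^2\log N}{N}\Bigr)+2\exp\bigl(-(\log N)^2\bigr)+2N^{-\xi},$$ and $$\rho_N(C_0)=\sup_{y_0:\,|x_0|\le C_0}\ \sup_{z\in\mathbb R}\Bigl|\mathbb P\Bigl(\frac{\Delta_1}{\sqrt N}\le z\,\Big|\,y_0\Bigr)-\Phi(z-x_0)\Bigr|,$$ the first supremum being over deterministic initial configurations with $|x_0|\le C_0$, where $x_0=\Delta_0\sqrt{2b\log N/(\pi N)}$. *)

theory Defs
  imports "HOL-Probability.Probability" "HOL-Library.Landau_Symbols"
begin

section \<open>Majority dynamics on resampled Erdos-Renyi graphs\<close>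

text \<open>A graph on \<open>{1..N}\<close> is its set of edges, an edge being a two-element subset of \<open>{1..N}\<close>.\<close>

definition all_edges :: "nat \<Rightarrow> nat set set" where
  "all_edges N = {e. e \<subseteq> {1..N} \<and> card e = 2}"

text \<open>Every edge is present independently with probability \<open>p\<close>.  Since \<^const>\<open>bernoulli_pmf\<close>
  truncates its parameter to \<open>[0,1]\<close>, this is meaningful for all \<open>p\<close>; for \<open>p = b ln N / N\<close>
  the truncation affects only finitely many \<open>N\<close>.\<close>

definition ER :: "nat \<Rightarrow> real \<Rightarrow> nat set set pmf" where
  "ER N p = map_pmf (\<lambda>f. {e \<in> all_edges N. f e})
              (Pi_pmf (all_edges N) False (\<lambda>_. bernoulli_pmf p))"

text \<open>The law of the i.i.d. sequence \<open>G 1, G 2, \<dots>\<close>.\<close>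

definition ER_seq :: "nat \<Rightarrow> real \<Rightarrow> (nat \<Rightarrow> nat set set) measure" where
  "ER_seq N p = (\<Pi>\<^sub>M t\<in>{1..}. measure_pmf (ER N p))"

definition configs :: "nat \<Rightarrow> (nat \<Rightarrow> int) set" where
  "configs N = {1..N} \<rightarrow>\<^sub>E {-1, 1}"

definition blue :: "nat \<Rightarrow> (nat \<Rightarrow> int) \<Rightarrow> nat set" where
  "blue N y = {v \<in> {1..N}. y v = 1}"

definition red :: "nat \<Rightarrow> (nat \<Rightarrow> int) \<Rightarrow> nat set" where
  "red N y = {v \<in> {1..N}. y v = -1}"

definition bias :: "nat \<Rightarrow> (nat \<Rightarrow> int) \<Rightarrow> real" where
  "bias N y = real (card (blue N y)) - real (card (red N y))"

definition nbrs :: "nat set set \<Rightarrow> nat \<Rightarrow> nat set" where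
  "nbrs E v = {u. {u, v} \<in> E}"

definition majority_step :: "nat \<Rightarrow> nat set set \<Rightarrow> (nat \<Rightarrow> int) \<Rightarrow> nat \<Rightarrow> int" where
  "majority_step N E y = (\<lambda>v\<in>{1..N}.
     if card (nbrs E v \<inter> blue N y) > card (nbrs E v \<inter> red N y) then 1
     else if card (nbrs E v \<inter> blue N y) < card (nbrs E v \<inter> red N y) then -1
     else y v)"

primrec day :: "nat \<Rightarrow> (nat \<Rightarrow> int) \<Rightarrow> (nat \<Rightarrow> nat set set) \<Rightarrow> nat \<Rightarrow> nat \<Rightarrow> int" where
  "day N y0 G 0 = y0"
| "day N y0 G (Suc t) = majority_step N (G (Suc t)) (day N y0 G t)"

definition edge_prob :: "real \<Rightarrow> nat \<Rightarrow> real" where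
  "edge_prob b N = b * ln (real N) / real N"

text \<open>Initial configurations are deterministic, so \<open>P( \<dots> | y0)\<close> is the probability under this
  measure for the dynamics \<^term>\<open>day N y0\<close> started from \<open>y0\<close>.\<close>

abbreviation graphs :: "real \<Rightarrow> nat \<Rightarrow> (nat \<Rightarrow> nat set set) measure" where
  "graphs b N \<equiv> ER_seq N (edge_prob b N)"

section \<open>Constants\<close>

definition Phi :: "real \<Rightarrow> real" where
  "Phi = cdf std_normal_distribution"

definition r_star :: "real \<Rightarrow> real" where
  "r_star b = 1/2 * (1 - sqrt (2 * b - 1) / b)"

text \<open>For \<open>b > 1\<close> one has \<open>0 < r_star b < 1/2\<close>, so that the inverse is taken at a point of the
  range of the strictly increasing function \<^const>\<open>Phi\<close>.\<close>

definition K2_ER :: "real \<Rightarrow> real" where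
  "K2_ER b = 1 / sqrt b * inv Phi (1 - r_star b)"

section \<open>The two properties\<close>

text \<open>Conditioning on \<open>y_t\<close> is conditioning on the events \<open>y_t = y\<close> of positive probability.\<close>

definition stepwise_amplification :: "real \<Rightarrow> real \<Rightarrow> real \<Rightarrow> real \<Rightarrow> real \<Rightarrow> bool" where
  "stepwise_amplification b K c1 C2 c \<longleftrightarrow>
     (\<forall>\<^sub>F N in sequentially. \<forall>y0 \<in> configs N. \<forall>t. \<forall>y \<in> configs N.
        \<P>(G in graphs b N. day N y0 G t = y) > 0 \<and>
        sqrt (real N / ln (real N)) \<le> bias N y \<and>
        bias N y \<le> K * real N / sqrt (ln (real N)) \<longrightarrow>
        \<P>(G in graphs b N.
             c1 * sqrt (ln (real N)) * bias N (day N y0 G t) \<le> bias N (day N y0 G (t + 1)) \<and>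
             bias N (day N y0 G (t + 1)) \<le> C2 * sqrt (ln (real N)) * bias N (day N y0 G t)
           \<bar> day N y0 G t = y)
        \<ge> 1 - 2 * exp (- c * ((bias N y)\<^sup>2 * ln (real N) / real N)))"

definition two_day_unanimity :: "real \<Rightarrow> real \<Rightarrow> real \<Rightarrow> bool" where
  "two_day_unanimity b K \<xi> \<longleftrightarrow>
     (\<forall>\<^sub>F N in sequentially. \<forall>y0 \<in> configs N.
        bias N y0 \<ge> K * real N / sqrt (ln (real N)) \<longrightarrow>
        \<P>(G in graphs b N. red N (day N y0 G 2) = {})
        \<ge> 1 - 2 * exp (- ((ln (real N))\<^sup>2)) - 2 * real N powr (- \<xi>))"

section \<open>Error functions and hitting time\<close>

definition x_start :: "real \<Rightarrow> nat \<Rightarrow> (nat \<Rightarrow> int) \<Rightarrow> real" where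
  "x_start b N y0 = bias N y0 * sqrt (2 * b * ln (real N) / (pi * real N))"

definition eta :: "real \<Rightarrow> real \<Rightarrow> nat \<Rightarrow> real \<Rightarrow> real" where
  "eta c \<xi> N s = 8 * exp (- c * (s\<^sup>2 * ln (real N) / real N))
     + 2 * exp (- ((ln (real N))\<^sup>2)) + 2 * real N powr (- \<xi>)"

text \<open>The suprema are of real numbers in \<open>[0,1]\<close>, and the outer index set is nonempty for all
  large \<open>N\<close> if \<open>C0 > 0\<close>.\<close>

definition rho :: "real \<Rightarrow> nat \<Rightarrow> real \<Rightarrow> real" where
  "rho b N C0 = (SUP y0 \<in> {y0 \<in> configs N. \<bar>x_start b N y0\<bar> \<le> C0}. SUP z \<in> UNIV.
     \<bar>\<P>(G in graphs b N. bias N (day N y0 G 1) / sqrt (real N) \<le> z) - Phi (z - x_start b N y0)\<bar>)"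

definition T_time :: "real \<Rightarrow> real \<Rightarrow> (nat \<Rightarrow> real) \<Rightarrow> nat \<Rightarrow> nat" where
  "T_time K c1 h N = nat (max 0
     \<lceil>ln (K * h N * sqrt (real N / ln (real N))) / ln (c1 * sqrt (ln (real N)))\<rceil>)"

definition err :: "real \<Rightarrow> real \<Rightarrow> real \<Rightarrow> (nat \<Rightarrow> real) \<Rightarrow> real \<Rightarrow> nat \<Rightarrow> real" where
  "err b c \<xi> h C0 N = rho b N C0 + 1 / h N + eta c \<xi> N (sqrt (real N) / h N)"

end

theory Submission
  imports Defs "HOL-Real_Asymp.Real_Asymp"
begin

text \<open>Suppose that the bias after the first day is at least \<open>sqrt N / h\<close>.  By property (A) it is
  multiplied by \<open>c1 sqrt (ln N)\<close> every day until, after at most \<open>T\<close> further days, it exceeds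
  \<open>K N / sqrt (ln N)\<close>; then property (B) gives a blue unanimity within two days, and unanimity is
  absorbing.  The failure probabilities sum up to \<open>\<eta>\<close>, so blue wins with probability at least
  \<open>\<Phi> (x - 1 / h) - \<rho> - \<eta> \<ge> \<Phi> x - \<delta>\<close>, where \<open>\<delta>\<close> is the error term.  Exchanging the colours, red
  wins with probability at least \<open>\<Phi> (- x) - \<delta> = 1 - \<Phi> x - \<delta>\<close>.  As the two events exclude each
  other, both lower bounds are also upper bounds up to \<open>\<delta>\<close>.

  It remains to see that \<open>\<rho>\<close> tends to 0, which is a central limit theorem for the first day.  The
  votes have the right mean by a local limit theorem for the difference of two binomial variables,
  and they depend on each other only because an edge \<open>uv\<close> is seen by both \<open>u\<close> and \<open>v\<close>.  Replacing
  the edge by two independent coins divides the characteristic function by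
  \<open>1 - \<gamma> y u y v\<close>, up to a negligible error, with some \<open>\<gamma> = O (1 / N\<^sup>2)\<close>.  The product of these
  factors over all edges tends to 1, since the sum of \<open>y u y v\<close> over the edges is
  \<open>(\<Delta>\<^sup>2 - N) / 2 = o (N\<^sup>2)\<close>.\<close>

section \<open>Random subsets\<close>

text \<open>The obstacle is that the edge corrections are not small in total. A vertex is pivotal
  for a given edge with probability of order 1 / sqrt (ln N), so at frequency t / sqrt N one edge
  contributes (t^2 / N) (ln N / N) (1 / ln N) up to constants. There are about N^2 / 2 edges, so the
  absolute values add up to a quantity of order one. Only the signs \<open>y u * y v\<close> make
  the sum vanish, and they can cancel only if all edges carry the same coefficient. But the pivotal
  probability depends on the colours of the endpoints, through the tally 0, 1 or -1 at which the
  vote flips. The local limit theorem is therefore needed a second time: it makes these three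
  probabilities asymptotically equal, relative to their own size, and the error left per edge is o(1
  / N^2).

  No rate is proved for the central limit theorem: \<open>rho\<close> is itself part of the error
  term and only has to tend to 0. Uniformity over the starts comes from applying the limit to a
  sequence of worst starts. Probabilities concerning a single graph are finite weighted sums, so
  that they can be computed by induction on the ground set.\<close>

definition subset_mean :: "real \<Rightarrow> 'a set \<Rightarrow> ('a set \<Rightarrow> 'b::real_normed_vector) \<Rightarrow> 'b" where
  "subset_mean p S f = (\<Sum>X\<in>Pow S. (p ^ card X * (1 - p) ^ card (S - X)) *\<^sub>R f X)"

lemma subset_mean_empty [simp]: "subset_mean p {} f = f {}"
  by (simp add: subset_mean_def)

text \<open>Conditioning on whether \<open>a\<close> is chosen. Many identities about
  \<open>subset_mean\<close> are proved by induction on the ground set through this recursion; they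
  hold for every real \<open>p\<close>, and only inequalities between means use that
  \<open>p\<close> is a probability.\<close>

lemma subset_mean_insert:
  assumes "finite S" "a \<notin> S"
  shows "subset_mean p (insert a S) f =
    p *\<^sub>R subset_mean p S (\<lambda>X. f (insert a X)) + (1 - p) *\<^sub>R subset_mean p S f"
proof -
  have fin: "finite (Pow S)" using assms by simp
  have inj: "inj_on (insert a) (Pow S)"
    using assms by (intro inj_onI) (metis Diff_insert_absorb PowD subsetD)
  have disj: "Pow S \<inter> insert a ` Pow S = {}" using assms by auto
  have c1: "card (insert a S - X) = Suc (card (S - X))" if "X \<in> Pow S" for X
  proof -
    have "insert a S - X = insert a (S - X)" using that assms by auto
    then show ?thesis using assms by simp
  qed
  have c2: "card (insert a X) = Suc (card X)" if "X \<in> Pow S" for X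
    using that assms by (subst card_insert_disjoint) (auto intro: finite_subset)
  have c3: "insert a S - insert a X = S - X" if "X \<in> Pow S" for X
    using that assms by auto
  have "subset_mean p (insert a S) f =
     (\<Sum>X\<in>Pow S. (p ^ card X * (1 - p) ^ card (insert a S - X)) *\<^sub>R f X)
   + (\<Sum>X\<in>Pow S. (p ^ card (insert a X) * (1 - p) ^ card (insert a S - insert a X)) *\<^sub>R f (insert a X))"
    unfolding subset_mean_def Pow_insert using fin disj inj
    by (subst sum.union_disjoint) (auto simp: sum.reindex)
  also have "(\<Sum>X\<in>Pow S. (p ^ card X * (1 - p) ^ card (insert a S - X)) *\<^sub>R f X)
      = (1 - p) *\<^sub>R subset_mean p S f"
    unfolding subset_mean_def scaleR_sum_right
    by (intro sum.cong refl) (simp add: c1 mult_ac)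
  also have "(\<Sum>X\<in>Pow S. (p ^ card (insert a X) * (1 - p) ^ card (insert a S - insert a X)) *\<^sub>R f (insert a X))
      = p *\<^sub>R subset_mean p S (\<lambda>X. f (insert a X))"
    unfolding subset_mean_def scaleR_sum_right
    by (intro sum.cong refl) (simp only: c2 c3 power_Suc scaleR_scaleR mult.assoc)
  finally show ?thesis by simp
qed

lemma subset_mean_cong:
  assumes "\<And>X. X \<subseteq> S \<Longrightarrow> f X = g X"
  shows "subset_mean p S f = subset_mean p S g"
  unfolding subset_mean_def by (intro sum.cong) (auto simp: assms)

lemma subset_mean_const [simp]: "finite S \<Longrightarrow> subset_mean p S (\<lambda>_. c) = c"
  by (induction S rule: finite_induct) (simp_all add: subset_mean_insert flip: scaleR_add_left)

lemma subset_mean_add: "subset_mean p S (\<lambda>X. f X + g X) = subset_mean p S f + subset_mean p S g"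
  by (simp add: subset_mean_def scaleR_add_right sum.distrib)

lemma subset_mean_diff: "subset_mean p S (\<lambda>X. f X - g X) = subset_mean p S f - subset_mean p S g"
  by (simp add: subset_mean_def scaleR_diff_right sum_subtractf)

lemma subset_mean_linear:
  assumes "bounded_linear L"
  shows "subset_mean p S (\<lambda>X. L (f X)) = L (subset_mean p S f)"
  unfolding subset_mean_def
  by (simp add: linear_sum[OF bounded_linear.linear[OF assms]]
      linear_cmul[OF bounded_linear.linear[OF assms]])

lemma subset_mean_mult_left:
  fixes f :: "'a set \<Rightarrow> 'b::real_normed_algebra"
  shows "subset_mean p S (\<lambda>X. c * f X) = c * subset_mean p S f"
  by (rule subset_mean_linear[OF bounded_linear_mult_right])

lemma subset_mean_mult_right:
  fixes f :: "'a set \<Rightarrow> 'b::real_normed_algebra"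
  shows "subset_mean p S (\<lambda>X. f X * c) = subset_mean p S f * c"
  by (rule subset_mean_linear[OF bounded_linear_mult_left])

lemma subset_mean_of_real:
  "subset_mean p S (\<lambda>X. of_real (f X)) = (of_real (subset_mean p S f) :: 'b::real_normed_algebra_1)"
  by (rule subset_mean_linear[OF bounded_linear_of_real])

lemma subset_mean_Re: "subset_mean p S (\<lambda>X. Re (f X)) = Re (subset_mean p S f)"
  by (rule subset_mean_linear[OF bounded_linear_Re])

lemma subset_mean_sum:
  "subset_mean p S (\<lambda>X. \<Sum>i\<in>I. f i X) = (\<Sum>i\<in>I. subset_mean p S (f i))"
  unfolding subset_mean_def by (simp add: scaleR_sum_right) (rule sum.swap)

text \<open>Fubini: the choices made in disjoint ground sets are independent.\<close>

lemma subset_mean_union: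
  assumes "finite S" "finite T" "S \<inter> T = {}"
  shows "subset_mean p (S \<union> T) f = subset_mean p S (\<lambda>X. subset_mean p T (\<lambda>Y. f (X \<union> Y)))"
  using assms
proof (induction S arbitrary: f rule: finite_induct)
  case (insert a S)
  then have *: "finite (S \<union> T)" "a \<notin> S \<union> T" "S \<inter> T = {}" by auto
  show ?case
    using * insert.hyps insert.IH[OF \<open>finite T\<close> *(3)]
    by (simp add: subset_mean_insert)
qed simp

lemma subset_mean_image:
  assumes "finite S" "inj_on h S"
  shows "subset_mean p (h ` S) f = subset_mean p S (\<lambda>X. f (h ` X))"
  using assms
proof (induction S arbitrary: f rule: finite_induct)
  case (insert a S)
  then show ?case by (simp add: subset_mean_insert)
qed simp

lemma subset_mean_marginal:
  assumes "finite S" "T \<subseteq> S"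
  shows "subset_mean p S (\<lambda>X. f (X \<inter> T)) = subset_mean p T f"
proof -
  have fT: "finite T" using assms finite_subset by blast
  have "subset_mean p (T \<union> (S - T)) (\<lambda>X. f (X \<inter> T))
      = subset_mean p T (\<lambda>X. subset_mean p (S - T) (\<lambda>Y. f ((X \<union> Y) \<inter> T)))"
    using fT assms by (intro subset_mean_union) auto
  also have "\<dots> = subset_mean p T (\<lambda>X. subset_mean p (S - T) (\<lambda>Y. f X))"
    by (intro subset_mean_cong arg_cong[where f = f]) auto
  also have "\<dots> = subset_mean p T f" using assms by simp
  finally show ?thesis using assms by (simp add: Un_absorb1)
qed

lemma subset_mean_prod:
  fixes f :: "'i \<Rightarrow> 'a set \<Rightarrow> complex"
  assumes "finite I" "\<And>i. i \<in> I \<Longrightarrow> finite (S i)"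
    "\<And>i j. i \<in> I \<Longrightarrow> j \<in> I \<Longrightarrow> i \<noteq> j \<Longrightarrow> S i \<inter> S j = {}"
  shows "subset_mean p (\<Union>i\<in>I. S i) (\<lambda>X. \<Prod>i\<in>I. f i (X \<inter> S i)) = (\<Prod>i\<in>I. subset_mean p (S i) (f i))"
  using assms
proof (induction I rule: finite_induct)
  case (insert a I)
  have disj: "S a \<inter> (\<Union>i\<in>I. S i) = {}" using insert by blast
  have "subset_mean p (S a \<union> (\<Union>i\<in>I. S i)) (\<lambda>X. \<Prod>i\<in>insert a I. f i (X \<inter> S i))
     = subset_mean p (S a) (\<lambda>X. subset_mean p (\<Union>i\<in>I. S i)
         (\<lambda>Y. \<Prod>i\<in>insert a I. f i ((X \<union> Y) \<inter> S i)))"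
    using insert disj by (intro subset_mean_union) auto
  also have "\<dots> = subset_mean p (S a) (\<lambda>X. subset_mean p (\<Union>i\<in>I. S i)
         (\<lambda>Y. f a X * (\<Prod>i\<in>I. f i (Y \<inter> S i))))"
  proof (intro subset_mean_cong)
    fix X Y assume XY: "X \<subseteq> S a" "Y \<subseteq> (\<Union>i\<in>I. S i)"
    have 1: "(X \<union> Y) \<inter> S a = X" using XY disj by blast
    have 2: "(X \<union> Y) \<inter> S i = Y \<inter> S i" if "i \<in> I" for i using XY disj that by blast
    show "(\<Prod>i\<in>insert a I. f i ((X \<union> Y) \<inter> S i)) = f a X * (\<Prod>i\<in>I. f i (Y \<inter> S i))"
      using insert.hyps 1 2 by simp
  qed
  also have "\<dots> = subset_mean p (S a) (\<lambda>X. f a X * (\<Prod>i\<in>I. subset_mean p (S i) (f i)))"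
    using insert by (simp add: subset_mean_mult_left)
  also have "\<dots> = (\<Prod>i\<in>insert a I. subset_mean p (S i) (f i))"
    using insert.hyps by (simp add: subset_mean_mult_right)
  finally show ?case by simp
qed simp

lemma norm_subset_mean_le:
  assumes "0 \<le> p" "p \<le> 1"
  shows "norm (subset_mean p S f) \<le> subset_mean p S (\<lambda>X. norm (f X))"
  unfolding subset_mean_def
  by (rule order_trans[OF norm_sum]) (use assms in simp)

lemma subset_mean_mono:
  fixes f g :: "'a set \<Rightarrow> real"
  assumes "0 \<le> p" "p \<le> 1" "\<And>X. X \<subseteq> S \<Longrightarrow> f X \<le> g X"
  shows "subset_mean p S f \<le> subset_mean p S g"
  unfolding subset_mean_def using assms by (intro sum_mono) (auto intro!: mult_left_mono)

lemma norm_subset_mean_bound: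
  assumes "0 \<le> p" "p \<le> 1" "finite S" "\<And>X. X \<subseteq> S \<Longrightarrow> norm (f X) \<le> c"
  shows "norm (subset_mean p S f) \<le> c"
proof -
  have "norm (subset_mean p S f) \<le> subset_mean p S (\<lambda>X. norm (f X))"
    using assms by (intro norm_subset_mean_le)
  also have "\<dots> \<le> subset_mean p S (\<lambda>X. c)" using assms by (intro subset_mean_mono)
  finally show ?thesis using assms by simp
qed

lemma subset_mean_card:
  assumes "finite S"
  shows "subset_mean p S (\<lambda>X. real (card X)) = p * real (card S)"
  using assms
proof (induction S rule: finite_induct)
  case (insert a S)
  have "subset_mean p S (\<lambda>X. real (card (insert a X))) = subset_mean p S (\<lambda>X. 1 + real (card X))"
    using insert.hyps by (intro subset_mean_cong)
      (subst card_insert_disjoint, auto intro: finite_subset)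
  with insert show ?case
    by (simp add: subset_mean_insert subset_mean_add algebra_simps)
qed simp

text \<open>The correlation of \<open>g\<close> with an event that looks only at \<open>J\<close> is controlled by erasing \<open>J\<close>
  from the argument of \<open>g\<close>.\<close>

lemma subset_mean_erase:
  fixes g :: "'a set \<Rightarrow> complex" and i :: "'a set \<Rightarrow> real"
  assumes p: "0 \<le> p" "p \<le> 1" and S: "finite S" "J \<subseteq> S"
    and g: "\<And>X. X \<subseteq> S \<Longrightarrow> norm (g X - g (X - J)) \<le> L * real (card (X \<inter> J))"
    and i: "\<And>X. X \<subseteq> J \<Longrightarrow> 0 \<le> i X \<and> i X \<le> 1"
  shows "norm (subset_mean p S (\<lambda>X. g X * of_real (i (X \<inter> J)))
           - subset_mean p S g * of_real (subset_mean p J i)) \<le> 2 * L * p * real (card J)"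
proof -
  have fJ: "finite J" using S finite_subset by blast
  have SJ: "J \<union> (S - J) = S" using S by auto
  let ?m = "subset_mean p J i" and ?r = "subset_mean p (S - J) g"
  have Lcard: "subset_mean p S (\<lambda>X. L * real (card (X \<inter> J))) = L * p * real (card J)"
    using subset_mean_marginal[OF S, of p "\<lambda>X. L * real (card X)"] fJ
    by (simp add: subset_mean_mult_left subset_mean_card)
  \<comment> \<open>With \<open>J\<close> erased, \<open>g\<close> reads only \<open>S - J\<close>,
    while \<open>i\<close> reads only \<open>J\<close>; hence the mean factorises.\<close>
  have e1: "subset_mean p S (\<lambda>X. g (X - J) * of_real (i (X \<inter> J))) = ?r * of_real ?m"
  proof -
    have "subset_mean p (J \<union> (S - J)) (\<lambda>X. g (X - J) * of_real (i (X \<inter> J)))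
        = subset_mean p J (\<lambda>X. subset_mean p (S - J) (\<lambda>Y. g ((X \<union> Y) - J) * of_real (i ((X \<union> Y) \<inter> J))))"
      using fJ S by (intro subset_mean_union) auto
    also have "\<dots> = subset_mean p J (\<lambda>X. subset_mean p (S - J) (\<lambda>Y. g Y * of_real (i X)))"
    proof (intro subset_mean_cong)
      fix X Y assume "X \<subseteq> J" "Y \<subseteq> S - J"
      then have "(X \<union> Y) - J = Y" "(X \<union> Y) \<inter> J = X" by auto
      then show "g ((X \<union> Y) - J) * of_real (i ((X \<union> Y) \<inter> J)) = g Y * of_real (i X)" by simp
    qed
    also have "\<dots> = ?r * of_real ?m"
      by (simp add: subset_mean_mult_right subset_mean_mult_left subset_mean_of_real)
    finally show ?thesis using SJ by simp
  qed
  have e2: "subset_mean p S (\<lambda>X. g (X - J)) = ?r"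
  proof -
    have "subset_mean p S (\<lambda>X. g (X - J)) = subset_mean p S (\<lambda>X. g (X \<inter> (S - J)))"
      by (intro subset_mean_cong arg_cong[where f = g]) auto
    also have "\<dots> = ?r" using S by (intro subset_mean_marginal) auto
    finally show ?thesis .
  qed
  have i': "\<bar>i (X \<inter> J)\<bar> \<le> 1" for X using i[of "X \<inter> J"] by auto
  \<comment> \<open>The erased mean \<open>?r\<close> is compared with the joint mean here and with
    the mean of \<open>g\<close> in \<open>d2\<close>; the two comparisons give the factor 2 in the
    bound.\<close>
  have d1: "norm (subset_mean p S (\<lambda>X. g X * of_real (i (X \<inter> J))) - ?r * of_real ?m)
      \<le> L * p * real (card J)"
  proof -
    have "norm (subset_mean p S (\<lambda>X. g X * of_real (i (X \<inter> J)) - g (X - J) * of_real (i (X \<inter> J))))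
      \<le> subset_mean p S (\<lambda>X. L * real (card (X \<inter> J)))"
    proof (rule order_trans[OF norm_subset_mean_le[OF p] subset_mean_mono[OF p]])
      fix X assume X: "X \<subseteq> S"
      have "norm (g X * of_real (i (X \<inter> J)) - g (X - J) * of_real (i (X \<inter> J)))
          = norm (g X - g (X - J)) * \<bar>i (X \<inter> J)\<bar>"
        by (simp add: norm_mult flip: left_diff_distrib)
      also have "\<dots> \<le> norm (g X - g (X - J)) * 1"
        using i'[of X] by (intro mult_left_mono) auto
      also have "\<dots> \<le> L * real (card (X \<inter> J))" using g[OF X] by simp
      finally show "norm (g X * of_real (i (X \<inter> J)) - g (X - J) * of_real (i (X \<inter> J)))
          \<le> L * real (card (X \<inter> J))" .
    qed
    then show ?thesis by (simp add: subset_mean_diff e1 Lcard)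
  qed
  have d2: "norm (subset_mean p S g - ?r) \<le> L * p * real (card J)"
  proof -
    have "norm (subset_mean p S (\<lambda>X. g X - g (X - J))) \<le> subset_mean p S (\<lambda>X. L * real (card (X \<inter> J)))"
      by (rule order_trans[OF norm_subset_mean_le[OF p] subset_mean_mono[OF p]]) (rule g)
    then show ?thesis by (simp add: subset_mean_diff e2 Lcard)
  qed
  have m: "\<bar>?m\<bar> \<le> 1"
    using norm_subset_mean_bound[OF p fJ, of i 1] i by fastforce
  have "norm (?r * of_real ?m - subset_mean p S g * of_real ?m) = norm (subset_mean p S g - ?r) * \<bar>?m\<bar>"
    by (simp add: norm_mult norm_minus_commute flip: left_diff_distrib)
  also have "\<dots> \<le> norm (subset_mean p S g - ?r) * 1" using m by (intro mult_left_mono) auto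
  finally have "norm (?r * of_real ?m - subset_mean p S g * of_real ?m) \<le> L * p * real (card J)"
    using d2 by simp
  with norm_triangle_le[of _ _ "L * p * real (card J) + L * p * real (card J)", OF add_mono[OF d1 this]]
  show ?thesis by (simp add: algebra_simps)
qed

section \<open>The random graph as a random subset\<close>

definition edge_pmf :: "real \<Rightarrow> 'a set \<Rightarrow> 'a set pmf" where
  "edge_pmf p S = map_pmf (\<lambda>f. {e \<in> S. f e}) (Pi_pmf S False (\<lambda>_. bernoulli_pmf p))"

text \<open>\<open>edge_pmf\<close> extends the law \<open>ER\<close> to arbitrary finite index sets
  so that this induction on \<open>S\<close> becomes possible.\<close>

lemma expectation_edge_pmf:
  fixes f :: "'a set \<Rightarrow> 'b::{banach, second_countable_topology}"
  assumes "finite S" "0 \<le> p" "p \<le> 1"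
  shows "measure_pmf.expectation (edge_pmf p S) f = subset_mean p S f"
  using assms
proof (induction S arbitrary: f rule: finite_induct)
  case empty
  then show ?case by (simp add: edge_pmf_def)
next
  case (insert a S)
  have eq: "edge_pmf p (insert a S) =
     bernoulli_pmf p \<bind> (\<lambda>b. map_pmf (\<lambda>X. if b then insert a X else X) (edge_pmf p S))"
    unfolding edge_pmf_def using insert.hyps
    apply (subst Pi_pmf_insert')
     apply assumption+
    apply (simp add: map_bind_pmf map_pmf_comp)
    apply (intro bind_pmf_cong refl)
    apply (simp add: map_bind_pmf bind_map_pmf flip: map_pmf_def)
    apply (intro map_pmf_cong refl)
    apply auto
    done
  have fin: "finite (set_pmf (edge_pmf p S))"
    by (rule finite_subset[of _ "Pow S"]) (auto simp: edge_pmf_def insert.hyps)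
  have "measure_pmf.expectation (edge_pmf p (insert a S)) f =
     p *\<^sub>R measure_pmf.expectation (edge_pmf p S) (\<lambda>X. f (insert a X))
     + (1 - p) *\<^sub>R measure_pmf.expectation (edge_pmf p S) f"
    unfolding eq
    apply (subst pmf_expectation_bind[of UNIV])
    using fin insert.prems by (auto simp: UNIV_bool algebra_simps)
  then show ?case using insert by (simp add: subset_mean_insert)
qed

lemma ER_eq: "ER N p = edge_pmf p (all_edges N)"
  by (simp add: ER_def edge_pmf_def)

lemma finite_all_edges [simp]: "finite (all_edges N)"
  by (rule finite_subset[of _ "Pow {1..N}"]) (auto simp: all_edges_def)

lemma expectation_ER:
  fixes f :: "nat set set \<Rightarrow> 'b::{banach, second_countable_topology}"
  assumes "0 \<le> p" "p \<le> 1"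
  shows "measure_pmf.expectation (ER N p) f = subset_mean p (all_edges N) f"
  unfolding ER_eq using assms by (intro expectation_edge_pmf) auto


section \<open>A local limit theorem\<close>

definition tally :: "'a set \<Rightarrow> 'a set \<Rightarrow> 'a set \<Rightarrow> int" where
  "tally B R Z = int (card (Z \<inter> B)) - int (card (Z \<inter> R))"

lemma tally_swap: "tally R B Z = - tally B R Z"
  by (simp add: tally_def)

lemma abs_tally_le:
  assumes "finite B" "finite R" "B \<inter> R = {}"
  shows "\<bar>tally B R Z\<bar> \<le> int (card (B \<union> R))"
proof -
  have "card (Z \<inter> B) \<le> card B" "card (Z \<inter> R) \<le> card R" using assms by (auto intro: card_mono)
  then show ?thesis using assms by (simp add: tally_def card_Un_disjoint)
qed

lemma subset_mean_power_card:
  fixes c :: complex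
  assumes "finite S"
  shows "subset_mean p S (\<lambda>X. c ^ card X) = (1 - p + p * c) ^ card S"
  using assms
proof (induction S rule: finite_induct)
  case (insert a S)
  have "subset_mean p S (\<lambda>X. c ^ card (insert a X)) = subset_mean p S (\<lambda>X. c * c ^ card X)"
    using insert.hyps by (intro subset_mean_cong)
      (subst card_insert_disjoint, auto intro: finite_subset)
  with insert show ?case
    by (simp add: subset_mean_insert subset_mean_mult_left scaleR_conv_of_real algebra_simps)
qed simp

text \<open>One blue and one red vertex together contribute the squared modulus of 1 - p + p
  \<open>cis \<theta>\<close>, which is real. For this reason the tally is studied first for colour
  classes of equal size.\<close>

lemma subset_mean_cis_tally:
  assumes fin: "finite B" "finite R" and disj: "B \<inter> R = {}" and card: "card B = n" "card R = n"
  shows "subset_mean p (B \<union> R) (\<lambda>Z. cis (\<theta> * real_of_int (tally B R Z)))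
    = of_real ((1 - 2 * p * (1 - p) * (1 - cos \<theta>)) ^ n)"
proof -
  have cis1: "cis (\<theta> * real_of_int (tally B R (X \<union> Y))) = cis \<theta> ^ card X * cis (- \<theta>) ^ card Y"
    if "X \<subseteq> B" "Y \<subseteq> R" for X Y
  proof -
    have "(X \<union> Y) \<inter> B = X" "(X \<union> Y) \<inter> R = Y" using that disj by auto
    then show ?thesis
      by (simp add: tally_def Complex.DeMoivre cis_mult algebra_simps)
  qed
  have "subset_mean p (B \<union> R) (\<lambda>Z. cis (\<theta> * real_of_int (tally B R Z)))
      = subset_mean p B (\<lambda>X. subset_mean p R (\<lambda>Y. cis (\<theta> * real_of_int (tally B R (X \<union> Y)))))"
    using fin disj by (rule subset_mean_union)
  also have "\<dots> = subset_mean p B (\<lambda>X. subset_mean p R (\<lambda>Y. cis \<theta> ^ card X * cis (- \<theta>) ^ card Y))"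
    by (intro subset_mean_cong cis1)
  also have "\<dots> = ((1 - p + p * cis \<theta>) * (1 - p + p * cis (- \<theta>))) ^ n"
    using fin card
    by (simp add: subset_mean_mult_left subset_mean_mult_right subset_mean_power_card power_mult_distrib)
  also have "(1 - p + p * cis \<theta>) * (1 - p + p * cis (- \<theta>))
      = complex_of_real (1 - 2 * p * (1 - p) * (1 - cos \<theta>))"
  proof -
    have s: "(sin \<theta>)\<^sup>2 = 1 - (cos \<theta>)\<^sup>2" by (simp add: sin_squared_eq)
    have "(1 - p + p * cos \<theta>)\<^sup>2 + p\<^sup>2 * (sin \<theta>)\<^sup>2 = 1 - 2 * p * (1 - p) * (1 - cos \<theta>)"
      unfolding s by (simp add: power2_eq_square algebra_simps)
    then show ?thesis by (simp add: complex_eq_iff power2_eq_square algebra_simps)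
  qed
  finally show ?thesis by simp
qed

text \<open>The probability that two independent binomial variables with parameters \<open>n\<close> and \<open>p\<close> differ
  by \<open>j\<close>, written as a Fourier coefficient.\<close>

definition balanced_prob :: "real \<Rightarrow> nat \<Rightarrow> int \<Rightarrow> real" where
  "balanced_prob p n j = 1 / (2 * pi) *
     (LBINT \<theta>:{-pi..pi}. (1 - 2 * p * (1 - p) * (1 - cos \<theta>)) ^ n * cos (\<theta> * real_of_int j))"

lemma set_integral_cos:
  "(LBINT \<theta>:{-pi..pi}. cos (\<theta> * real_of_int k)) = 2 * pi * of_bool (k = 0)"
proof (cases "k = 0")
  case False
  have int: "set_integrable lborel {-pi..pi} (\<lambda>\<theta>. cos (\<theta> * real_of_int k))"
    by (intro borel_integrable_atLeastAtMost' continuous_intros)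
  have deriv: "((\<lambda>\<theta>. sin (\<theta> * real_of_int k) / k) has_vector_derivative cos (\<theta> * real_of_int k))
      (at \<theta> within {-pi..pi})" for \<theta>
    unfolding has_real_derivative_iff_has_vector_derivative[symmetric]
    using False by (auto intro!: derivative_eq_intros)
  have "((\<lambda>\<theta>. cos (\<theta> * real_of_int k)) has_integral
      (sin (pi * real_of_int k) / k - sin (- pi * real_of_int k) / k)) {-pi..pi}"
    by (rule fundamental_theorem_of_calculus[OF _ deriv]) simp
  then have "integral {-pi..pi} (\<lambda>\<theta>. cos (\<theta> * real_of_int k)) = 0"
    by (simp add: integral_unique)
  then show ?thesis
    using False set_borel_integral_eq_integral(2)[OF int] by simp
next
  case True
  have "(LBINT \<theta>:{-pi..pi}. (1::real)) = 2 * pi"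
    by (simp add: set_lebesgue_integral_def)
  then show ?thesis using True by simp
qed

text \<open>Fourier inversion on the integers. The mean is a finite sum, so it commutes with the
  integral, and \<open>set_integral_cos\<close> keeps exactly the sets with tally
  \<open>j\<close>.\<close>

lemma balanced_prob:
  assumes fin: "finite B" "finite R" and disj: "B \<inter> R = {}" and card: "card B = n" "card R = n"
  shows "subset_mean p (B \<union> R) (\<lambda>Z. of_bool (tally B R Z = j)) = balanced_prob p n j"
proof -
  have Re: "subset_mean p (B \<union> R) (\<lambda>Z. cos (\<theta> * real_of_int (tally B R Z - j)))
     = (1 - 2 * p * (1 - p) * (1 - cos \<theta>)) ^ n * cos (\<theta> * real_of_int j)" for \<theta>
  proof -
    have "subset_mean p (B \<union> R) (\<lambda>Z. cos (\<theta> * real_of_int (tally B R Z - j)))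
        = subset_mean p (B \<union> R) (\<lambda>Z. Re (cis (\<theta> * tally B R Z) * cis (- (\<theta> * j))))"
      by (intro subset_mean_cong) (simp add: cis_mult algebra_simps)
    also have "\<dots> = Re (subset_mean p (B \<union> R) (\<lambda>Z. cis (\<theta> * tally B R Z)) * cis (- (\<theta> * j)))"
      by (simp only: subset_mean_Re subset_mean_mult_right)
    also have "\<dots> = (1 - 2 * p * (1 - p) * (1 - cos \<theta>)) ^ n * cos (\<theta> * real_of_int j)"
      by (subst subset_mean_cis_tally[OF assms]) (simp del: of_real_power)
    finally show ?thesis .
  qed
  have int: "set_integrable lborel {-pi..pi} (\<lambda>\<theta>. w *\<^sub>R cos (\<theta> * real_of_int k))" for w and k :: int
    by (intro borel_integrable_atLeastAtMost' continuous_intros)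
  have "2 * pi * balanced_prob p n j
      = (LBINT \<theta>:{-pi..pi}. subset_mean p (B \<union> R) (\<lambda>Z. cos (\<theta> * real_of_int (tally B R Z - j))))"
    by (simp only: balanced_prob_def Re) simp
  also have "\<dots> = (\<Sum>X\<in>Pow (B \<union> R). LBINT \<theta>:{-pi..pi}.
       (p ^ card X * (1 - p) ^ card (B \<union> R - X)) *\<^sub>R cos (\<theta> * real_of_int (tally B R X - j)))"
    unfolding subset_mean_def set_lebesgue_integral_def scaleR_sum_right
    using int unfolding set_integrable_def by (intro Bochner_Integration.integral_sum)
  also have "\<dots> = (\<Sum>X\<in>Pow (B \<union> R). (p ^ card X * (1 - p) ^ card (B \<union> R - X)) *\<^sub>R
       (2 * pi * of_bool (tally B R X - j = 0)))"
    by (simp only: set_integral_scaleR_right set_integral_cos)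
  also have "\<dots> = 2 * pi * subset_mean p (B \<union> R) (\<lambda>Z. of_bool (tally B R Z = j))"
    by (simp add: subset_mean_def sum_distrib_left mult_ac)
  finally show ?thesis by simp
qed

text \<open>A quadratic lower bound on the whole period, which provides the Gaussian majorant in
  \<open>local_limit\<close>. With y = |x| / 2 one has 1 - cos x = 2 (sin y)^2, and y^2 \<le> 3
  turns the cubic Taylor bound into sin y \<ge> y / 2; the constant 1/8 is what this crude estimate
  yields.\<close>

lemma one_minus_cos_ge:
  fixes x :: real
  assumes "\<bar>x\<bar> \<le> pi"
  shows "1 - cos x \<ge> x\<^sup>2 / 8"
proof -
  define y where "y = \<bar>x\<bar> / 2"
  have y: "0 \<le> y" "y \<le> pi / 2" using assms by (auto simp: y_def)
  have pi: "pi < 3.2" using pi_less_4 pi_approx by simp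
  have "y\<^sup>2 \<le> (3.2 / 2)\<^sup>2" using y pi by (intro power_mono) auto
  then have y2: "y\<^sup>2 \<le> 3" by (simp add: power2_eq_square)
  have "\<bar>sin y - (\<Sum>m<3. sin_coeff m * y ^ m)\<bar> \<le> inverse (fact 3) * \<bar>y\<bar> ^ 3"
    by (rule Maclaurin_sin_bound)
  then have "\<bar>sin y - y\<bar> \<le> y ^ 3 / 6"
    using y by (simp add: numeral_3_eq_3 sin_coeff_def fact_numeral divide_simps)
  moreover have "y ^ 3 / 6 \<le> y / 2"
    using y y2 mult_left_mono[OF y2 y(1)] by (simp add: power3_eq_cube power2_eq_square)
  ultimately have "y / 2 \<le> sin y" by linarith
  then have "(y / 2)\<^sup>2 \<le> (sin y)\<^sup>2" using y by (intro power_mono) auto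
  moreover have "1 - cos x = 2 * (sin y)\<^sup>2"
    using cos_double_sin[of y] by (simp add: y_def)
  ultimately show ?thesis by (simp add: y_def power_divide)
qed

text \<open>In the logarithm the error of the linear approximation is at most 2 n y^2, a bounded
  factor n y times a factor y that tends to 0.\<close>

lemma power_one_minus_tendsto_exp:
  fixes y :: "nat \<Rightarrow> real"
  assumes lim: "(\<lambda>k. real (n k) * y k) \<longlonglongrightarrow> L" and y: "y \<longlonglongrightarrow> 0"
  shows "(\<lambda>k. (1 - y k) ^ n k) \<longlonglongrightarrow> exp (- L)"
proof -
  have ev: "\<forall>\<^sub>F k in sequentially. \<bar>y k\<bar> < 1/2"
    using order_tendstoD(2)[OF tendsto_rabs[OF y], of "1/2"] by simp
  have "(\<lambda>k. real (n k) * ln (1 - y k) + real (n k) * y k) \<longlonglongrightarrow> 0"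
  proof (rule Lim_null_comparison)
    show "(\<lambda>k. 2 * (\<bar>real (n k) * y k\<bar> * \<bar>y k\<bar>)) \<longlonglongrightarrow> 0"
      using tendsto_mult[OF tendsto_const tendsto_mult[OF tendsto_rabs[OF lim] tendsto_rabs[OF y]], of 2]
      by simp
    show "\<forall>\<^sub>F k in sequentially. norm (real (n k) * ln (1 - y k) + real (n k) * y k)
         \<le> 2 * (\<bar>real (n k) * y k\<bar> * \<bar>y k\<bar>)"
      using ev
    proof eventually_elim
      case (elim k)
      have "\<bar>ln (1 + - y k) - - y k\<bar> \<le> 2 * (- y k)\<^sup>2"
        using elim by (intro abs_ln_one_plus_x_minus_x_bound) simp
      then have "real (n k) * \<bar>ln (1 - y k) + y k\<bar> \<le> real (n k) * (2 * (y k)\<^sup>2)"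
        by (intro mult_left_mono) simp_all
      moreover have "norm (real (n k) * ln (1 - y k) + real (n k) * y k) = real (n k) * \<bar>ln (1 - y k) + y k\<bar>"
        by (simp add: abs_mult flip: distrib_left)
      ultimately show ?case by (simp add: abs_mult power2_eq_square mult_ac)
    qed
  qed
  from tendsto_diff[OF this lim] have "(\<lambda>k. real (n k) * ln (1 - y k)) \<longlonglongrightarrow> - L" by simp
  then have "(\<lambda>k. exp (real (n k) * ln (1 - y k))) \<longlonglongrightarrow> exp (- L)" by (rule tendsto_exp)
  then show ?thesis
  proof (rule Lim_transform_eventually)
    show "\<forall>\<^sub>F k in sequentially. exp (real (n k) * ln (1 - y k)) = (1 - y k) ^ n k"
      using ev by eventually_elim (simp add: exp_of_nat_mult)
  qed
qed

lemma gaussian_integral: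
  "integrable lborel (\<lambda>x::real. exp (- x\<^sup>2 / 2))" "(\<integral>x. exp (- (x::real)\<^sup>2 / 2) \<partial>lborel) = sqrt (2 * pi)"
proof -
  have eq: "exp (- x\<^sup>2 / 2) = sqrt (2 * pi) * std_normal_density x" for x :: real
    by (simp add: std_normal_density_def)
  show "integrable lborel (\<lambda>x::real. exp (- x\<^sup>2 / 2))"
    unfolding eq by (intro integrable_mult_right integrable_normal_density) simp
  show "(\<integral>x. exp (- (x::real)\<^sup>2 / 2) \<partial>lborel) = sqrt (2 * pi)"
    unfolding eq by (subst integral_mult_right_zero) (simp add: integral_normal_density)
qed

text \<open>Let r^2 = 2 n p (1 - p), the variance of the difference of the two binomial variables.
  Substituting \<theta> = x / r turns the Fourier integral into one that tends to the Gaussian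
  integral by dominated convergence. The limit does not depend on \<open>j\<close>: neighbouring
  tallies become equally likely.\<close>

lemma local_limit:
  fixes p :: "nat \<Rightarrow> real" and n :: "nat \<Rightarrow> nat"
  assumes p: "\<forall>\<^sub>F k in sequentially. 0 \<le> p k \<and> p k \<le> 1" and p0: "p \<longlonglongrightarrow> 0"
    and np: "filterlim (\<lambda>k. real (n k) * p k) at_top sequentially"
  shows "(\<lambda>k. sqrt (2 * real (n k) * p k * (1 - p k)) * balanced_prob (p k) (n k) j)
    \<longlonglongrightarrow> 1 / sqrt (2 * pi)"
proof -
  define a where "a k = 2 * p k * (1 - p k)" for k
  define r where "r k = sqrt (real (n k) * a k)" for k
  \<comment> \<open>The bound 1/2 on \<open>a k\<close> keeps the base of the power nonnegative on
    the whole period. Where \<open>ok\<close> fails the integrand is replaced by 0, because the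
    majorant must hold for every \<open>k\<close> and not only eventually.\<close>
  define ok where "ok k \<longleftrightarrow> 0 \<le> a k \<and> a k \<le> 1 / 2 \<and> 0 < r k" for k
  define g where "g k x = indicator {-pi..pi} (x / r k) *
      ((1 - a k * (1 - cos (x / r k))) ^ n k * cos (x / r k * real_of_int j))" for k and x :: real
  have a0: "a \<longlonglongrightarrow> 0" unfolding a_def using p0 by (auto intro!: tendsto_eq_intros)
  have na: "filterlim (\<lambda>k. real (n k) * a k) at_top sequentially"
  proof (rule filterlim_at_top_mono[OF np])
    have "\<forall>\<^sub>F k in sequentially. p k < 1/2" using order_tendstoD(2)[OF p0, of "1/2"] by simp
    with p show "\<forall>\<^sub>F k in sequentially. real (n k) * p k \<le> real (n k) * a k"
    proof eventually_elim
      case (elim k)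
      then have "p k * 1 \<le> p k * (2 * (1 - p k))" by (intro mult_left_mono) auto
      then show ?case unfolding a_def by (intro mult_left_mono) (auto simp: algebra_simps)
    qed
  qed
  have r: "filterlim r at_top sequentially"
    unfolding r_def by (rule filterlim_compose[OF sqrt_at_top na])
  have ok: "\<forall>\<^sub>F k in sequentially. ok k"
  proof -
    have "\<forall>\<^sub>F k in sequentially. a k < 1/2" using order_tendstoD(2)[OF a0, of "1/2"] by simp
    moreover have "\<forall>\<^sub>F k in sequentially. 0 < r k"
      using r by (simp add: filterlim_at_top_dense)
    ultimately show ?thesis using p
      by eventually_elim (auto simp: ok_def a_def)
  qed
  have "(\<lambda>k. \<integral>x. (if ok k then g k x else 0) \<partial>lborel) \<longlonglongrightarrow> (\<integral>x. exp (- x\<^sup>2 / 2) \<partial>lborel)"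
  proof (rule integral_dominated_convergence[where w = "\<lambda>x. exp (- x\<^sup>2 / 8)"])
    show "integrable lborel (\<lambda>x::real. exp (- x\<^sup>2 / 8))"
    proof -
      have "integrable lborel (\<lambda>x::real. exp (- (0 + (1/2) * x)\<^sup>2 / 2))"
        by (rule lborel_integrable_real_affine[OF gaussian_integral(1)]) simp
      then show ?thesis by (simp add: power_mult_distrib power_divide)
    qed
    show "AE x in lborel. norm (if ok k then g k x else 0) \<le> exp (- x\<^sup>2 / 8)" for k
    proof (intro AE_I2)
      fix x :: real
      show "norm (if ok k then g k x else 0) \<le> exp (- x\<^sup>2 / 8)"
      proof (cases "ok k \<and> x / r k \<in> {-pi..pi}")
        case True
        define u where "u = x / r k"
        from True have ok: "0 \<le> a k" "a k \<le> 1/2" "0 < r k" and u: "\<bar>u\<bar> \<le> pi"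
          by (auto simp: ok_def u_def)
        have v: "0 \<le> 1 - a k * (1 - cos u)" "1 - a k * (1 - cos u) \<le> exp (- (a k * (1 - cos u)))"
        proof -
          have "a k * (1 - cos u) \<le> (1/2) * 2"
            using ok cos_ge_minus_one[of u] by (intro mult_mono) auto
          then show "0 \<le> 1 - a k * (1 - cos u)" by simp
          show "1 - a k * (1 - cos u) \<le> exp (- (a k * (1 - cos u)))"
            using exp_ge_add_one_self[of "- (a k * (1 - cos u))"] by simp
        qed
        have "norm (g k x) \<le> (1 - a k * (1 - cos u)) ^ n k"
          using True v by (simp add: g_def u_def[symmetric] abs_mult power_abs mult_left_le)
        also have "\<dots> \<le> exp (- (a k * (1 - cos u))) ^ n k" using v by (intro power_mono)
        also have "\<dots> = exp (- (real (n k) * a k * (1 - cos u)))"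
          by (simp add: exp_of_nat_mult[symmetric] mult_ac)
        also have "\<dots> \<le> exp (- (real (n k) * a k * (u\<^sup>2 / 8)))"
          using one_minus_cos_ge[OF u] ok by (simp add: mult_left_mono del: times_divide_eq_right)
        also have "real (n k) * a k * (u\<^sup>2 / 8) = x\<^sup>2 / 8"
        proof -
          have "real (n k) * a k = (r k)\<^sup>2" using ok by (simp add: r_def)
          then show ?thesis using ok by (simp add: u_def power_divide)
        qed
        finally show ?thesis using True by simp
      qed (auto simp: g_def)
    qed
    show "AE x in lborel. (\<lambda>k. if ok k then g k x else 0) \<longlonglongrightarrow> exp (- x\<^sup>2 / 2)"
    proof (intro AE_I2)
      fix x :: real
      have xr: "(\<lambda>k. x / r k) \<longlonglongrightarrow> 0"
        using r by (intro tendsto_divide_0[OF tendsto_const] filterlim_at_top_imp_at_infinity)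
      have "\<forall>\<^sub>F k in sequentially. \<bar>x / r k\<bar> < pi"
        using order_tendstoD(2)[OF tendsto_rabs[OF xr], of pi] by simp
      then have ind: "(\<lambda>k. indicator {-pi..pi} (x / r k) :: real) \<longlonglongrightarrow> 1"
        by (intro tendsto_eventually) (auto simp: abs_less_iff simp del: abs_divide elim!: eventually_mono)
      have "((\<lambda>r. r\<^sup>2 * (1 - cos (x / r))) \<longlongrightarrow> x\<^sup>2 / 2) at_top"
        by (real_asymp simp: power2_eq_square)
      from filterlim_compose[OF this r]
      have "(\<lambda>k. (r k)\<^sup>2 * (1 - cos (x / r k))) \<longlonglongrightarrow> x\<^sup>2 / 2" .
      moreover have "\<forall>\<^sub>F k in sequentially. (r k)\<^sup>2 * (1 - cos (x / r k))
          = real (n k) * (a k * (1 - cos (x / r k)))"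
        using ok by eventually_elim (simp add: ok_def r_def)
      ultimately have 1: "(\<lambda>k. real (n k) * (a k * (1 - cos (x / r k)))) \<longlonglongrightarrow> x\<^sup>2 / 2"
        by (rule Lim_transform_eventually)
      have 2: "(\<lambda>k. a k * (1 - cos (x / r k))) \<longlonglongrightarrow> 0"
        using tendsto_mult[OF a0 tendsto_diff[OF tendsto_const tendsto_cos[OF xr]], of 1] by simp
      have 3: "(\<lambda>k. cos (x / r k * real_of_int j)) \<longlonglongrightarrow> 1"
        using tendsto_cos[OF tendsto_mult_left_zero[OF xr]] by simp
      have "(\<lambda>k. g k x) \<longlonglongrightarrow> 1 * (exp (- (x\<^sup>2 / 2)) * 1)"
        unfolding g_def by (intro tendsto_mult ind power_one_minus_tendsto_exp 1 2 3)
      then have "(\<lambda>k. g k x) \<longlonglongrightarrow> exp (- x\<^sup>2 / 2)" by simp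
      then show "(\<lambda>k. if ok k then g k x else 0) \<longlonglongrightarrow> exp (- x\<^sup>2 / 2)"
        by (rule Lim_transform_eventually) (use ok in eventually_elim, simp)
    qed
    show "(\<lambda>x. if ok k then g k x else 0) \<in> borel_measurable lborel" for k
      unfolding g_def by (cases "ok k") measurable
  qed simp
  then have lim: "(\<lambda>k. (\<integral>x. (if ok k then g k x else 0) \<partial>lborel) / (2 * pi)) \<longlonglongrightarrow> sqrt (2 * pi) / (2 * pi)"
    unfolding gaussian_integral(2) by (intro tendsto_intros) auto
  have "sqrt (2 * pi) / (2 * pi) = 1 / sqrt (2 * pi)"
    by (simp add: real_div_sqrt field_simps)
  with lim have lim': "(\<lambda>k. (\<integral>x. (if ok k then g k x else 0) \<partial>lborel) / (2 * pi)) \<longlonglongrightarrow> 1 / sqrt (2 * pi)"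
    by simp
  show ?thesis
  proof (rule Lim_transform_eventually[OF lim'])
    show "\<forall>\<^sub>F k in sequentially. (\<integral>x. (if ok k then g k x else 0) \<partial>lborel) / (2 * pi)
        = sqrt (2 * real (n k) * p k * (1 - p k)) * balanced_prob (p k) (n k) j"
      using ok
    proof eventually_elim
      case (elim k)
      then have rk: "r k > 0" by (simp add: ok_def)
      let ?f = "\<lambda>\<theta>. indicator {-pi..pi} \<theta> * ((1 - a k * (1 - cos \<theta>)) ^ n k * cos (\<theta> * real_of_int j))"
      have "(\<integral>\<theta>. ?f \<theta> \<partial>lborel) = \<bar>1 / r k\<bar> *\<^sub>R (\<integral>x. ?f (0 + 1 / r k * x) \<partial>lborel)"
        using rk by (intro lborel_integral_real_affine) simp
      also have "\<dots> = (\<integral>x. g k x \<partial>lborel) / r k"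
        using rk by (simp add: g_def)
      finally have "(\<integral>x. g k x \<partial>lborel) = r k * (\<integral>\<theta>. ?f \<theta> \<partial>lborel)"
        using rk by simp
      also have "\<dots> = 2 * pi * (r k * balanced_prob (p k) (n k) j)"
        by (simp add: balanced_prob_def a_def set_lebesgue_integral_def mult_ac)
      finally show ?case using elim by (simp add: r_def a_def mult_ac)
    qed
  qed
qed


text \<open>A Taylor expansion in the expected number m p of chosen elements, where m =
  \<open>card T\<close>. One more element changes the mean by p times the average increment of
  \<open>h\<close>. By the first bound this increment differs from \<open>h 1 - h 0\<close> by at
  most 4 m p, and summing these errors over the elements gives the quadratic bound.\<close>

lemma subset_mean_count_approx:
  fixes h :: "nat \<Rightarrow> real"
  assumes p: "0 \<le> p" "p \<le> 1" and T: "finite T" and h: "\<And>k. \<bar>h k\<bar> \<le> 1"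
  shows "\<bar>subset_mean p T (\<lambda>Y. h (card Y)) - h 0\<bar> \<le> 2 * (real (card T) * p)"
    and "\<bar>subset_mean p T (\<lambda>Y. h (card Y)) - h 0 - real (card T) * p * (h 1 - h 0)\<bar>
      \<le> 2 * (real (card T) * p)\<^sup>2"
proof -
  have step: "subset_mean p (insert a S) (\<lambda>Y. h (card Y)) = subset_mean p S (\<lambda>Y. h (card Y))
      + p * (subset_mean p S (\<lambda>Y. h (Suc (card Y))) - subset_mean p S (\<lambda>Y. h (card Y)))"
    if "finite S" "a \<notin> S" for a and S :: "'a set" and h :: "nat \<Rightarrow> real"
  proof -
    have "subset_mean p S (\<lambda>X. h (card (insert a X))) = subset_mean p S (\<lambda>X. h (Suc (card X)))"
      using that by (intro subset_mean_cong)
        (subst card_insert_disjoint, auto intro: finite_subset)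
    then show ?thesis using that by (simp add: subset_mean_insert algebra_simps)
  qed
  have le1: "\<bar>subset_mean p S (\<lambda>Y. h (card Y))\<bar> \<le> 1" if "finite S" "\<And>k. \<bar>h k\<bar> \<le> 1"
    for S :: "'a set" and h :: "nat \<Rightarrow> real"
    using norm_subset_mean_bound[OF p that(1), of "\<lambda>Y. h (card Y)" 1] that(2) by simp
  have first: "\<bar>subset_mean p S (\<lambda>Y. h (card Y)) - h 0\<bar> \<le> 2 * (real (card S) * p)"
    if "finite S" "\<And>k. \<bar>h k\<bar> \<le> 1" for S :: "'a set" and h :: "nat \<Rightarrow> real"
    using that(1)
  proof (induction S rule: finite_induct)
    case (insert a S)
    let ?e = "subset_mean p S (\<lambda>Y. h (card Y))" and ?e' = "subset_mean p S (\<lambda>Y. h (Suc (card Y)))"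
    have "\<bar>?e' - ?e\<bar> \<le> 2"
      using le1[OF insert.hyps(1), of h] le1[OF insert.hyps(1), of "\<lambda>k. h (Suc k)"] that(2)
      by (simp add: abs_le_iff)
    then have "\<bar>p * (?e' - ?e)\<bar> \<le> p * 2" using p by (simp add: abs_mult mult_left_mono)
    then show ?case using insert unfolding step[OF insert.hyps]
      by (simp add: algebra_simps)
  qed simp
  show "\<bar>subset_mean p T (\<lambda>Y. h (card Y)) - h 0\<bar> \<le> 2 * (real (card T) * p)"
    using first[OF T h] .
  show "\<bar>subset_mean p T (\<lambda>Y. h (card Y)) - h 0 - real (card T) * p * (h 1 - h 0)\<bar>
      \<le> 2 * (real (card T) * p)\<^sup>2"
    using T
  proof (induction T rule: finite_induct)
    case (insert a S)
    let ?e = "subset_mean p S (\<lambda>Y. h (card Y))" and ?e' = "subset_mean p S (\<lambda>Y. h (Suc (card Y)))"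
    let ?d = "real (card S)"
    have "\<bar>(?e' - ?e) - (h 1 - h 0)\<bar> \<le> 4 * (?d * p)"
      using first[OF insert.hyps(1), of h] first[OF insert.hyps(1), of "\<lambda>k. h (Suc k)"] h
      by (simp add: abs_le_iff)
    then have "\<bar>p * ((?e' - ?e) - (h 1 - h 0))\<bar> \<le> p * (4 * (?d * p))"
      using p by (simp add: abs_mult mult_left_mono)
    then have *: "\<bar>p * (?e' - ?e) - p * (h 1 - h 0)\<bar> \<le> 4 * ?d * p\<^sup>2"
      by (simp add: algebra_simps power2_eq_square)
    have c: "real (card (insert a S)) = ?d + 1" using insert.hyps by simp
    have "?e + p * (?e' - ?e) - h 0 - (?d + 1) * p * (h 1 - h 0)
       = (?e - h 0 - ?d * p * (h 1 - h 0)) + (p * (?e' - ?e) - p * (h 1 - h 0))"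
      by (simp add: algebra_simps)
    also have "\<bar>\<dots>\<bar> \<le> 2 * (?d * p)\<^sup>2 + 4 * ?d * p\<^sup>2"
      using * insert.IH by linarith
    also have "\<dots> \<le> 2 * ((?d + 1) * p)\<^sup>2"
      by (simp add: power2_eq_square algebra_simps)
    finally show ?case unfolding step[OF insert.hyps] c .
  qed simp
qed

section \<open>Symmetry of balanced tallies, and colour classes of unequal size\<close>

lemma balanced_prob_uminus: "balanced_prob p n (- j) = balanced_prob p n j"
  by (simp add: balanced_prob_def)

lemma subset_mean_balanced:
  fixes f :: "int \<Rightarrow> real"
  assumes "finite B" "finite R" "B \<inter> R = {}" "card B = n" "card R = n"
  shows "subset_mean p (B \<union> R) (\<lambda>Z. f (tally B R Z))
    = (\<Sum>j\<in>{- int (2 * n)..int (2 * n)}. f j * balanced_prob p n j)"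
proof -
  have "card (B \<union> R) = 2 * n" using assms by (simp add: card_Un_disjoint)
  then have mem: "tally B R Z \<in> {- int (2 * n)..int (2 * n)}" for Z
    using abs_tally_le[OF assms(1-3), of Z] by auto
  have "subset_mean p (B \<union> R) (\<lambda>Z. f (tally B R Z)) = subset_mean p (B \<union> R)
      (\<lambda>Z. \<Sum>j\<in>{- int (2 * n)..int (2 * n)}. f j * of_bool (tally B R Z = j))"
  proof (intro subset_mean_cong)
    fix Z
    have "(\<Sum>j\<in>{- int (2 * n)..int (2 * n)}. f j * of_bool (tally B R Z = j))
       = (\<Sum>j\<in>{- int (2 * n)..int (2 * n)}. if tally B R Z = j then f j else 0)"
      by (intro sum.cong) auto
    also have "\<dots> = f (tally B R Z)" using mem by (subst sum.delta') auto
    finally show "f (tally B R Z) = (\<Sum>j\<in>{- int (2 * n)..int (2 * n)}. f j * of_bool (tally B R Z = j))" ..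
  qed
  also have "\<dots> = (\<Sum>j\<in>{- int (2 * n)..int (2 * n)}. f j * balanced_prob p n j)"
    by (simp only: subset_mean_sum subset_mean_mult_left balanced_prob[OF assms])
  finally show ?thesis .
qed

lemma subset_mean_balanced_uminus:
  fixes f :: "int \<Rightarrow> real"
  assumes "finite B" "finite R" "B \<inter> R = {}" "card B = n" "card R = n"
  shows "subset_mean p (B \<union> R) (\<lambda>Z. f (- tally B R Z)) = subset_mean p (B \<union> R) (\<lambda>Z. f (tally B R Z))"
  unfolding subset_mean_balanced[OF assms, where f = "\<lambda>j. f (- j)"] subset_mean_balanced[OF assms, of p f]
  by (rule sum.reindex_bij_witness[of _ uminus uminus]) (auto simp: balanced_prob_uminus)

text \<open>The tally D has a symmetric law. Therefore the mean of sgn (D + 1) is half the mean of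
  sgn (D + 1) - sgn (D - 1), and this difference is 2 at D = 0, is 1 at D = 1 and at D = -1, and
  vanishes elsewhere.\<close>

lemma subset_mean_balanced_sgn:
  assumes "finite B" "finite R" "B \<inter> R = {}" "card B = n" "card R = n"
  shows "subset_mean p (B \<union> R) (\<lambda>Z. real_of_int (sgn (tally B R Z))) = 0"
    and "subset_mean p (B \<union> R) (\<lambda>Z. real_of_int (sgn (tally B R Z + 1)))
      = balanced_prob p n 0 + balanced_prob p n 1"
proof -
  let ?E = "\<lambda>f. subset_mean p (B \<union> R) (\<lambda>Z. f (tally B R Z)) :: real"
  have neg: "?E (\<lambda>j. - f j) = - ?E f" for f :: "int \<Rightarrow> real"
    using subset_mean_mult_left[of p "B \<union> R" "-1" "\<lambda>Z. f (tally B R Z)"] by simp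
  have "?E (\<lambda>j. real_of_int (sgn (- j))) = ?E (\<lambda>j. real_of_int (sgn j))"
    by (rule subset_mean_balanced_uminus[OF assms])
  then show "?E (\<lambda>j. real_of_int (sgn j)) = 0"
    using neg[of "\<lambda>j. real_of_int (sgn j)"] by (simp add: sgn_minus)
  have sg: "real_of_int (sgn (- j + 1)) = - real_of_int (sgn (j - 1))" for j
    by (simp add: sgn_if)
  have "?E (\<lambda>j. real_of_int (sgn (j + 1))) = ?E (\<lambda>j. real_of_int (sgn (- j + 1)))"
    by (rule subset_mean_balanced_uminus[OF assms, symmetric])
  also have "\<dots> = - ?E (\<lambda>j. real_of_int (sgn (j - 1)))"
    unfolding sg by (rule neg)
  finally have "2 * ?E (\<lambda>j. real_of_int (sgn (j + 1)))
     = ?E (\<lambda>j. real_of_int (sgn (j + 1))) - ?E (\<lambda>j. real_of_int (sgn (j - 1)))" by simp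
  also have "\<dots> = ?E (\<lambda>j. real_of_int (sgn (j + 1)) - real_of_int (sgn (j - 1)))"
    by (simp add: subset_mean_diff)
  also have "\<dots> = ?E (\<lambda>j. 2 * of_bool (j = 0) + (of_bool (j = 1) + of_bool (j = - 1)))"
    by (intro subset_mean_cong) (auto simp: sgn_if)
  also have "\<dots> = 2 * balanced_prob p n 0 + 2 * balanced_prob p n 1"
    using balanced_prob_uminus[of p n 1]
    by (simp add: subset_mean_add subset_mean_mult_left balanced_prob[OF assms])
  finally show "?E (\<lambda>j. real_of_int (sgn (j + 1))) = balanced_prob p n 0 + balanced_prob p n 1" by simp
qed

text \<open>The surplus \<open>B - B0\<close> of the larger class is averaged last: given the
  balanced part, it acts only through the number of its chosen vertices, so
  \<open>subset_mean_count_approx\<close> applies. The choice of \<open>B0\<close> is immaterial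
  later, since balanced means depend only on the common size of the classes.\<close>

lemma unbalanced_mean:
  fixes f :: "int \<Rightarrow> real"
  assumes p: "0 \<le> p" "p \<le> 1" and fin: "finite B" "finite R" and disj: "B \<inter> R = {}"
    and le: "card R \<le> card B" and f: "\<And>j. \<bar>f j\<bar> \<le> 1"
  obtains B0 where "B0 \<subseteq> B" "card B0 = card R"
    "\<bar>subset_mean p (B \<union> R) (\<lambda>Z. f (tally B R Z))
       - subset_mean p (B0 \<union> R) (\<lambda>Z. f (tally B0 R Z))\<bar> \<le> 2 * (real (card B - card R) * p)"
    "\<bar>subset_mean p (B \<union> R) (\<lambda>Z. f (tally B R Z)) - subset_mean p (B0 \<union> R) (\<lambda>Z. f (tally B0 R Z))
       - real (card B - card R) * p * (subset_mean p (B0 \<union> R) (\<lambda>Z. f (tally B0 R Z + 1))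
            - subset_mean p (B0 \<union> R) (\<lambda>Z. f (tally B0 R Z)))\<bar>
     \<le> 2 * (real (card B - card R) * p)\<^sup>2"
proof -
  obtain B0 where B0: "B0 \<subseteq> B" "card B0 = card R" using obtain_subset_with_card_n[OF le] by metis
  define T where "T = B - B0"
  have fB0: "finite B0" using B0 fin finite_subset by blast
  have T: "finite T" "card T = card B - card R" "T \<inter> (B0 \<union> R) = {}" "T \<union> (B0 \<union> R) = B \<union> R"
    using B0 fin disj fB0 by (auto simp: T_def card_Diff_subset)
  define h where "h k = subset_mean p (B0 \<union> R) (\<lambda>Z. f (tally B0 R Z + int k))" for k
  have tally: "tally B R (Y \<union> X) = tally B0 R X + int (card Y)" if "Y \<subseteq> T" "X \<subseteq> B0 \<union> R" for X Y
  proof -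
    have "(Y \<union> X) \<inter> B = Y \<union> (X \<inter> B0)" "(Y \<union> X) \<inter> R = X \<inter> R" "Y \<inter> (X \<inter> B0) = {}" "finite Y"
      using that B0 disj T(1) by (auto simp: T_def intro: finite_subset)
    then show ?thesis using fB0 by (simp add: tally_def card_Un_disjoint)
  qed
  have "subset_mean p (T \<union> (B0 \<union> R)) (\<lambda>Z. f (tally B R Z))
     = subset_mean p T (\<lambda>Y. subset_mean p (B0 \<union> R) (\<lambda>X. f (tally B R (Y \<union> X))))"
    using T fB0 fin by (intro subset_mean_union) auto
  also have "\<dots> = subset_mean p T (\<lambda>Y. h (card Y))"
    unfolding h_def by (intro subset_mean_cong) (simp add: tally)
  finally have E: "subset_mean p (B \<union> R) (\<lambda>Z. f (tally B R Z)) = subset_mean p T (\<lambda>Y. h (card Y))"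
    using T by simp
  have h: "\<bar>h k\<bar> \<le> 1" for k
    unfolding h_def using norm_subset_mean_bound[OF p, of "B0 \<union> R" "\<lambda>Z. f (tally B0 R Z + int k)" 1] f fB0 fin
    by simp
  show ?thesis
    using that[OF B0] subset_mean_count_approx[where h = h, OF p T(1) h] unfolding E T(2) by (simp add: h_def)
qed

lemma unbalanced_prob:
  assumes p: "0 \<le> p" "p \<le> 1" and fin: "finite B" "finite R" and disj: "B \<inter> R = {}"
  shows "\<bar>subset_mean p (B \<union> R) (\<lambda>Z. of_bool (tally B R Z = j)) - balanced_prob p (min (card B) (card R)) j\<bar>
    \<le> 2 * (\<bar>real (card B) - real (card R)\<bar> * p)"
proof -
  have main: "\<bar>subset_mean p (B \<union> R) (\<lambda>Z. of_bool (tally B R Z = j)) - balanced_prob p (card R) j\<bar>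
    \<le> 2 * ((real (card B) - real (card R)) * p)"
    if fin: "finite B" "finite R" and disj: "B \<inter> R = {}" and le: "card R \<le> card B" for B R :: "'a set" and j
  proof -
    obtain B0 where B0: "B0 \<subseteq> B" "card B0 = card R"
      "\<bar>subset_mean p (B \<union> R) (\<lambda>Z. of_bool (tally B R Z = j))
       - subset_mean p (B0 \<union> R) (\<lambda>Z. of_bool (tally B0 R Z = j))\<bar> \<le> 2 * (real (card B - card R) * p)"
      by (rule unbalanced_mean[OF p fin disj le, of "\<lambda>i. of_bool (i = j)"]) auto
    have "finite B0" "B0 \<inter> R = {}" using B0 fin disj finite_subset by blast+
    with B0(2,3) show ?thesis
      using balanced_prob[of B0 R "card R" p j] fin le by (simp add: of_nat_diff)
  qed
  show ?thesis
  proof (cases "card R \<le> card B")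
    case True
    then show ?thesis using main[OF fin disj True, of j] by simp
  next
    case False
    have "subset_mean p (B \<union> R) (\<lambda>Z. of_bool (tally B R Z = j))
       = (subset_mean p (R \<union> B) (\<lambda>Z. of_bool (tally R B Z = - j)) :: real)"
      unfolding tally_swap[of R B] by (simp add: sup.commute)
    with False show ?thesis
      using main[of R B "- j"] fin disj by (simp add: balanced_prob_uminus Int_commute)
  qed
qed

text \<open>With balanced classes the mean sign is 0, and one surplus vote raises it to
  \<open>balanced_prob p n 0 + balanced_prob p n 1\<close>; the expected surplus is d p. If red is
  larger, exchanging the classes reverses both the sign and d.\<close>

lemma unbalanced_sgn:
  assumes p: "0 \<le> p" "p \<le> 1" and fin: "finite B" "finite R" and disj: "B \<inter> R = {}"
  defines "n \<equiv> min (card B) (card R)" and "d \<equiv> real (card B) - real (card R)"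
  shows "\<bar>subset_mean p (B \<union> R) (\<lambda>Z. real_of_int (sgn (tally B R Z)))
      - d * p * (balanced_prob p n 0 + balanced_prob p n 1)\<bar> \<le> 2 * (d * p)\<^sup>2"
proof -
  have main: "\<bar>subset_mean p (B \<union> R) (\<lambda>Z. real_of_int (sgn (tally B R Z)))
      - (real (card B) - real (card R)) * p * (balanced_prob p (card R) 0 + balanced_prob p (card R) 1)\<bar>
      \<le> 2 * ((real (card B) - real (card R)) * p)\<^sup>2"
    if fin: "finite B" "finite R" and disj: "B \<inter> R = {}" and le: "card R \<le> card B" for B R :: "'a set"
  proof -
    obtain B0 where B0: "B0 \<subseteq> B" "card B0 = card R"
      "\<bar>subset_mean p (B \<union> R) (\<lambda>Z. real_of_int (sgn (tally B R Z)))
       - subset_mean p (B0 \<union> R) (\<lambda>Z. real_of_int (sgn (tally B0 R Z)))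
       - real (card B - card R) * p * (subset_mean p (B0 \<union> R) (\<lambda>Z. real_of_int (sgn (tally B0 R Z + 1)))
            - subset_mean p (B0 \<union> R) (\<lambda>Z. real_of_int (sgn (tally B0 R Z))))\<bar>
     \<le> 2 * (real (card B - card R) * p)\<^sup>2"
      by (rule unbalanced_mean[OF p fin disj le, of "\<lambda>i. real_of_int (sgn i)"]) (auto simp: sgn_if)
    have "finite B0" "B0 \<inter> R = {}" using B0 fin disj finite_subset by blast+
    with B0(2,3) show ?thesis
      using subset_mean_balanced_sgn[of B0 R "card R" p] fin le by (simp add: of_nat_diff)
  qed
  show ?thesis
  proof (cases "card R \<le> card B")
    case True
    then show ?thesis using main[OF fin disj True] by (simp add: n_def d_def)
  next
    case False
    have "subset_mean p (B \<union> R) (\<lambda>Z. real_of_int (sgn (tally B R Z)))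
       = - subset_mean p (R \<union> B) (\<lambda>Z. real_of_int (sgn (tally R B Z)))"
      unfolding tally_swap[of R B]
      using subset_mean_mult_left[of p "B \<union> R" "-1" "\<lambda>Z. real_of_int (sgn (tally B R Z))"]
      by (simp add: sup.commute sgn_minus)
    moreover have "(d * p)\<^sup>2 = ((real (card R) - real (card B)) * p)\<^sup>2"
      unfolding d_def by (simp add: power2_eq_square algebra_simps)
    ultimately show ?thesis
      using False main[of R B] fin disj by (simp add: n_def d_def Int_commute algebra_simps)
  qed
qed


section \<open>The first day\<close>

text \<open>The update rule as a function of the consulted set \<open>Z\<close>, so that it also
  makes sense for neighbourhoods that do not come from one common graph.\<close>

definition vote :: "nat \<Rightarrow> (nat \<Rightarrow> int) \<Rightarrow> nat set \<Rightarrow> nat \<Rightarrow> int" where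
  "vote N y Z v = (let d = tally (blue N y) (red N y) Z in if d = 0 then y v else sgn d)"

lemma configs_values: "y \<in> configs N \<Longrightarrow> v \<in> {1..N} \<Longrightarrow> y v = 1 \<or> y v = - 1"
  by (auto simp: configs_def PiE_def Pi_def)

lemma finite_configs [simp]: "finite (configs N)"
  unfolding configs_def by (intro finite_PiE) auto

lemma blue_red:
  assumes "y \<in> configs N"
  shows "finite (blue N y)" "finite (red N y)" "blue N y \<inter> red N y = {}" "blue N y \<union> red N y = {1..N}"
  using configs_values[OF assms] by (simp add: blue_def, simp add: red_def,
    auto simp: blue_def red_def, force)

lemma bias_eq_sum:
  assumes "y \<in> configs N"
  shows "bias N y = (\<Sum>v\<in>{1..N}. real_of_int (y v))"
proof -
  have "(\<Sum>v\<in>blue N y \<union> red N y. real_of_int (y v))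
     = (\<Sum>v\<in>blue N y. real_of_int (y v)) + (\<Sum>v\<in>red N y. real_of_int (y v))"
    using blue_red[OF assms] by (intro sum.union_disjoint) auto
  also have "(\<Sum>v\<in>blue N y. real_of_int (y v)) = real (card (blue N y))" by (simp add: blue_def)
  also have "(\<Sum>v\<in>red N y. real_of_int (y v)) = - real (card (red N y))" by (simp add: red_def)
  finally show ?thesis using blue_red[OF assms] by (simp add: bias_def)
qed

lemma majority_step_vote: "v \<in> {1..N} \<Longrightarrow> majority_step N E y v = vote N y (nbrs E v) v"
  by (auto simp: majority_step_def vote_def tally_def Let_def)

lemma vote_values: "y \<in> configs N \<Longrightarrow> v \<in> {1..N} \<Longrightarrow> vote N y Z v = 1 \<or> vote N y Z v = - 1"
  using configs_values[of y N v] by (auto simp: vote_def Let_def sgn_if)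

lemma majority_step_configs: "y \<in> configs N \<Longrightarrow> majority_step N E y \<in> configs N"
  using vote_values[of y N] majority_step_vote[of _ N E y]
  by (fastforce simp: configs_def PiE_def extensional_def majority_step_def)

lemma tally_insert:
  assumes "y \<in> configs N" "v \<in> {1..N}" "v \<notin> Z" "finite Z"
  shows "tally (blue N y) (red N y) (insert v Z) = tally (blue N y) (red N y) Z + y v"
proof (cases "y v = 1")
  case True
  then have "insert v Z \<inter> blue N y = insert v (Z \<inter> blue N y)" "insert v Z \<inter> red N y = Z \<inter> red N y"
    using assms by (auto simp: blue_def red_def)
  then show ?thesis using assms True by (simp add: tally_def)
next
  case False
  then have m: "y v = - 1" using configs_values assms by blast
  then have "insert v Z \<inter> red N y = insert v (Z \<inter> red N y)" "insert v Z \<inter> blue N y = Z \<inter> blue N y"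
    using assms by (auto simp: blue_def red_def)
  then show ?thesis using assms m by (simp add: tally_def)
qed

text \<open>The arrival of \<open>v\<close> changes the vote of \<open>u\<close> only across the point where the tie-breaking rule
  switches; in all four cases this happens at the tally \<open>- (y u + y v) / 2\<close>.\<close>

lemma cis_vote_insert:
  assumes y: "y \<in> configs N" and uv: "u \<in> {1..N}" "v \<in> {1..N}" and Z: "v \<notin> Z" "finite Z"
  shows "cis (s * real_of_int (vote N y (insert v Z) u)) - cis (s * real_of_int (vote N y Z u))
     = 2 * \<i> * of_real (sin s) * of_int (y v)
        * of_real (of_bool (2 * tally (blue N y) (red N y) Z = - (y u + y v)))"
proof -
  define d where "d = tally (blue N y) (red N y) Z"
  have d': "tally (blue N y) (red N y) (insert v Z) = d + y v"
    unfolding d_def by (rule tally_insert[OF y uv(2) Z])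
  have cis: "cis s - cis (- s) = 2 * \<i> * of_real (sin s)" "cis (- s) - cis s = - (2 * \<i> * of_real (sin s))"
    by (auto simp: complex_eq_iff)
  consider "y u = 1" "y v = 1" | "y u = 1" "y v = - 1" | "y u = - 1" "y v = 1" | "y u = - 1" "y v = - 1"
    using configs_values[OF y uv(1)] configs_values[OF y uv(2)] by blast
  then show ?thesis
  proof cases
    case 1
    then have "vote N y (insert v Z) u = (if d \<ge> -1 then 1 else -1)" "vote N y Z u = (if d \<ge> 0 then 1 else -1)"
      "2 * d = - (y u + y v) \<longleftrightarrow> d = -1"
      unfolding vote_def d' d_def[symmetric] by (auto simp: Let_def sgn_if)
    then show ?thesis using 1 cis unfolding d_def[symmetric] by auto
  next
    case 2
    then have "vote N y (insert v Z) u = (if d \<ge> 1 then 1 else -1)" "vote N y Z u = (if d \<ge> 0 then 1 else -1)"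
      "2 * d = - (y u + y v) \<longleftrightarrow> d = 0"
      unfolding vote_def d' d_def[symmetric] by (auto simp: Let_def sgn_if)
    then show ?thesis using 2 cis unfolding d_def[symmetric] by auto
  next
    case 3
    then have "vote N y (insert v Z) u = (if d \<ge> 0 then 1 else -1)" "vote N y Z u = (if d \<ge> 1 then 1 else -1)"
      "2 * d = - (y u + y v) \<longleftrightarrow> d = 0"
      unfolding vote_def d' d_def[symmetric] by (auto simp: Let_def sgn_if)
    then show ?thesis using 3 cis unfolding d_def[symmetric] by auto
  next
    case 4
    then have "vote N y (insert v Z) u = (if d \<ge> 2 then 1 else -1)" "vote N y Z u = (if d \<ge> 1 then 1 else -1)"
      "2 * d = - (y u + y v) \<longleftrightarrow> d = 1"
      unfolding vote_def d' d_def[symmetric] by (auto simp: Let_def sgn_if)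
    then show ?thesis using 4 cis unfolding d_def[symmetric] by auto
  qed
qed

lemma norm_cis_minus_one_le: "norm (cis x - 1) \<le> \<bar>x\<bar>"
  using iexp_approx1[of x 0] by (simp add: cis_conv_exp)

text \<open>The edges in \<open>A\<close> are shared by their endpoints; for every other pair, each endpoint consults
  a coin of its own.\<close>

definition slot :: "nat set set \<Rightarrow> nat \<Rightarrow> nat \<Rightarrow> nat \<times> nat" where
  "slot A w v = (if {w, v} \<in> A then (min w v, max w v) else (w, v))"

definition view :: "nat \<Rightarrow> nat set set \<Rightarrow> (nat \<times> nat) set \<Rightarrow> nat \<Rightarrow> nat set" where
  "view N A X w = {v \<in> {1..N} - {w}. slot A w v \<in> X}"

definition slots :: "nat \<Rightarrow> (nat \<times> nat) set" where
  "slots N = {(u, v). u \<in> {1..N} \<and> v \<in> {1..N} \<and> u \<noteq> v}"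

text \<open>The characteristic function of the sum of the votes, interpolating between independent
  votes, for \<open>A = {}\<close>, and the true dynamics, for \<open>A = all_edges N\<close>. The
  coins are the ordered pairs in \<open>slots N\<close>; for a shared edge only the increasing pair
  is read and the other coin is idle.\<close>

definition hybrid_char :: "nat \<Rightarrow> real \<Rightarrow> (nat \<Rightarrow> int) \<Rightarrow> real \<Rightarrow> nat set set \<Rightarrow> complex" where
  "hybrid_char N p y s A = subset_mean p (slots N)
     (\<lambda>X. \<Prod>w\<in>{1..N}. cis (s * real_of_int (vote N y (view N A X w) w)))"


section \<open>Coins, views and the effect of sharing one edge\<close>

lemma finite_slots [simp]: "finite (slots N)"
  by (rule finite_subset[of _ "{1..N} \<times> {1..N}"]) (auto simp: slots_def)

lemma slot_pair: "slot A w v = (a, b) \<Longrightarrow> {w, v} = {a, b}"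
  by (auto simp: slot_def min_def max_def split: if_splits)

lemma slot_in_slots: "w \<in> {1..N} \<Longrightarrow> v \<in> {1..N} - {w} \<Longrightarrow> slot A w v \<in> slots N"
  by (auto simp: slot_def slots_def min_def max_def)

lemma slot_eqD: "slot A w v = slot A w' v' \<Longrightarrow> {w, v} = {w', v'}"
  by (metis slot_pair surj_pair)

lemma slot_inj: "inj_on (slot A w) S"
  by (rule inj_onI) (metis slot_eqD doubleton_eq_iff)

lemma finite_view [simp]: "finite (view N A X w)"
  by (simp add: view_def)

lemma norm_cis_vote_diff:
  assumes "y \<in> configs N" "w \<in> {1..N}"
  shows "norm (cis (s * real_of_int (vote N y Z w)) - cis (s * real_of_int (vote N y Z' w))) \<le> 2 * \<bar>s\<bar>"
proof -
  have "norm (cis s - cis (- s)) \<le> 2 * \<bar>s\<bar>"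
  proof -
    have "cis s - cis (- s) = of_real (2 * sin s) * \<i>" by (auto simp: complex_eq_iff)
    then have "norm (cis s - cis (- s)) = 2 * \<bar>sin s\<bar>" by (simp add: norm_mult)
    then show ?thesis using abs_sin_x_le_abs_x[of s] by simp
  qed
  then show ?thesis using vote_values[OF assms, of Z] vote_values[OF assms, of Z']
    by (auto simp: norm_minus_commute)
qed

text \<open>A coupling: removing \<open>D\<close> matters only if the random set meets
  \<open>D\<close>, and the number of points in which it does so has mean p
  \<open>card D\<close>.\<close>

lemma subset_mean_remove:
  fixes g :: "'a set \<Rightarrow> real"
  assumes p: "0 \<le> p" "p \<le> 1" and S: "finite S" "D \<subseteq> S" and g: "\<And>X. \<bar>g X\<bar> \<le> 1"
  shows "\<bar>subset_mean p S g - subset_mean p (S - D) g\<bar> \<le> 2 * p * real (card D)"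
proof -
  have "subset_mean p (S - D) g = subset_mean p S (\<lambda>X. g (X \<inter> (S - D)))"
    using S by (intro subset_mean_marginal[symmetric]) auto
  moreover have "norm (subset_mean p S (\<lambda>X. g X - g (X \<inter> (S - D)))) \<le> subset_mean p S (\<lambda>X. 2 * real (card (X \<inter> D)))"
  proof (rule order_trans[OF norm_subset_mean_le[OF p] subset_mean_mono[OF p]])
    fix X assume X: "X \<subseteq> S"
    show "norm (g X - g (X \<inter> (S - D))) \<le> 2 * real (card (X \<inter> D))"
    proof (cases "X \<inter> D = {}")
      case True
      then have "X \<inter> (S - D) = X" using X by auto
      then show ?thesis by simp
    next
      case False
      then have "1 \<le> card (X \<inter> D)"
        using S X by (simp add: Suc_le_eq card_gt_0_iff) (meson finite_subset inf_le1 order_trans)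
      moreover have "\<bar>g X - g (X \<inter> (S - D))\<bar> \<le> 2" using g[of X] g[of "X \<inter> (S - D)"] by linarith
      ultimately show ?thesis by simp
    qed
  qed
  moreover have "subset_mean p S (\<lambda>X. 2 * real (card (X \<inter> D))) = 2 * p * real (card D)"
    using subset_mean_marginal[OF S, of p "\<lambda>X. 2 * real (card X)"] S
    by (simp add: subset_mean_mult_left subset_mean_card finite_subset[OF S(2,1)])
  ultimately show ?thesis by (simp add: subset_mean_diff)
qed

text \<open>Averaging over the two coins of the pair \<open>uv\<close> leaves a mixed second difference, which vanishes
  unless both \<open>u\<close> and \<open>v\<close> are pivotal.  These two events are independent of each other and, up to
  the erasure error, of the other votes.\<close>

lemma hybrid_char_insert:
  assumes y: "y \<in> configs N" and p: "0 \<le> p" "p \<le> 1"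
    and uv: "u \<in> {1..N}" "v \<in> {1..N}" "u < v" and A: "{u, v} \<notin> A"
  defines "\<kappa> \<equiv> subset_mean p ({1..N} - {u, v})
      (\<lambda>Z. of_bool (2 * tally (blue N y) (red N y) Z = - (y u + y v))) :: real"
  shows "norm (hybrid_char N p y s (insert {u, v} A) - hybrid_char N p y s A
      - of_real (- 4 * (sin s)\<^sup>2 * p * (1 - p) * y u * y v * \<kappa>\<^sup>2) * hybrid_char N p y s A)
    \<le> 8 * \<bar>s\<bar> ^ 3 * p * (4 * p * real N + 1)"
proof -
  let ?B = "insert {u, v} A"
  define V where "V = {1..N} - {u, v}"
  define S where "S = slots N - {(u, v), (v, u)}"
  define al where "al w Z = cis (s * real_of_int (vote N y Z w))" for w Z
  define g where "g X = (\<Prod>w\<in>V. al w (view N A X w))" for X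
  define F where "F C X = (\<Prod>w\<in>{1..N}. al w (view N C X w))" for C X
  have ne: "u \<noteq> v" using uv by simp
  have finV: "finite V" by (simp add: V_def)
  have finS: "finite S" by (simp add: S_def)
  have hyb: "hybrid_char N p y s C = subset_mean p (slots N) (F C)" for C
    by (simp add: hybrid_char_def F_def[abs_def] al_def)
  have slots: "slots N = insert (u, v) (insert (v, u) S)" "(u, v) \<notin> insert (v, u) S" "(v, u) \<notin> S"
    using uv by (auto simp: S_def slots_def)
  have al1: "norm (al w Z) = 1" for w Z by (simp add: al_def)
  have F_split: "F C X = g' * al u (view N C X u) * al v (view N C X v)"
    if "g' = (\<Prod>w\<in>V. al w (view N C X w))" for C X g'
  proof -
    have "{1..N} = insert u (insert v V)" "u \<notin> insert v V" "v \<notin> V" using uv by (auto simp: V_def)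
    then show ?thesis unfolding F_def that using finV by (simp add: mult_ac)
  qed
  have sl_uv: "slot A u v = (u, v)" "slot A v u = (v, u)" "slot ?B u v = (u, v)" "slot ?B v u = (u, v)"
    using A uv by (auto simp: slot_def insert_commute)
  have sl_other: "slot ?B w x = slot A w x" if "{w, x} \<noteq> {u, v}" for w x
    using that by (simp add: slot_def)
  have sl_ne: "slot C w x \<noteq> (u, v)" "slot C w x \<noteq> (v, u)" if "{w, x} \<noteq> {u, v}" for C w x
    using that slot_pair[of C w x u v] slot_pair[of C w x v u] by auto
  have view_other: "view N ?B X w = view N A X w"
    if "X \<subseteq> slots N" "w \<notin> {u, v}" for X w
    using that sl_other unfolding view_def by (auto simp: doubleton_eq_iff)
  have view_ins: "view N A (insert (u, v) X) w = view N A X w" "view N A (insert (v, u) X) w = view N A X w"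
    if "w \<notin> {u, v}" for X w
    using that sl_ne unfolding view_def by (auto simp: doubleton_eq_iff)
  \<comment> \<open>The factors of \<open>u\<close> and of \<open>v\<close> when the pair is absent
    (0) or present (1) in their views. A shared coin allows only the combinations (0,0) and (1,1),
    private coins allow all four.\<close>
  define a0 a1 b0 b1 where "a0 X = al u (view N A X u)" and "a1 X = al u (insert v (view N A X u))"
    and "b0 X = al v (view N A X v)" and "b1 X = al v (insert u (view N A X v))" for X
  have suB: "slot ?B u x \<in> S' \<longleftrightarrow> (if x = v then (u, v) \<in> S' else slot A u x \<in> S')"
    and svB: "slot ?B v x \<in> S' \<longleftrightarrow> (if x = u then (u, v) \<in> S' else slot A v x \<in> S')" for S' x
    using sl_uv sl_other[of u x] sl_other[of v x] by (auto simp: doubleton_eq_iff)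
  have su: "slot A u x = (u, v) \<longleftrightarrow> x = v" "slot A u x \<noteq> (v, u)" for x
    using sl_ne[of u x A] sl_uv ne by (cases "x = v"; auto simp: doubleton_eq_iff)+
  have sv: "slot A v x \<noteq> (u, v)" "slot A v x = (v, u) \<longleftrightarrow> x = u" for x
    using sl_ne[of v x A] sl_uv ne by (cases "x = u"; auto simp: doubleton_eq_iff)+
  have vu: "view N ?B X u = view N A X u" "view N ?B (insert (v, u) X) u = view N A X u"
      "view N A (insert (v, u) X) u = view N A X u"
      "view N ?B (insert (u, v) X) u = insert v (view N A X u)"
      "view N A (insert (u, v) X) u = insert v (view N A X u)"
      "view N ?B (insert (u, v) (insert (v, u) X)) u = insert v (view N A X u)"
      "view N A (insert (u, v) (insert (v, u) X)) u = insert v (view N A X u)"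
      "v \<notin> view N A X u" if "X \<subseteq> S" for X
    using that uv ne unfolding view_def suB by (auto simp: S_def su sl_uv split: if_splits)
  have vv: "view N ?B X v = view N A X v" "view N ?B (insert (v, u) X) v = view N A X v"
      "view N A (insert (v, u) X) v = insert u (view N A X v)"
      "view N ?B (insert (u, v) X) v = insert u (view N A X v)"
      "view N A (insert (u, v) X) v = view N A X v"
      "view N ?B (insert (u, v) (insert (v, u) X)) v = insert u (view N A X v)"
      "view N A (insert (u, v) (insert (v, u) X)) v = insert u (view N A X v)"
      "u \<notin> view N A X v" if "X \<subseteq> S" for X
    using that uv ne unfolding view_def svB by (auto simp: S_def sv sl_uv split: if_splits)
  have gw: "(\<Prod>w\<in>V. al w (view N C X' w)) = g X"
    if "X \<subseteq> S" "C = A \<or> C = ?B" "X' \<in> {X, insert (u, v) X, insert (v, u) X, insert (u, v) (insert (v, u) X)}"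
    for C X X'
  proof -
    have "X' \<subseteq> slots N" using that slots by auto
    then have "view N C X' w = view N A X w" if "w \<in> V" for w
      using \<open>C = A \<or> C = ?B\<close> that \<open>X' \<in> _\<close> view_other[of X' w] view_ins[of w] by (auto simp: V_def)
    then show ?thesis unfolding g_def by (intro prod.cong) auto
  qed
  have FB: "F ?B (insert (u, v) (insert (v, u) X)) = g X * a1 X * b1 X"
      "F ?B (insert (u, v) X) = g X * a1 X * b1 X"
      "F ?B (insert (v, u) X) = g X * a0 X * b0 X" "F ?B X = g X * a0 X * b0 X" if "X \<subseteq> S" for X
    by (subst F_split[OF gw[OF that, symmetric]];
        simp add: vu[OF that] vv[OF that] a0_def a1_def b0_def b1_def)+
  have FA: "F A (insert (u, v) (insert (v, u) X)) = g X * a1 X * b1 X"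
      "F A (insert (u, v) X) = g X * a1 X * b0 X"
      "F A (insert (v, u) X) = g X * a0 X * b1 X" "F A X = g X * a0 X * b0 X" if "X \<subseteq> S" for X
    by (subst F_split[OF gw[OF that, symmetric]];
        simp add: vu[OF that] vv[OF that] a0_def a1_def b0_def b1_def)+
  let ?M = "subset_mean p S :: _ \<Rightarrow> complex"
  have slots_mean: "subset_mean p (slots N) f
     = p *\<^sub>R (p *\<^sub>R ?M (\<lambda>X. f (insert (u, v) (insert (v, u) X))) + (1 - p) *\<^sub>R ?M (\<lambda>X. f (insert (u, v) X)))
     + (1 - p) *\<^sub>R (p *\<^sub>R ?M (\<lambda>X. f (insert (v, u) X)) + (1 - p) *\<^sub>R ?M f)" for f
    using slots finS by (simp add: subset_mean_insert)
  have hB: "hybrid_char N p y s ?B = p *\<^sub>R ?M (\<lambda>X. g X * a1 X * b1 X) + (1 - p) *\<^sub>R ?M (\<lambda>X. g X * a0 X * b0 X)"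
  proof -
    have "?M (\<lambda>X. F ?B (insert (u, v) (insert (v, u) X))) = ?M (\<lambda>X. g X * a1 X * b1 X)"
      "?M (\<lambda>X. F ?B (insert (u, v) X)) = ?M (\<lambda>X. g X * a1 X * b1 X)"
      "?M (\<lambda>X. F ?B (insert (v, u) X)) = ?M (\<lambda>X. g X * a0 X * b0 X)"
      "?M (F ?B) = ?M (\<lambda>X. g X * a0 X * b0 X)"
      by (intro subset_mean_cong FB; assumption)+
    then show ?thesis
      unfolding hyb slots_mean by (simp add: algebra_simps flip: scaleR_add_left)
  qed
  have hA: "hybrid_char N p y s A
     = p *\<^sub>R (p *\<^sub>R ?M (\<lambda>X. g X * a1 X * b1 X) + (1 - p) *\<^sub>R ?M (\<lambda>X. g X * a1 X * b0 X))
     + (1 - p) *\<^sub>R (p *\<^sub>R ?M (\<lambda>X. g X * a0 X * b1 X) + (1 - p) *\<^sub>R ?M (\<lambda>X. g X * a0 X * b0 X))"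
  proof -
    have "?M (\<lambda>X. F A (insert (u, v) (insert (v, u) X))) = ?M (\<lambda>X. g X * a1 X * b1 X)"
      "?M (\<lambda>X. F A (insert (u, v) X)) = ?M (\<lambda>X. g X * a1 X * b0 X)"
      "?M (\<lambda>X. F A (insert (v, u) X)) = ?M (\<lambda>X. g X * a0 X * b1 X)"
      "?M (F A) = ?M (\<lambda>X. g X * a0 X * b0 X)"
      by (intro subset_mean_cong FA; assumption)+
    then show ?thesis unfolding hyb slots_mean by simp
  qed
  \<comment> \<open>The covariance of two functions of one Bernoulli variable: p a1 b1 + (1 - p) a0
    b0 minus (p a1 + (1 - p) a0) (p b1 + (1 - p) b0) equals p (1 - p) (a1 - a0) (b1 - b0).\<close>
  have diff: "hybrid_char N p y s ?B - hybrid_char N p y s A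
     = of_real (p * (1 - p)) * ?M (\<lambda>X. g X * ((a1 X - a0 X) * (b1 X - b0 X)))"
  proof -
    have eq: "?M (\<lambda>X. g X * ((a1 X - a0 X) * (b1 X - b0 X))) = ?M (\<lambda>X. g X * a1 X * b1 X)
       - ?M (\<lambda>X. g X * a1 X * b0 X) - ?M (\<lambda>X. g X * a0 X * b1 X) + ?M (\<lambda>X. g X * a0 X * b0 X)"
      unfolding subset_mean_diff[symmetric] subset_mean_add[symmetric]
      by (intro subset_mean_cong) (simp add: algebra_simps)
    show ?thesis
      unfolding hA hB eq scaleR_conv_of_real of_real_mult of_real_diff of_real_1 by algebra
  qed
  define P where "P w X = (of_bool (2 * tally (blue N y) (red N y) {x\<in>V. slot A w x \<in> X} = - (y u + y v)) :: real)"
    for w X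
  have ab: "(a1 X - a0 X) * (b1 X - b0 X)
      = of_real (- 4 * (sin s)\<^sup>2 * y u * y v) * of_real (P u X * P v X)" if "X \<subseteq> S" for X
  proof -
    have e: "{x\<in>V. slot A u x \<in> X} = view N A X u" "{x\<in>V. slot A v x \<in> X} = view N A X v"
      using vu(8)[OF that] vv(8)[OF that] by (auto simp: V_def view_def)
    have "a1 X - a0 X = 2 * \<i> * of_real (sin s) * of_int (y v) * of_real (P u X)"
      unfolding a1_def a0_def al_def P_def e
      by (rule cis_vote_insert[OF y uv(1,2)]) (simp_all add: vu(8)[OF that])
    moreover have "b1 X - b0 X = 2 * \<i> * of_real (sin s) * of_int (y u) * of_real (P v X)"
      unfolding b1_def b0_def al_def P_def e add.commute[of "y u" "y v"]
      by (rule cis_vote_insert[OF y uv(2,1)]) (simp_all add: vv(8)[OF that])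
    ultimately show ?thesis by (simp add: power2_eq_square)
  qed
  \<comment> \<open>The coins that \<open>u\<close> and \<open>v\<close> read about other vertices.
    The two families are disjoint, which makes the two pivotal events independent and produces the
    square of \<kappa>.\<close>
  define J where "J = slot A u ` V \<union> slot A v ` V"
  define i where "i X = P u X * P v X" for X
  have Jdisj: "slot A u ` V \<inter> slot A v ` V = {}"
    using slot_eqD[of A u _ v] ne by (auto simp: V_def doubleton_eq_iff) (metis doubleton_eq_iff)
  have JS: "J \<subseteq> S"
    using slot_in_slots[of u N _ A] slot_in_slots[of v N _ A] uv sl_ne[of u _ A] sl_ne[of v _ A]
    unfolding J_def S_def V_def by (auto simp: doubleton_eq_iff) blast+
  have finJ: "finite J" using JS finS finite_subset by blast
  have cardJ: "real (card J) \<le> 2 * real N"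
  proof -
    have "card J \<le> card V + card V"
      unfolding J_def using card_image_le[OF finV, of "slot A u"] card_image_le[OF finV, of "slot A v"]
      by (rule order_trans[OF card_Un_le add_mono])
    moreover have "card V \<le> N" using card_mono[of "{1..N}" V] by (auto simp: V_def)
    ultimately show ?thesis by linarith
  qed
  have PJ: "i (X \<inter> J) = i X" for X
  proof -
    have "{x\<in>V. slot A u x \<in> X \<inter> J} = {x\<in>V. slot A u x \<in> X}" "{x\<in>V. slot A v x \<in> X \<inter> J} = {x\<in>V. slot A v x \<in> X}"
      by (auto simp: J_def)
    then show ?thesis by (simp add: i_def P_def)
  qed
  have Mi: "subset_mean p J i = \<kappa>\<^sup>2"
  proof -
    let ?b = "\<lambda>Z. of_bool (2 * tally (blue N y) (red N y) Z = - (y u + y v)) :: real"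
    have PK: "subset_mean p (slot A w ` V) (P w) = \<kappa>" for w
    proof -
      have "P w (slot A w ` Z) = ?b Z" if "Z \<subseteq> V" for Z
      proof -
        have "{x\<in>V. slot A w x \<in> slot A w ` Z} = Z" using that slot_inj[of A w UNIV] by (auto dest: injD)
        then show ?thesis by (simp add: P_def)
      qed
      then show ?thesis
        unfolding \<kappa>_def V_def[symmetric] by (subst subset_mean_image[OF finV slot_inj]) (rule subset_mean_cong)
    qed
    have "i (X \<union> Y) = P u X * P v Y" if "X \<subseteq> slot A u ` V" "Y \<subseteq> slot A v ` V" for X Y
    proof -
      have "{x\<in>V. slot A u x \<in> X \<union> Y} = {x\<in>V. slot A u x \<in> X}" "{x\<in>V. slot A v x \<in> X \<union> Y} = {x\<in>V. slot A v x \<in> Y}"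
        using that Jdisj by blast+
      then show ?thesis by (simp add: i_def P_def)
    qed
    then have "subset_mean p J i = subset_mean p (slot A u ` V) (\<lambda>X. subset_mean p (slot A v ` V) (\<lambda>Y. P u X * P v Y))"
      unfolding J_def using finV Jdisj by (subst subset_mean_union) (auto intro!: subset_mean_cong)
    also have "\<dots> = subset_mean p (slot A u ` V) (P u) * subset_mean p (slot A v ` V) (P v)"
      by (simp add: subset_mean_mult_left subset_mean_mult_right)
    also have "\<dots> = \<kappa> * \<kappa>" unfolding PK ..
    finally show ?thesis by (simp add: power2_eq_square)
  qed
  have gLip: "norm (g X - g (X - J)) \<le> 2 * \<bar>s\<bar> * real (card (X \<inter> J))" if "X \<subseteq> S" for X
  proof -
    define W where "W = {w\<in>V. view N A X w \<noteq> view N A (X - J) w}"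
    have "norm (g X - g (X - J)) \<le> (\<Sum>w\<in>V. norm (al w (view N A X w) - al w (view N A (X - J) w)))"
      unfolding g_def by (rule norm_prod_diff) (simp_all add: al1)
    also have "\<dots> \<le> (\<Sum>w\<in>V. if w \<in> W then 2 * \<bar>s\<bar> else 0)"
      using norm_cis_vote_diff[OF y] by (intro sum_mono) (auto simp: W_def al_def V_def)
    also have "\<dots> = 2 * \<bar>s\<bar> * real (card W)"
    proof -
      have "V \<inter> W = W" by (auto simp: W_def)
      then show ?thesis using finV by (simp add: sum.If_cases)
    qed
    \<comment> \<open>A coin in \<open>J\<close> involves \<open>u\<close> or \<open>v\<close>, so
      at most one vertex of \<open>V\<close> can read it. Assigning to each vertex with a changed
      view one erased coin is therefore injective.\<close>
    also have "card W \<le> card (X \<inter> J)"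
    proof -
      have "\<exists>x. x \<noteq> w \<and> slot A w x \<in> X \<inter> J" if "w \<in> W" for w
        using that by (auto simp: W_def view_def)
      then obtain f where f: "\<And>w. w \<in> W \<Longrightarrow> slot A w (f w) \<in> X \<inter> J" by metis
      have "inj_on (\<lambda>w. slot A w (f w)) W"
      proof (rule inj_onI, rule ccontr)
        fix w w' assume w: "w \<in> W" "w' \<in> W" "slot A w (f w) = slot A w' (f w')" "w \<noteq> w'"
        then have 1: "{w, f w} = {w, w'}" using slot_eqD[OF w(3)] by (auto simp: doubleton_eq_iff)
        from f[OF w(1)] obtain x z where "slot A w (f w) = slot A z x" "z = u \<or> z = v"
          by (auto simp: J_def)
        then have "z \<in> {w, w'}" using slot_eqD[of A w "f w" z x] 1 by auto
        then show False using w(1,2) \<open>z = u \<or> z = v\<close> by (auto simp: W_def V_def)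
      qed
      then show ?thesis
        using f finJ by (intro card_inj_on_le) auto
    qed
    finally show ?thesis by (simp add: mult_left_mono)
  qed
  have erase: "norm (?M (\<lambda>X. g X * of_real (i X)) - ?M g * of_real (\<kappa>\<^sup>2)) \<le> 8 * \<bar>s\<bar> * p * real N"
  proof -
    have i01: "0 \<le> i X \<and> i X \<le> 1" for X by (simp add: i_def P_def)
    have "norm (?M (\<lambda>X. g X * of_real (i (X \<inter> J))) - ?M g * of_real (subset_mean p J i))
        \<le> 2 * (2 * \<bar>s\<bar>) * p * real (card J)"
      by (rule subset_mean_erase[OF p finS JS]) (use gLip i01 in auto)
    also have "\<dots> \<le> 2 * (2 * \<bar>s\<bar>) * p * (2 * real N)"
      using cardJ p by (intro mult_left_mono) auto
    finally show ?thesis unfolding PJ Mi by (simp add: mult_ac)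
  qed
  have \<kappa>: "0 \<le> \<kappa>\<^sup>2" "\<kappa>\<^sup>2 \<le> 1"
  proof -
    have "\<bar>\<kappa>\<bar> \<le> 1" unfolding \<kappa>_def
      using norm_subset_mean_bound[OF p, of "{1..N} - {u, v}"
          "\<lambda>Z. of_bool (2 * tally (blue N y) (red N y) Z = - (y u + y v)) :: real" 1] by simp
    then show "\<kappa>\<^sup>2 \<le> 1" by (simp add: abs_square_le_1)
  qed simp
  \<comment> \<open>Dropping the factors of \<open>u\<close> and \<open>v\<close> costs |s| for each
    of them. This lets the mean of the other votes be replaced by \<open>hybrid_char\<close> itself,
    so that the effect of the edge becomes multiplicative.\<close>
  have gA: "norm (hybrid_char N p y s A - ?M g) \<le> 2 * \<bar>s\<bar>"
  proof -
    have convex: "norm (p *\<^sub>R x + (1 - p) *\<^sub>R x' - z) \<le> r"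
      if "norm (x - z) \<le> r" "norm (x' - z) \<le> r" for x x' z :: complex and r
    proof -
      have "p *\<^sub>R x + (1 - p) *\<^sub>R x' - z = p *\<^sub>R (x - z) + (1 - p) *\<^sub>R (x' - z)"
        by (simp add: algebra_simps)
      also have "norm \<dots> \<le> p * norm (x - z) + (1 - p) * norm (x' - z)"
        using p by (intro norm_triangle_le) simp
      also have "\<dots> \<le> p * r + (1 - p) * r" using that p by (intro add_mono mult_left_mono) auto
      finally show ?thesis by (simp add: algebra_simps)
    qed
    have "norm (?M (\<lambda>X. g X * a X * b X) - ?M g) \<le> 2 * \<bar>s\<bar>"
      if ab: "\<And>X. \<exists>Z. a X = al u Z" "\<And>X. \<exists>Z. b X = al v Z" for a b
    proof -
      have "norm (?M (\<lambda>X. g X * a X * b X - g X)) \<le> 2 * \<bar>s\<bar>"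
      proof (rule norm_subset_mean_bound[OF p finS])
        fix X
        obtain Z Z' where Z: "a X = al u Z" "b X = al v Z'" using ab by metis
        have "\<bar>s * real_of_int (vote N y Z u)\<bar> = \<bar>s\<bar>" "\<bar>s * real_of_int (vote N y Z' v)\<bar> = \<bar>s\<bar>"
          using vote_values[OF y uv(1), of Z] vote_values[OF y uv(2), of Z'] by (auto simp: abs_mult)
        then have n: "norm (a X - 1) \<le> \<bar>s\<bar>" "norm (b X - 1) \<le> \<bar>s\<bar>"
          using norm_cis_minus_one_le unfolding Z al_def by metis+
        have gX: "norm (g X) = 1" unfolding g_def prod_norm[symmetric] by (simp add: al1)
        have "norm (g X * a X * b X - g X) = norm (a X * (b X - 1) + (a X - 1))"
        proof -
          have "g X * a X * b X - g X = g X * (a X * (b X - 1) + (a X - 1))" by (simp add: algebra_simps)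
          then show ?thesis by (simp add: norm_mult gX)
        qed
        also have "\<dots> \<le> norm (a X) * norm (b X - 1) + norm (a X - 1)"
          by (intro norm_triangle_le) (simp add: norm_mult)
        also have "\<dots> \<le> 2 * \<bar>s\<bar>" using n by (simp add: Z al1)
        finally show "norm (g X * a X * b X - g X) \<le> 2 * \<bar>s\<bar>" .
      qed
      then show ?thesis by (simp add: subset_mean_diff)
    qed
    note M = this[of a1 b1] this[of a1 b0] this[of a0 b1] this[of a0 b0]
    show ?thesis unfolding hA
      by (intro convex M) (auto simp: a0_def a1_def b0_def b1_def)
  qed
  define c where "c = p * (1 - p) * (- 4 * (sin s)\<^sup>2 * y u * y v)"
  have "?M (\<lambda>X. g X * ((a1 X - a0 X) * (b1 X - b0 X)))
     = ?M (\<lambda>X. of_real (- 4 * (sin s)\<^sup>2 * y u * y v) * (g X * of_real (i X)))"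
    by (intro subset_mean_cong) (simp add: ab i_def)
  then have diff': "hybrid_char N p y s ?B - hybrid_char N p y s A = of_real c * ?M (\<lambda>X. g X * of_real (i X))"
    unfolding diff subset_mean_mult_left c_def by simp
  have c: "\<bar>c\<bar> \<le> 4 * s\<^sup>2 * p"
  proof -
    have "\<bar>c\<bar> = 4 * (sin s)\<^sup>2 * (p * (1 - p))"
      using configs_values[OF y uv(1)] configs_values[OF y uv(2)] p
      by (auto simp: c_def abs_mult)
    also have "\<dots> \<le> 4 * s\<^sup>2 * (p * 1)"
      using p abs_sin_x_le_abs_x[of s] by (intro mult_mono) (auto simp: abs_le_square_iff)
    finally show ?thesis by simp
  qed
  have eq: "of_real (- 4 * (sin s)\<^sup>2 * p * (1 - p) * y u * y v * \<kappa>\<^sup>2) = of_real c * (of_real (\<kappa>\<^sup>2) :: complex)"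
    by (simp add: c_def)
  have "norm (hybrid_char N p y s ?B - hybrid_char N p y s A
      - of_real (- 4 * (sin s)\<^sup>2 * p * (1 - p) * y u * y v * \<kappa>\<^sup>2) * hybrid_char N p y s A)
     = \<bar>c\<bar> * norm (?M (\<lambda>X. g X * of_real (i X)) - of_real (\<kappa>\<^sup>2) * hybrid_char N p y s A)"
    unfolding diff' eq norm_of_real[symmetric, where 'a = complex] norm_mult[symmetric]
    by (simp only: right_diff_distrib mult.assoc)
  also have "?M (\<lambda>X. g X * of_real (i X)) - of_real (\<kappa>\<^sup>2) * hybrid_char N p y s A
     = (?M (\<lambda>X. g X * of_real (i X)) - ?M g * of_real (\<kappa>\<^sup>2)) - of_real (\<kappa>\<^sup>2) * (hybrid_char N p y s A - ?M g)"
    by (simp add: algebra_simps)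
  also have "\<bar>c\<bar> * norm \<dots> \<le> (4 * s\<^sup>2 * p) * (8 * \<bar>s\<bar> * p * real N + 1 * (2 * \<bar>s\<bar>))"
  proof (rule mult_mono[OF c])
    show "norm ((?M (\<lambda>X. g X * of_real (i X)) - ?M g * of_real (\<kappa>\<^sup>2))
        - of_real (\<kappa>\<^sup>2) * (hybrid_char N p y s A - ?M g)) \<le> 8 * \<bar>s\<bar> * p * real N + 1 * (2 * \<bar>s\<bar>)"
    proof (rule norm_triangle_le_diff[OF add_mono[OF erase]])
      have "norm (of_real (\<kappa>\<^sup>2) * (hybrid_char N p y s A - ?M g)) = \<kappa>\<^sup>2 * norm (hybrid_char N p y s A - ?M g)"
        by (simp add: norm_mult norm_power)
      also have "\<dots> \<le> 1 * (2 * \<bar>s\<bar>)" using \<kappa> gA by (intro mult_mono) auto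
      finally show "norm (of_real (\<kappa>\<^sup>2) * (hybrid_char N p y s A - ?M g)) \<le> 1 * (2 * \<bar>s\<bar>)" .
    qed
  qed (use p in auto)
  also have "\<dots> = 8 * \<bar>s\<bar> ^ 3 * p * (4 * p * real N + 1)"
    by (subst power2_abs[of s, symmetric]) (simp add: power2_eq_square power3_eq_cube algebra_simps
        del: abs_mult_self_eq)
  finally show ?thesis .
qed


section \<open>The recursion over the edges with a common coefficient\<close>

lemma balanced_prob_bounds:
  assumes "0 \<le> p" "p \<le> 1"
  shows "0 \<le> balanced_prob p n j" "balanced_prob p n j \<le> 1"
proof -
  have eq: "balanced_prob p n j
      = subset_mean p ({..<n} \<union> {n..<2 * n}) (\<lambda>Z. of_bool (tally {..<n} {n..<2 * n} Z = j))"
    by (rule balanced_prob[symmetric]) auto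
  show "0 \<le> balanced_prob p n j"
    unfolding eq using subset_mean_mono[OF assms, of "{..<n} \<union> {n..<2 * n}" "\<lambda>_. 0"] by simp
  show "balanced_prob p n j \<le> 1"
    unfolding eq using subset_mean_mono[OF assms, of "{..<n} \<union> {n..<2 * n}" _ "\<lambda>_. 1"] by simp
qed

text \<open>The terms come from deleting the two endpoints from the ground set (2 p for each), from
  the unequal sizes of the colour classes, and from replacing a pivotal tally 1 or -1 by 0.\<close>

definition pivot_error :: "nat \<Rightarrow> real \<Rightarrow> (nat \<Rightarrow> int) \<Rightarrow> real" where
  "pivot_error N p y = (let n = min (card (blue N y)) (card (red N y)) in
     4 * p + 2 * (\<bar>bias N y\<bar> * p) + \<bar>balanced_prob p n 0 - balanced_prob p n 1\<bar>)"

lemma pivot_prob: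
  assumes y: "y \<in> configs N" and p: "0 \<le> p" "p \<le> 1" and uv: "u \<in> {1..N}" "v \<in> {1..N}" "u \<noteq> v"
  shows "\<bar>subset_mean p ({1..N} - {u, v}) (\<lambda>Z. of_bool (2 * tally (blue N y) (red N y) Z = - (y u + y v)))
    - balanced_prob p (min (card (blue N y)) (card (red N y))) 0\<bar> \<le> pivot_error N p y"
proof -
  define n where "n = min (card (blue N y)) (card (red N y))"
  have "y u = 1 \<or> y u = -1" "y v = 1 \<or> y v = -1"
    using configs_values[OF y] uv by auto
  then obtain j :: int where j: "- (y u + y v) = 2 * j" "j = 0 \<or> j = 1 \<or> j = - 1"
    by (elim disjE) (force+)
  let ?g = "\<lambda>Z. of_bool (tally (blue N y) (red N y) Z = j) :: real"
  have "\<bar>subset_mean p {1..N} ?g - subset_mean p ({1..N} - {u, v}) ?g\<bar> \<le> 2 * p * real (card {u, v})"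
    using uv by (intro subset_mean_remove[OF p]) auto
  moreover have "\<bar>subset_mean p {1..N} ?g - balanced_prob p n j\<bar> \<le> 2 * (\<bar>bias N y\<bar> * p)"
    using unbalanced_prob[OF p blue_red(1-3)[OF y], of j] blue_red(4)[OF y] by (simp add: n_def bias_def)
  moreover have "\<bar>balanced_prob p n j - balanced_prob p n 0\<bar> \<le> \<bar>balanced_prob p n 0 - balanced_prob p n 1\<bar>"
    using j(2) balanced_prob_uminus[of p n 1] by auto
  ultimately show ?thesis
    using uv(3) unfolding j(1) pivot_error_def Let_def n_def[symmetric] by simp
qed

text \<open>Here the pivotal probability k of the particular edge is traded for the common value k0,
  at the price of |k^2 - k0^2| \<le> e (2 k0 + e), where e is \<open>pivot_error\<close>. After that
  \<gamma> is the same for all edges and only the sign of the edge remains in the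
  multiplier.\<close>

lemma hybrid_char_step:
  fixes s :: real
  assumes y: "y \<in> configs N" and p: "0 \<le> p" "p \<le> 1" and e: "e \<in> all_edges N" "e \<notin> A"
  defines "\<gamma> \<equiv> 4 * (sin s)\<^sup>2 * p * (1 - p) * (balanced_prob p (min (card (blue N y)) (card (red N y))) 0)\<^sup>2"
  shows "norm (hybrid_char N p y s (insert e A)
        - of_real (1 - \<gamma> * real_of_int (\<Prod>w\<in>e. y w)) * hybrid_char N p y s A)
    \<le> 8 * \<bar>s\<bar> ^ 3 * p * (4 * p * real N + 1) + 4 * s\<^sup>2 * p * (pivot_error N p y
        * (2 * balanced_prob p (min (card (blue N y)) (card (red N y))) 0 + pivot_error N p y))"
proof -
  from e obtain a b where ab: "e = {a, b}" "a \<noteq> b" "a \<in> {1..N}" "b \<in> {1..N}"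
    by (auto simp: all_edges_def card_2_iff)
  obtain u v where uv: "e = {u, v}" "u \<in> {1..N}" "v \<in> {1..N}" "u < v"
    using ab by (cases "a < b") (auto intro: that[of a b] that[of b a])
  define k0 where "k0 = balanced_prob p (min (card (blue N y)) (card (red N y))) 0"
  define k where "k = (subset_mean p ({1..N} - {u, v})
      (\<lambda>Z. of_bool (2 * tally (blue N y) (red N y) Z = - (y u + y v))) :: real)"
  let ?H = "hybrid_char N p y s"
  have H1: "norm (?H A) \<le> 1"
    unfolding hybrid_char_def
    by (rule norm_subset_mean_bound[OF p]) (auto simp flip: prod_norm)
  define c where "c = 4 * (sin s)\<^sup>2 * p * (1 - p) * y u * y v"
  have c: "\<bar>c\<bar> \<le> 4 * s\<^sup>2 * p"
  proof -
    have "\<bar>c\<bar> = 4 * (sin s)\<^sup>2 * (p * (1 - p))"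
      using configs_values[OF y uv(2)] configs_values[OF y uv(3)] p by (auto simp: c_def abs_mult)
    also have "\<dots> \<le> 4 * s\<^sup>2 * (p * 1)"
      using p abs_sin_x_le_abs_x[of s] by (intro mult_mono) (auto simp: abs_le_square_iff)
    finally show ?thesis by simp
  qed
  have k: "\<bar>k - k0\<bar> \<le> pivot_error N p y"
    unfolding k_def k0_def using uv by (intro pivot_prob[OF y p]) auto
  have k0: "0 \<le> k0" using balanced_prob_bounds[OF p] by (simp add: k0_def)
  define r where "r = pivot_error N p y * (2 * k0 + pivot_error N p y)"
  have ksq: "\<bar>k\<^sup>2 - k0\<^sup>2\<bar> \<le> r"
  proof -
    have "\<bar>k\<^sup>2 - k0\<^sup>2\<bar> = \<bar>k - k0\<bar> * \<bar>k + k0\<bar>"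
      by (simp add: power2_eq_square algebra_simps flip: abs_mult)
    also have "\<dots> \<le> r"
      unfolding r_def using k k0 by (intro mult_mono) (auto simp: abs_le_iff)
    finally show ?thesis .
  qed
  have eq: "?H (insert e A) - of_real (1 - \<gamma> * real_of_int (\<Prod>w\<in>e. y w)) * ?H A
    = (?H (insert {u, v} A) - ?H A - of_real (- 4 * (sin s)\<^sup>2 * p * (1 - p) * y u * y v * k\<^sup>2) * ?H A)
      - of_real (c * (k\<^sup>2 - k0\<^sup>2)) * ?H A"
  proof -
    have "(\<Prod>w\<in>e. y w) = y u * y v" using uv by simp
    then show ?thesis unfolding uv(1) \<gamma>_def k0_def[symmetric] c_def by (simp add: algebra_simps)
  qed
  show ?thesis unfolding eq
  proof (rule norm_triangle_le_diff[OF add_mono])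
    show "norm (?H (insert {u, v} A) - ?H A - of_real (- 4 * (sin s)\<^sup>2 * p * (1 - p) * y u * y v * k\<^sup>2) * ?H A)
        \<le> 8 * \<bar>s\<bar> ^ 3 * p * (4 * p * real N + 1)"
      using hybrid_char_insert[OF y p uv(2-4), of A s] e uv(1) unfolding k_def by simp
    have "norm (of_real (c * (k\<^sup>2 - k0\<^sup>2)) * ?H A) = \<bar>c\<bar> * \<bar>k\<^sup>2 - k0\<^sup>2\<bar> * norm (?H A)"
      unfolding norm_mult norm_of_real abs_mult by simp
    also have "\<dots> \<le> (4 * s\<^sup>2 * p) * r * 1"
      using order_trans[OF abs_ge_zero ksq] c ksq H1 p by (intro mult_mono mult_nonneg_nonneg) auto
    finally show "norm (of_real (c * (k\<^sup>2 - k0\<^sup>2)) * ?H A) 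
        \<le> 4 * s\<^sup>2 * p * (pivot_error N p y
        * (2 * balanced_prob p (min (card (blue N y)) (card (red N y))) 0 + pivot_error N p y))"
      by (simp add: k0_def r_def)
  qed
qed

text \<open>A discrete Gronwall argument: each insertion commits an error of at most \<delta>, and
  every later multiplier enlarges it by at most 1 + \<gamma>.\<close>

lemma perturbed_product:
  fixes \<Phi> :: "'a set \<Rightarrow> 'b::{real_normed_field}"
  assumes fin: "finite E" and \<delta>: "0 \<le> \<delta>" and \<gamma>: "\<And>e. e \<in> E \<Longrightarrow> norm (c e) \<le> 1 + \<gamma>" "0 \<le> \<gamma>"
    and step: "\<And>A e. A \<subseteq> E \<Longrightarrow> e \<in> E \<Longrightarrow> e \<notin> A \<Longrightarrow> norm (\<Phi> (insert e A) - c e * \<Phi> A) \<le> \<delta>"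
  shows "norm (\<Phi> E - (\<Prod>e\<in>E. c e) * \<Phi> {}) \<le> real (card E) * \<delta> * (1 + \<gamma>) ^ card E"
proof -
  have "norm (\<Phi> A - (\<Prod>e\<in>A. c e) * \<Phi> {}) \<le> real (card A) * \<delta> * (1 + \<gamma>) ^ card A"
    if "finite A" "A \<subseteq> E" for A
    using that
  proof (induction A rule: finite_induct)
    case (insert e A)
    have IH: "norm (\<Phi> A - (\<Prod>e\<in>A. c e) * \<Phi> {}) \<le> real (card A) * \<delta> * (1 + \<gamma>) ^ card A"
      using insert by simp
    have "\<Phi> (insert e A) - (\<Prod>e\<in>insert e A. c e) * \<Phi> {}
        = (\<Phi> (insert e A) - c e * \<Phi> A) + c e * (\<Phi> A - (\<Prod>e\<in>A. c e) * \<Phi> {})"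
      using insert.hyps by (simp add: algebra_simps)
    also have "norm \<dots> \<le> norm (\<Phi> (insert e A) - c e * \<Phi> A) + norm (c e) * norm (\<Phi> A - (\<Prod>e\<in>A. c e) * \<Phi> {})"
      by (intro norm_triangle_le) (simp add: norm_mult)
    also have "\<dots> \<le> \<delta> * (1 + \<gamma>) ^ card (insert e A) + (1 + \<gamma>) * (real (card A) * \<delta> * (1 + \<gamma>) ^ card A)"
    proof (intro add_mono mult_mono IH)
      have "\<delta> * 1 \<le> \<delta> * (1 + \<gamma>) ^ card (insert e A)"
        using \<delta> \<gamma>(2) by (intro mult_left_mono one_le_power) auto
      then show "norm (\<Phi> (insert e A) - c e * \<Phi> A) \<le> \<delta> * (1 + \<gamma>) ^ card (insert e A)"
        using step[of A e] insert by simp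
    qed (use \<gamma> insert in auto)
    also have "\<dots> = real (card (insert e A)) * \<delta> * (1 + \<gamma>) ^ card (insert e A)"
      using insert.hyps by (simp add: algebra_simps)
    finally show ?case .
  qed simp
  then show ?thesis using fin by simp
qed

text \<open>Without shared edges the vertex \<open>w\<close> reads only the coins
  \<open>(w, v)\<close>, and these families are disjoint for different \<open>w\<close>.\<close>

lemma hybrid_char_empty:
  "hybrid_char N p y s {} = (\<Prod>w\<in>{1..N}. subset_mean p ({1..N} - {w}) (\<lambda>Z. cis (s * real_of_int (vote N y Z w))))"
proof -
  let ?S = "\<lambda>w. Pair w ` ({1..N} - {w})"
  let ?f = "\<lambda>w X. cis (s * real_of_int (vote N y {v \<in> {1..N} - {w}. (w, v) \<in> X} w))"
  have slots: "slots N = (\<Union>w\<in>{1..N}. ?S w)" by (auto simp: slots_def)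
  have "hybrid_char N p y s {} = subset_mean p (\<Union>w\<in>{1..N}. ?S w) (\<lambda>X. \<Prod>w\<in>{1..N}. ?f w (X \<inter> ?S w))"
    unfolding hybrid_char_def slots view_def slot_def
    by (intro subset_mean_cong prod.cong refl arg_cong[where f = "\<lambda>Z. cis (s * real_of_int (vote N y Z _))"]) auto
  also have "\<dots> = (\<Prod>w\<in>{1..N}. subset_mean p (?S w) (?f w))"
    by (rule subset_mean_prod) auto
  also have "\<dots> = (\<Prod>w\<in>{1..N}. subset_mean p ({1..N} - {w}) (\<lambda>Z. cis (s * real_of_int (vote N y Z w))))"
  proof (intro prod.cong refl)
    fix w
    have "subset_mean p (?S w) (?f w) = subset_mean p ({1..N} - {w}) (\<lambda>Z. ?f w (Pair w ` Z))"
      by (rule subset_mean_image) (auto intro: inj_onI)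
    also have "\<dots> = subset_mean p ({1..N} - {w}) (\<lambda>Z. cis (s * real_of_int (vote N y Z w)))"
      by (intro subset_mean_cong arg_cong[where f = "\<lambda>Z. cis (s * real_of_int (vote N y Z w))"]) auto
    finally show "subset_mean p (?S w) (?f w)
        = subset_mean p ({1..N} - {w}) (\<lambda>Z. cis (s * real_of_int (vote N y Z w)))" .
  qed
  finally show ?thesis .
qed

lemma prod_cis: "(\<Prod>i\<in>I. cis (f i)) = cis (\<Sum>i\<in>I. f i)"
  by (induction I rule: infinite_finite_induct) (simp_all add: cis_mult)

text \<open>When all edges are shared only the increasing pairs are read, and these correspond
  bijectively to the edges of the graph.\<close>

lemma hybrid_char_all_edges:
  assumes y: "y \<in> configs N"
  shows "hybrid_char N p y s (all_edges N)
    = subset_mean p (all_edges N) (\<lambda>E. cis (s * bias N (majority_step N E y)))"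
proof -
  define S where "S = {(u, v). u \<in> {1..N} \<and> v \<in> {1..N} \<and> u < v}"
  define h where "h = (\<lambda>(u::nat, v::nat). {u, v})"
  let ?F = "\<lambda>X. \<Prod>w\<in>{1..N}. cis (s * real_of_int (vote N y (view N (all_edges N) X w) w))"
  have S: "S \<subseteq> slots N" by (auto simp: S_def slots_def)
  then have finS: "finite S" using finite_slots finite_subset by blast
  have edge: "{w, v} \<in> all_edges N" if "w \<in> {1..N}" "v \<in> {1..N} - {w}" for w v
    using that by (auto simp: all_edges_def card_2_iff)
  have sl: "slot (all_edges N) w v = (min w v, max w v)" "(min w v, max w v) \<in> S"
    if "w \<in> {1..N}" "v \<in> {1..N} - {w}" for w v
    using that edge[OF that] by (auto simp: slot_def S_def min_def max_def)
  have inj: "inj_on h S" by (rule inj_onI) (auto simp: h_def S_def doubleton_eq_iff)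
  have im: "h ` S = all_edges N"
  proof
    have "h (u, v) \<in> all_edges N" if "(u, v) \<in> S" for u v
      using that edge[of u v] by (simp add: h_def S_def)
    then show "h ` S \<subseteq> all_edges N" by auto
    show "all_edges N \<subseteq> h ` S"
    proof
      fix e assume "e \<in> all_edges N"
      then obtain a b where "e = {a, b}" "a \<noteq> b" "a \<in> {1..N}" "b \<in> {1..N}"
        by (auto simp: all_edges_def card_2_iff)
      then have "e = h (min a b, max a b)" "(min a b, max a b) \<in> S"
        by (auto simp: h_def S_def min_def max_def)
      then show "e \<in> h ` S" by blast
    qed
  qed
  have "hybrid_char N p y s (all_edges N) = subset_mean p (slots N) (\<lambda>X. ?F (X \<inter> S))"
    unfolding hybrid_char_def
  proof (intro subset_mean_cong prod.cong refl)
    fix X w assume "w \<in> {1..N}"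
    then have "view N (all_edges N) X w = view N (all_edges N) (X \<inter> S) w"
      using sl[of w] unfolding view_def by (intro Collect_cong) (metis IntE IntI)
    then show "cis (s * real_of_int (vote N y (view N (all_edges N) X w) w))
        = cis (s * real_of_int (vote N y (view N (all_edges N) (X \<inter> S) w) w))" by simp
  qed
  also have "\<dots> = subset_mean p S ?F" using S by (intro subset_mean_marginal) auto
  also have "\<dots> = subset_mean p S (\<lambda>X. cis (s * bias N (majority_step N (h ` X) y)))"
  proof (intro subset_mean_cong)
    fix X assume X: "X \<subseteq> S"
    have nb: "nbrs (h ` X) w = view N (all_edges N) X w" if w: "w \<in> {1..N}" for w
    proof -
      have "{v, w} \<in> h ` X \<longleftrightarrow> v \<in> {1..N} - {w} \<and> (min w v, max w v) \<in> X" for v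
      proof
        assume "{v, w} \<in> h ` X"
        then obtain a b where "(a, b) \<in> X" "{v, w} = {a, b}" by (auto simp: h_def)
        then show "v \<in> {1..N} - {w} \<and> (min w v, max w v) \<in> X"
          using X by (auto simp: S_def doubleton_eq_iff min_def max_def)
      next
        assume *: "v \<in> {1..N} - {w} \<and> (min w v, max w v) \<in> X"
        have "{v, w} = h (min w v, max w v)" by (auto simp: h_def min_def max_def)
        with * show "{v, w} \<in> h ` X" by blast
      qed
      then show ?thesis
        using sl(1)[OF w] unfolding nbrs_def view_def by (intro Collect_cong) metis
    qed
    have "bias N (majority_step N (h ` X) y) = (\<Sum>w\<in>{1..N}. real_of_int (vote N y (view N (all_edges N) X w) w))"
      unfolding bias_eq_sum[OF majority_step_configs[OF y]]
      by (intro sum.cong refl) (simp only: majority_step_vote nb)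
    then show "?F X = cis (s * bias N (majority_step N (h ` X) y))"
      by (simp only: prod_cis sum_distrib_left[symmetric])
  qed
  also have "\<dots> = subset_mean p (h ` S) (\<lambda>E. cis (s * bias N (majority_step N E y)))"
    by (rule subset_mean_image[OF finS inj, symmetric])
  finally show ?thesis unfolding im .
qed


section \<open>Sums and products over all edges\<close>

lemma all_edges_Suc: "all_edges (Suc N) = all_edges N \<union> (\<lambda>u. {u, Suc N}) ` {1..N}"
proof
  show "all_edges (Suc N) \<subseteq> all_edges N \<union> (\<lambda>u. {u, Suc N}) ` {1..N}"
  proof
    fix e assume e: "e \<in> all_edges (Suc N)"
    then obtain a b where ab: "e = {a, b}" "a \<noteq> b" "a \<in> {1..Suc N}" "b \<in> {1..Suc N}"
      by (auto simp: all_edges_def card_2_iff)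
    consider "b = Suc N" | "a = Suc N" | "a \<in> {1..N}" "b \<in> {1..N}" using ab by force
    then show "e \<in> all_edges N \<union> (\<lambda>u. {u, Suc N}) ` {1..N}"
    proof cases
      case 1
      then have "a \<in> {1..N}" using ab by auto
      then show ?thesis using 1 ab(1) by blast
    next
      case 2
      then have "b \<in> {1..N}" "e = {b, Suc N}" using ab by auto
      then show ?thesis by blast
    next
      case 3
      then show ?thesis using ab(1,2) by (simp add: all_edges_def)
    qed
  qed
  show "all_edges N \<union> (\<lambda>u. {u, Suc N}) ` {1..N} \<subseteq> all_edges (Suc N)"
    by (auto simp: all_edges_def)
qed

lemma sum_edge_signs:
  assumes "\<And>v. v \<in> {1..N} \<Longrightarrow> y v = 1 \<or> y v = - 1"
  shows "2 * (\<Sum>e\<in>all_edges N. \<Prod>w\<in>e. y w) = (\<Sum>v\<in>{1..N}. y v)\<^sup>2 - int N"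
  using assms
proof (induction N)
  case 0
  have "all_edges 0 = {}" by (auto simp: all_edges_def)
  then show ?case by simp
next
  case (Suc N)
  have disj: "all_edges N \<inter> (\<lambda>u. {u, Suc N}) ` {1..N} = {}"
    by (auto simp: all_edges_def)
  have inj: "inj_on (\<lambda>u. {u, Suc N}) {1..N}" by (rule inj_onI) (auto simp: doubleton_eq_iff)
  have "(\<Sum>e\<in>all_edges (Suc N). \<Prod>w\<in>e. y w)
     = (\<Sum>e\<in>all_edges N. \<Prod>w\<in>e. y w) + (\<Sum>u\<in>{1..N}. \<Prod>w\<in>{u, Suc N}. y w)"
    unfolding all_edges_Suc using disj inj by (subst sum.union_disjoint) (auto simp: sum.reindex)
  also have "(\<Sum>u\<in>{1..N}. \<Prod>w\<in>{u, Suc N}. y w) = (\<Sum>u\<in>{1..N}. y u) * y (Suc N)"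
    unfolding sum_distrib_right by (intro sum.cong) auto
  finally have *: "2 * (\<Sum>e\<in>all_edges (Suc N). \<Prod>w\<in>e. y w)
     = (\<Sum>v\<in>{1..N}. y v)\<^sup>2 - int N + 2 * (\<Sum>u\<in>{1..N}. y u) * y (Suc N)"
    using Suc by simp
  have "(y (Suc N))\<^sup>2 = 1" using Suc.prems[of "Suc N"] by auto
  then show ?case unfolding * by (simp add: power2_sum)
qed

lemma card_all_edges_le: "card (all_edges N) \<le> N\<^sup>2"
proof -
  have "all_edges N \<subseteq> (\<lambda>(u, v). {u, v}) ` ({1..N} \<times> {1..N})"
    by (fastforce simp: all_edges_def card_2_iff)
  then have "card (all_edges N) \<le> card ({1..N} \<times> {1..N})"
    by (rule surj_card_le[rotated]) simp
  then show ?thesis by (simp add: power2_eq_square)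
qed

text \<open>In the logarithm the quadratic errors add up to at most 2 g^2 \<open>card (E N)\<close>.
  The linear terms are controlled through their signed sum, because in the application the sum of
  their absolute values is merely bounded.\<close>

lemma prod_tendsto_1:
  fixes x :: "nat \<Rightarrow> 'a \<Rightarrow> real"
  assumes fin: "\<And>N. finite (E N)" and x: "\<forall>\<^sub>F N in sequentially. \<forall>e\<in>E N. \<bar>x N e\<bar> \<le> g N"
    and g: "g \<longlonglongrightarrow> 0" "(\<lambda>N. (g N)\<^sup>2 * real (card (E N))) \<longlonglongrightarrow> 0"
    and sum: "(\<lambda>N. \<Sum>e\<in>E N. x N e) \<longlonglongrightarrow> 0"
  shows "(\<lambda>N. \<Prod>e\<in>E N. 1 + x N e) \<longlonglongrightarrow> 1"
proof -
  have ev: "\<forall>\<^sub>F N in sequentially. \<forall>e\<in>E N. \<bar>x N e\<bar> \<le> g N \<and> g N < 1/2"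
    using x order_tendstoD(2)[OF g(1), of "1/2"] by (auto elim: eventually_elim2)
  have "(\<lambda>N. (\<Sum>e\<in>E N. ln (1 + x N e)) - (\<Sum>e\<in>E N. x N e)) \<longlonglongrightarrow> 0"
  proof (rule Lim_null_comparison)
    show "(\<lambda>N. 2 * ((g N)\<^sup>2 * real (card (E N)))) \<longlonglongrightarrow> 0"
      using tendsto_mult[OF tendsto_const g(2), of 2] by simp
    show "\<forall>\<^sub>F N in sequentially. norm ((\<Sum>e\<in>E N. ln (1 + x N e)) - (\<Sum>e\<in>E N. x N e))
        \<le> 2 * ((g N)\<^sup>2 * real (card (E N)))"
      using ev
    proof eventually_elim
      case (elim N)
      have "norm ((\<Sum>e\<in>E N. ln (1 + x N e)) - (\<Sum>e\<in>E N. x N e)) \<le> (\<Sum>e\<in>E N. \<bar>ln (1 + x N e) - x N e\<bar>)"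
        by (simp flip: sum_subtractf)
      also have "\<dots> \<le> (\<Sum>e\<in>E N. 2 * (g N)\<^sup>2)"
      proof (rule sum_mono)
        fix e assume e: "e \<in> E N"
        have "\<bar>ln (1 + x N e) - x N e\<bar> \<le> 2 * (x N e)\<^sup>2"
          using elim e by (intro abs_ln_one_plus_x_minus_x_bound) force
        also have "\<dots> \<le> 2 * (g N)\<^sup>2"
          using elim e power_mono[of "\<bar>x N e\<bar>" "g N" 2] by simp
        finally show "\<bar>ln (1 + x N e) - x N e\<bar> \<le> 2 * (g N)\<^sup>2" .
      qed
      finally show ?case by (simp add: mult_ac)
    qed
  qed
  from tendsto_add[OF this sum] have "(\<lambda>N. \<Sum>e\<in>E N. ln (1 + x N e)) \<longlonglongrightarrow> 0" by simp
  from tendsto_exp[OF this] have lim: "(\<lambda>N. exp (\<Sum>e\<in>E N. ln (1 + x N e))) \<longlonglongrightarrow> 1" by simp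
  show ?thesis
  proof (rule Lim_transform_eventually[OF lim])
    show "\<forall>\<^sub>F N in sequentially. exp (\<Sum>e\<in>E N. ln (1 + x N e)) = (\<Prod>e\<in>E N. 1 + x N e)"
      using ev
    proof eventually_elim
      case (elim N)
      have "0 < 1 + x N e" if "e \<in> E N" for e
        using elim that by (force simp: abs_le_iff)
      then show ?case using fin by (simp add: exp_sum)
    qed
  qed
qed

section \<open>The characteristic function of a single vote\<close>

lemma norm_exp_expansion:
  "norm (cis s - (1 + \<i> * of_real s - of_real (s\<^sup>2 / 2))) \<le> \<bar>s\<bar> ^ 3 / 6"
  "norm (cis s - (1 + \<i> * of_real s)) \<le> s\<^sup>2 / 2"
proof -
  have "{..2::nat} = {0, 1, 2}" by auto
  then show "norm (cis s - (1 + \<i> * of_real s - of_real (s\<^sup>2 / 2))) \<le> \<bar>s\<bar> ^ 3 / 6"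
    using iexp_approx1[of s 2] by (simp add: cis_conv_exp fact_numeral power_mult_distrib algebra_simps numeral_3_eq_3)
  show "norm (cis s - (1 + \<i> * of_real s)) \<le> s\<^sup>2 / 2"
    using iexp_approx1[of s 1] by (simp add: cis_conv_exp power2_eq_square algebra_simps)
qed

lemma exp_minus_bounds:
  fixes x :: real
  assumes "0 \<le> x"
  shows "\<bar>1 - exp (- x)\<bar> \<le> x" "\<bar>1 - x - exp (- x)\<bar> \<le> x\<^sup>2"
proof -
  have 1: "1 - x \<le> exp (- x)" using exp_ge_add_one_self[of "- x"] by simp
  have 2: "exp (- x) \<le> 1" using assms by simp
  show "\<bar>1 - exp (- x)\<bar> \<le> x" using 1 2 assms by simp
  have "1 + x \<le> exp x" by (rule exp_ge_add_one_self)
  then have "exp (- x) \<le> 1 / (1 + x)" using assms by (simp add: exp_minus field_simps)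
  also have "\<dots> \<le> 1 - x + x\<^sup>2"
  proof -
    have "1 \<le> (1 - x + x\<^sup>2) * (1 + x)" using assms by (simp add: algebra_simps power2_eq_square)
    then show ?thesis using assms by (simp add: divide_le_eq)
  qed
  finally show "\<bar>1 - x - exp (- x)\<bar> \<le> x\<^sup>2" using 1 by simp
qed

text \<open>The characteristic function of a \<open>\<plusminus>1\<close> variable with mean \<open>\<mu>\<close>.\<close>

lemma sign_char_approx:
  fixes s \<mu> :: real
  assumes "\<bar>\<mu>\<bar> \<le> 1"
  shows "norm (of_real (cos s) + \<i> * of_real (\<mu> * sin s) - of_real (exp (- s\<^sup>2 / 2)) * cis (\<mu> * s))
    \<le> \<bar>s\<bar> ^ 3 + s ^ 4 + s\<^sup>2 * \<mu>\<^sup>2"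
proof -
  define e where "e = exp (- s\<^sup>2 / 2)"
  define r where "r = cis s - (1 + \<i> * of_real s - of_real (s\<^sup>2 / 2))"
  have r: "norm r \<le> \<bar>s\<bar> ^ 3 / 6" unfolding r_def by (rule norm_exp_expansion)
  have c: "\<bar>cos s - (1 - s\<^sup>2 / 2)\<bar> \<le> \<bar>s\<bar> ^ 3 / 6"
    using abs_Re_le_cmod[of r] r by (simp add: r_def)
  have sn: "\<bar>sin s - s\<bar> \<le> \<bar>s\<bar> ^ 3 / 6"
    using abs_Im_le_cmod[of r] r by (simp add: r_def)
  have e1: "\<bar>1 - e\<bar> \<le> s\<^sup>2 / 2" and e2: "\<bar>1 - s\<^sup>2 / 2 - e\<bar> \<le> s ^ 4 / 4"
    using exp_minus_bounds[of "s\<^sup>2 / 2"] by (simp_all add: e_def power_divide flip: power_mult)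
  have cis: "norm (cis (\<mu> * s) - (1 + \<i> * of_real (\<mu> * s))) \<le> (\<mu> * s)\<^sup>2 / 2"
    by (rule norm_exp_expansion)
  have cis1: "norm (cis (\<mu> * s) - 1) \<le> \<bar>\<mu> * s\<bar>" by (rule norm_cis_minus_one_le)
  have "of_real (cos s) + \<i> * of_real (\<mu> * sin s) - of_real e * cis (\<mu> * s)
     = of_real (cos s - (1 - s\<^sup>2 / 2)) + \<i> * of_real (\<mu> * (sin s - s)) + of_real (1 - s\<^sup>2 / 2 - e)
       - (cis (\<mu> * s) - (1 + \<i> * of_real (\<mu> * s))) + (cis (\<mu> * s) - 1) * of_real (1 - e)"
    by (simp add: algebra_simps)
  also have "norm \<dots> \<le> \<bar>s\<bar> ^ 3 / 6 + \<bar>s\<bar> ^ 3 / 6 + s ^ 4 / 4 + (\<mu> * s)\<^sup>2 / 2 + \<bar>s\<bar> ^ 3 / 2"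
  proof (intro norm_triangle_mono norm_triangle_le_diff[OF add_mono])
    show "norm (of_real (cos s - (1 - s\<^sup>2 / 2)) :: complex) \<le> \<bar>s\<bar> ^ 3 / 6" unfolding norm_of_real by (rule c)
    have "\<bar>\<mu>\<bar> * \<bar>sin s - s\<bar> \<le> 1 * (\<bar>s\<bar> ^ 3 / 6)" using assms sn by (intro mult_mono) auto
    then show "norm (\<i> * of_real (\<mu> * (sin s - s))) \<le> \<bar>s\<bar> ^ 3 / 6"
      by (simp add: norm_mult flip: of_real_diff)
    show "norm (of_real (1 - s\<^sup>2 / 2 - e) :: complex) \<le> s ^ 4 / 4" unfolding norm_of_real by (rule e2)
    have "norm ((cis (\<mu> * s) - 1) * of_real (1 - e)) = norm (cis (\<mu> * s) - 1) * \<bar>1 - e\<bar>"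
      unfolding norm_mult norm_of_real ..
    also have "\<dots> \<le> \<bar>\<mu> * s\<bar> * (s\<^sup>2 / 2)" using cis1 e1 by (intro mult_mono) auto
    also have "\<dots> \<le> (1 * \<bar>s\<bar>) * (s\<^sup>2 / 2)" unfolding abs_mult using assms by (intro mult_right_mono) auto
    also have "\<dots> = \<bar>s\<bar> ^ 3 / 2" by (simp add: power3_eq_cube power2_eq_square)
    finally show "norm ((cis (\<mu> * s) - 1) * of_real (1 - e)) \<le> \<bar>s\<bar> ^ 3 / 2" .
  qed (rule cis)
  also have "\<dots> \<le> \<bar>s\<bar> ^ 3 + s ^ 4 + s\<^sup>2 * \<mu>\<^sup>2"
  proof -
    have "0 \<le> \<bar>s\<bar> ^ 3" "0 \<le> s ^ 4" "0 \<le> s\<^sup>2 * \<mu>\<^sup>2" "(\<mu> * s)\<^sup>2 = s\<^sup>2 * \<mu>\<^sup>2"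
      by (simp_all add: power_mult_distrib mult.commute)
    then show ?thesis by linarith
  qed
  finally show ?thesis by (simp add: e_def)
qed

lemma subset_mean_cis_sign:
  fixes f :: "'a set \<Rightarrow> int"
  assumes fin: "finite S" and f: "\<And>Z. Z \<subseteq> S \<Longrightarrow> f Z = 1 \<or> f Z = - 1"
  shows "subset_mean p S (\<lambda>Z. cis (s * real_of_int (f Z)))
    = of_real (cos s) + \<i> * of_real (subset_mean p S (\<lambda>Z. real_of_int (f Z)) * sin s)"
proof -
  have "subset_mean p S (\<lambda>Z. cis (s * real_of_int (f Z)))
      = subset_mean p S (\<lambda>Z. of_real (cos s) + \<i> * of_real (sin s) * of_real (real_of_int (f Z)))"
  proof (rule subset_mean_cong)
    fix Z assume "Z \<subseteq> S"
    then show "cis (s * real_of_int (f Z)) = of_real (cos s) + \<i> * of_real (sin s) * of_real (real_of_int (f Z))"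
      using f[of Z] by (auto simp: complex_eq_iff)
  qed
  also have "\<dots> = of_real (cos s) + \<i> * of_real (sin s) * of_real (subset_mean p S (\<lambda>Z. real_of_int (f Z)))"
    unfolding subset_mean_add subset_mean_mult_left subset_mean_of_real using fin by simp
  finally show ?thesis by (simp add: mult_ac)
qed


text \<open>One start for each N, so that limits can be taken along the sequence; no convergence of
  \<open>x_start\<close> is assumed. The bound is asked only eventually, since for small N there may
  be no configuration that satisfies it.\<close>

locale start_sequence =
  fixes b C0 :: real and y :: "nat \<Rightarrow> nat \<Rightarrow> int"
  assumes b: "b > 0" and y: "\<And>N. y N \<in> configs N"
    and start: "\<forall>\<^sub>F N in sequentially. \<bar>x_start b N (y N)\<bar> \<le> C0"
begin

section \<open>Orders of magnitude along a sequence of starts\<close>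

definition p where "p N = edge_prob b N"
definition d where "d N = bias N (y N)"
definition n where "n N = min (card (blue N (y N))) (card (red N (y N)))"
definition k where "k N j = balanced_prob (p N) (n N) j"
text \<open>The bias in units of sqrt (N / ln N), which is \<open>x_start\<close> up to a constant
  factor and hence eventually bounded.\<close>

definition a where "a N = d N * sqrt (ln (real N) / real N)"
definition perr where "perr N = pivot_error N (p N) (y N)"

lemma x_start_a: "x_start b N (y N) = a N * sqrt (2 * b / pi)"
proof -
  have "2 * b * ln (real N) / (pi * real N) = (ln (real N) / real N) * (2 * b / pi)" by (simp add: mult_ac)
  then show ?thesis unfolding x_start_def a_def d_def by (simp only: real_sqrt_mult mult.assoc)
qed

lemma a_bounded: "\<forall>\<^sub>F N in sequentially. \<bar>a N\<bar> \<le> C0 / sqrt (2 * b / pi)"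
  using start
proof eventually_elim
  case (elim N)
  then show ?case using b by (simp add: x_start_a abs_mult pos_le_divide_eq)
qed

lemma a_mult_null:
  assumes "f \<longlonglongrightarrow> 0"
  shows "(\<lambda>N. a N * f N) \<longlonglongrightarrow> 0"
proof (rule Lim_null_comparison)
  show "(\<lambda>N. C0 / sqrt (2 * b / pi) * \<bar>f N\<bar>) \<longlonglongrightarrow> 0"
    using tendsto_mult[OF tendsto_const tendsto_rabs[OF assms], of "C0 / sqrt (2 * b / pi)"] by simp
  show "\<forall>\<^sub>F N in sequentially. norm (a N * f N) \<le> C0 / sqrt (2 * b / pi) * \<bar>f N\<bar>"
    using a_bounded by eventually_elim (simp only: real_norm_def abs_mult mult_right_mono abs_ge_zero)
qed

lemma ev_large: "\<forall>\<^sub>F N in sequentially. real N > 1 \<and> ln (real N) > 0"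
  using eventually_gt_at_top[of "1::nat"] by eventually_elim simp

lemma d_eq: "\<forall>\<^sub>F N in sequentially. d N = a N * sqrt (real N / ln (real N))"
  using ev_large
proof eventually_elim
  case (elim N)
  have "sqrt (ln (real N) / real N) * sqrt (real N / ln (real N)) = 1"
    using elim unfolding real_sqrt_mult[symmetric] by simp
  then show ?case unfolding a_def by (simp only: mult.assoc mult_1_right)
qed

text \<open>Since the bias is O(sqrt (N / ln N)), limits that involve the unknown configuration
  reduce to limits of explicit functions of N.\<close>

lemma d_mult_null:
  assumes "(\<lambda>N. sqrt (real N / ln (real N)) * f N) \<longlonglongrightarrow> 0"
  shows "(\<lambda>N. d N * f N) \<longlonglongrightarrow> 0"
  using a_mult_null[OF assms]
  by (rule Lim_transform_eventually) (use d_eq in eventually_elim, simp)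

lemma p_tendsto: "p \<longlonglongrightarrow> 0"
  unfolding p_def edge_prob_def by real_asymp

lemma p_bounds: "\<forall>\<^sub>F N in sequentially. 0 \<le> p N \<and> p N \<le> 1"
  using ev_large order_tendstoD(2)[OF p_tendsto zero_less_one]
  by eventually_elim (use b in \<open>simp add: p_def edge_prob_def\<close>)

lemma dp_sqrt_ln: "(\<lambda>N. d N * (p N * sqrt (ln (real N)))) \<longlonglongrightarrow> 0"
  unfolding p_def edge_prob_def by (rule d_mult_null) real_asymp

lemma dp: "(\<lambda>N. d N * p N) \<longlonglongrightarrow> 0"
  unfolding p_def edge_prob_def by (rule d_mult_null) real_asymp

lemma n_eq: "2 * real (n N) = real N - \<bar>d N\<bar>"
proof -
  have "card (blue N (y N)) + card (red N (y N)) = N"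
    using blue_red[OF y, of N] by (metis card_Un_disjoint card_atLeastAtMost diff_Suc_1)
  then have "real (card (blue N (y N))) + real (card (red N (y N))) = real N" by linarith
  then show ?thesis by (auto simp: n_def d_def bias_def min_def)
qed

lemma Np: "N > 0 \<Longrightarrow> real N * p N = b * ln (real N)"
  by (simp add: p_def edge_prob_def)

lemma np_over_ln: "(\<lambda>N. 2 * real (n N) * p N * (1 - p N) / ln (real N)) \<longlonglongrightarrow> b"
proof -
  have "(\<lambda>N. \<bar>d N * (p N / ln (real N))\<bar>) \<longlonglongrightarrow> \<bar>0\<bar>"
    unfolding p_def edge_prob_def by (intro tendsto_rabs d_mult_null) real_asymp
  from tendsto_mult[OF tendsto_diff[OF tendsto_const this] tendsto_diff[OF tendsto_const p_tendsto], of b 1]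
  have "(\<lambda>N. (b - \<bar>d N * (p N / ln (real N))\<bar>) * (1 - p N)) \<longlonglongrightarrow> b" by simp
  then show ?thesis
  proof (rule Lim_transform_eventually)
    show "\<forall>\<^sub>F N in sequentially. (b - \<bar>d N * (p N / ln (real N))\<bar>) * (1 - p N)
        = 2 * real (n N) * p N * (1 - p N) / ln (real N)"
      using ev_large p_bounds
    proof eventually_elim
      case (elim N)
      have "2 * real (n N) * p N = real N * p N - \<bar>d N\<bar> * p N" unfolding n_eq by (simp add: algebra_simps)
      also have "\<dots> = b * ln (real N) - \<bar>d N\<bar> * p N" using Np[of N] elim by simp
      finally have E: "2 * real (n N) * p N = b * ln (real N) - \<bar>d N\<bar> * p N" .
      have "\<bar>d N * (p N / ln (real N))\<bar> = \<bar>d N\<bar> * p N / ln (real N)" using elim by (simp add: abs_mult)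
      then show ?case unfolding E using elim by (simp add: field_simps)
    qed
  qed
qed

text \<open>The local limit theorem with variance 2 n p (1 - p) asymptotic to b ln N, because the
  smaller colour class contains about half of the vertices.\<close>

lemma k_limit: "(\<lambda>N. sqrt (ln (real N)) * k N j) \<longlonglongrightarrow> 1 / sqrt (2 * pi * b)"
proof -
  let ?r = "\<lambda>N. sqrt (2 * real (n N) * p N * (1 - p N) / ln (real N))"
  have "filterlim (\<lambda>N. real (n N) * p N) at_top sequentially"
  proof (rule filterlim_at_top_mono)
    have "filterlim (\<lambda>N. b / 4 * ln (real N)) at_top sequentially" using b by real_asymp
    then show "filterlim (\<lambda>N. b / 4 * ln (real N)) at_top sequentially" .
    have "\<forall>\<^sub>F N in sequentially. b / 2 < 2 * real (n N) * p N * (1 - p N) / ln (real N)"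
      using np_over_ln b by (intro order_tendstoD(1)) auto
    with ev_large p_bounds show "\<forall>\<^sub>F N in sequentially. b / 4 * ln (real N) \<le> real (n N) * p N"
    proof eventually_elim
      case (elim N)
      then have "b / 2 * ln (real N) < 2 * (real (n N) * p N) * (1 - p N)" by (simp add: field_simps)
      also have "\<dots> \<le> 2 * (real (n N) * p N) * 1" using elim by (intro mult_left_mono) auto
      finally show ?case by simp
    qed
  qed
  then have 1: "(\<lambda>N. sqrt (2 * real (n N) * p N * (1 - p N)) * k N j) \<longlonglongrightarrow> 1 / sqrt (2 * pi)"
    unfolding k_def by (intro local_limit p_bounds p_tendsto)
  have 2: "?r \<longlonglongrightarrow> sqrt b" by (intro tendsto_real_sqrt np_over_ln)
  have "(\<lambda>N. (sqrt (2 * real (n N) * p N * (1 - p N)) * k N j) / ?r N) \<longlonglongrightarrow> (1 / sqrt (2 * pi)) / sqrt b"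
    using b by (intro tendsto_divide 1 2) auto
  then have 3: "(\<lambda>N. (sqrt (2 * real (n N) * p N * (1 - p N)) * k N j) / ?r N) \<longlonglongrightarrow> 1 / sqrt (2 * pi * b)"
    by (simp add: real_sqrt_mult)
  show ?thesis
  proof (rule Lim_transform_eventually[OF 3])
    have "\<forall>\<^sub>F N in sequentially. 0 < 2 * real (n N) * p N * (1 - p N) / ln (real N)"
      using np_over_ln b by (intro order_tendstoD(1)) auto
    with ev_large show "\<forall>\<^sub>F N in sequentially. (sqrt (2 * real (n N) * p N * (1 - p N)) * k N j) / ?r N
        = sqrt (ln (real N)) * k N j"
    proof eventually_elim
      case (elim N)
      then have "sqrt (2 * real (n N) * p N * (1 - p N)) > 0" "sqrt (ln (real N)) > 0"
        by (simp_all add: zero_less_divide_iff)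
      moreover have "(r * x) / (r / r') = r' * x" if "r > 0" "r' > 0" for r r' x :: real
        using that by simp
      ultimately show ?case unfolding real_sqrt_divide by blast
    qed
  qed
qed

lemma k_null: "(\<lambda>N. k N j) \<longlonglongrightarrow> 0"
proof -
  have "(\<lambda>N. 1 / sqrt (ln (real N))) \<longlonglongrightarrow> 0" by real_asymp
  from tendsto_mult[OF k_limit this] have "(\<lambda>N. sqrt (ln (real N)) * k N j * (1 / sqrt (ln (real N)))) \<longlonglongrightarrow> 0"
    by simp
  then show ?thesis by (rule Lim_transform_eventually) (use ev_large in eventually_elim, simp)
qed

text \<open>The replacement error is of smaller order than the pivotal probability itself, which has
  order 1 / sqrt (ln N). For the difference of \<open>k N 0\<close> and \<open>k N 1\<close> this
  holds because the limit in \<open>k_limit\<close> does not depend on \<open>j\<close>.\<close>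

lemma perr_limit: "(\<lambda>N. sqrt (ln (real N)) * perr N) \<longlonglongrightarrow> 0"
proof -
  have 1: "(\<lambda>N. 4 * (sqrt (ln (real N)) * p N)) \<longlonglongrightarrow> 0"
    unfolding p_def edge_prob_def by real_asymp
  have 2: "(\<lambda>N. 2 * \<bar>d N * (p N * sqrt (ln (real N)))\<bar>) \<longlonglongrightarrow> 0"
    using tendsto_mult[OF tendsto_const tendsto_rabs[OF dp_sqrt_ln], of 2] by simp
  have 3: "(\<lambda>N. \<bar>sqrt (ln (real N)) * k N 0 - sqrt (ln (real N)) * k N 1\<bar>) \<longlonglongrightarrow> 0"
    using tendsto_rabs[OF tendsto_diff[OF k_limit[of 0] k_limit[of 1]]] by simp
  have "(\<lambda>N. 4 * (sqrt (ln (real N)) * p N) + 2 * \<bar>d N * (p N * sqrt (ln (real N)))\<bar>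
      + \<bar>sqrt (ln (real N)) * k N 0 - sqrt (ln (real N)) * k N 1\<bar>) \<longlonglongrightarrow> 0"
    using tendsto_add[OF tendsto_add[OF 1 2] 3] by simp
  then show ?thesis
  proof (rule Lim_transform_eventually)
    show "\<forall>\<^sub>F N in sequentially. 4 * (sqrt (ln (real N)) * p N) + 2 * \<bar>d N * (p N * sqrt (ln (real N)))\<bar>
      + \<bar>sqrt (ln (real N)) * k N 0 - sqrt (ln (real N)) * k N 1\<bar> = sqrt (ln (real N)) * perr N"
      using ev_large
    proof eventually_elim
      case (elim N)
      have "\<bar>sqrt (ln (real N)) * k N 0 - sqrt (ln (real N)) * k N 1\<bar> = sqrt (ln (real N)) * \<bar>k N 0 - k N 1\<bar>"
        using elim by (simp add: abs_mult flip: right_diff_distrib)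
      moreover have "\<bar>d N * (p N * sqrt (ln (real N)))\<bar> = sqrt (ln (real N)) * (\<bar>d N\<bar> * p N)"
        using elim b by (simp add: abs_mult p_def edge_prob_def)
      ultimately show ?case
        unfolding perr_def pivot_error_def Let_def n_def[symmetric] k_def[symmetric] d_def[symmetric]
        by (simp add: algebra_simps)
    qed
  qed
qed


section \<open>Shared edges against private coins\<close>

abbreviation H where "H t N \<equiv> hybrid_char N (p N) (y N) (t / sqrt (real N))"

definition \<gamma> where
  "\<gamma> t N = 4 * (sin (t / sqrt (real N)))\<^sup>2 * p N * (1 - p N) * (k N 0)\<^sup>2"

text \<open>The factors have orders t^2 / N for the squared sine, ln N / N for the edge probability
  and 1 / ln N for the squared pivotal probability; their product is O(1 / N^2).\<close>

lemma \<gamma>_bounds: "\<forall>\<^sub>F N in sequentially. 0 \<le> \<gamma> t N \<and>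
    \<gamma> t N * (real N)\<^sup>2 \<le> 4 * t\<^sup>2 * b * (sqrt (ln (real N)) * k N 0)\<^sup>2"
  using ev_large p_bounds
proof eventually_elim
  case (elim N)
  have "(sin (t / sqrt (real N)))\<^sup>2 \<le> (t / sqrt (real N))\<^sup>2"
    using abs_sin_x_le_abs_x[of "t / sqrt (real N)"] by (simp only: abs_le_square_iff)
  also have "\<dots> = t\<^sup>2 / real N" using elim by (simp add: power_divide)
  finally have "\<gamma> t N \<le> 4 * (t\<^sup>2 / real N) * p N * 1 * (k N 0)\<^sup>2"
    unfolding \<gamma>_def using elim by (intro mult_mono) auto
  then have "\<gamma> t N * (real N)\<^sup>2 \<le> 4 * (t\<^sup>2 / real N) * p N * 1 * (k N 0)\<^sup>2 * (real N)\<^sup>2"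
    by (intro mult_right_mono) auto
  also have "\<dots> = 4 * t\<^sup>2 * (real N * p N) * (k N 0)\<^sup>2"
    using elim by (simp add: power2_eq_square)
  also have "real N * p N = b * ln (real N)" using Np[of N] elim by simp
  also have "4 * t\<^sup>2 * (b * ln (real N)) * (k N 0)\<^sup>2 = 4 * t\<^sup>2 * b * (sqrt (ln (real N)) * k N 0)\<^sup>2"
    using elim by (simp add: power_mult_distrib)
  finally have "\<gamma> t N * (real N)\<^sup>2 \<le> 4 * t\<^sup>2 * b * (sqrt (ln (real N)) * k N 0)\<^sup>2" .
  moreover have "0 \<le> \<gamma> t N" using elim by (simp add: \<gamma>_def)
  ultimately show ?case by simp
qed

definition G where "G t N = 4 * t\<^sup>2 * b * (sqrt (ln (real N)) * k N 0)\<^sup>2"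

lemma G_limit: "(\<lambda>N. G t N) \<longlonglongrightarrow> 4 * t\<^sup>2 * b * (1 / sqrt (2 * pi * b))\<^sup>2"
  unfolding G_def by (intro tendsto_intros k_limit)

lemma edge_sign: "e \<in> all_edges N \<Longrightarrow> \<bar>real_of_int (\<Prod>w\<in>e. y N w)\<bar> = 1"
proof -
  assume "e \<in> all_edges N"
  then have "(\<Prod>w\<in>e. \<bar>real_of_int (y N w)\<bar>) = (\<Prod>w\<in>e. 1)"
    using configs_values[OF y[of N]] by (intro prod.cong) (fastforce simp: all_edges_def)+
  then show ?thesis by (simp add: abs_prod)
qed

lemma edge_product_limit:
  "(\<lambda>N. \<Prod>e\<in>all_edges N. 1 - \<gamma> t N * real_of_int (\<Prod>w\<in>e. y N w)) \<longlonglongrightarrow> 1"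
proof -
  have sum: "(\<Sum>e\<in>all_edges N. real_of_int (\<Prod>w\<in>e. y N w)) = ((d N)\<^sup>2 - real N) / 2" for N
  proof -
    have "2 * (\<Sum>e\<in>all_edges N. \<Prod>w\<in>e. y N w) = (\<Sum>v\<in>{1..N}. y N v)\<^sup>2 - int N"
      by (rule sum_edge_signs) (rule configs_values[OF y])
    then have "real_of_int (2 * (\<Sum>e\<in>all_edges N. \<Prod>w\<in>e. y N w)) = real_of_int ((\<Sum>v\<in>{1..N}. y N v)\<^sup>2 - int N)"
      by simp
    then show ?thesis unfolding d_def bias_eq_sum[OF y] by simp
  qed
  have inv: "(\<lambda>N. 1 / (real N)\<^sup>2) \<longlonglongrightarrow> 0" "(\<lambda>N. 1 / real N) \<longlonglongrightarrow> 0" by real_asymp+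
  have d2: "(\<lambda>N. (d N)\<^sup>2 / (real N)\<^sup>2) \<longlonglongrightarrow> 0"
  proof -
    have "(\<lambda>N. d N * (1 / real N)) \<longlonglongrightarrow> 0" by (rule d_mult_null) real_asymp
    from tendsto_power[OF this, of 2] show ?thesis by (simp add: power_divide)
  qed
  have "(\<lambda>N. \<Prod>e\<in>all_edges N. 1 + (- (\<gamma> t N * real_of_int (\<Prod>w\<in>e. y N w)))) \<longlonglongrightarrow> 1"
  proof (rule prod_tendsto_1[where g = "\<lambda>N. G t N / (real N)\<^sup>2"])
    show "\<forall>\<^sub>F N in sequentially. \<forall>e\<in>all_edges N.
        \<bar>- (\<gamma> t N * real_of_int (\<Prod>w\<in>e. y N w))\<bar> \<le> G t N / (real N)\<^sup>2"
      using \<gamma>_bounds[of t] ev_large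
    proof eventually_elim
      case (elim N)
      show ?case
      proof
        fix e assume e: "e \<in> all_edges N"
        have "\<bar>- (\<gamma> t N * real_of_int (\<Prod>w\<in>e. y N w))\<bar> = \<gamma> t N"
          using elim edge_sign[OF e] by (simp only: abs_minus abs_mult) simp
        also have "\<dots> \<le> G t N / (real N)\<^sup>2"
          using elim by (simp add: pos_le_divide_eq G_def)
        finally show "\<bar>- (\<gamma> t N * real_of_int (\<Prod>w\<in>e. y N w))\<bar> \<le> G t N / (real N)\<^sup>2" .
      qed
    qed
    show "(\<lambda>N. G t N / (real N)\<^sup>2) \<longlonglongrightarrow> 0"
      using tendsto_mult[OF G_limit inv(1)] by simp
    show "(\<lambda>N. (G t N / (real N)\<^sup>2)\<^sup>2 * real (card (all_edges N))) \<longlonglongrightarrow> 0"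
    proof (rule Lim_null_comparison)
      show "(\<lambda>N. (G t N)\<^sup>2 * (1 / (real N)\<^sup>2)) \<longlonglongrightarrow> 0"
        using tendsto_mult[OF tendsto_power[OF G_limit] inv(1)] by simp
      show "\<forall>\<^sub>F N in sequentially. norm ((G t N / (real N)\<^sup>2)\<^sup>2 * real (card (all_edges N)))
          \<le> (G t N)\<^sup>2 * (1 / (real N)\<^sup>2)"
        using ev_large
      proof eventually_elim
        case (elim N)
        have "real (card (all_edges N)) \<le> (real N)\<^sup>2"
          using card_all_edges_le[of N] by (metis of_nat_le_iff of_nat_power)
        then have "(G t N / (real N)\<^sup>2)\<^sup>2 * real (card (all_edges N)) \<le> (G t N / (real N)\<^sup>2)\<^sup>2 * (real N)\<^sup>2"
          by (intro mult_left_mono) auto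
        also have "\<dots> = (G t N)\<^sup>2 * (1 / (real N)\<^sup>2)"
          using elim by (simp add: power2_eq_square)
        finally show ?case by simp
      qed
    qed
    show "(\<lambda>N. \<Sum>e\<in>all_edges N. - (\<gamma> t N * real_of_int (\<Prod>w\<in>e. y N w))) \<longlonglongrightarrow> 0"
    proof (rule Lim_null_comparison)
      have "(\<lambda>N. G t N * (((d N)\<^sup>2 / (real N)\<^sup>2 + 1 / real N) / 2)) \<longlonglongrightarrow> (4 * t\<^sup>2 * b * (1 / sqrt (2 * pi * b))\<^sup>2) * ((0 + 0) / 2)"
        by (intro tendsto_mult G_limit tendsto_divide tendsto_add d2 inv(2) tendsto_const) simp
      then show "(\<lambda>N. G t N * (((d N)\<^sup>2 / (real N)\<^sup>2 + 1 / real N) / 2)) \<longlonglongrightarrow> 0" by simp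
      show "\<forall>\<^sub>F N in sequentially. norm (\<Sum>e\<in>all_edges N. - (\<gamma> t N * real_of_int (\<Prod>w\<in>e. y N w)))
          \<le> G t N * (((d N)\<^sup>2 / (real N)\<^sup>2 + 1 / real N) / 2)"
        using \<gamma>_bounds[of t] ev_large
      proof eventually_elim
        case (elim N)
        have "norm (\<Sum>e\<in>all_edges N. - (\<gamma> t N * real_of_int (\<Prod>w\<in>e. y N w))) = \<gamma> t N * \<bar>((d N)\<^sup>2 - real N) / 2\<bar>"
          unfolding sum_negf sum_distrib_left[symmetric] sum using elim by (simp add: abs_mult)
        also have "\<dots> \<le> \<gamma> t N * (((d N)\<^sup>2 + real N) / 2)"
        proof (intro mult_left_mono)
          show "\<bar>((d N)\<^sup>2 - real N) / 2\<bar> \<le> ((d N)\<^sup>2 + real N) / 2"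
            using abs_triangle_ineq4[of "(d N)\<^sup>2" "real N"] by simp
        qed (use elim in simp)
        also have "\<dots> = (\<gamma> t N * (real N)\<^sup>2) * (((d N)\<^sup>2 / (real N)\<^sup>2 + 1 / real N) / 2)"
          using elim by (simp add: field_simps power2_eq_square)
        also have "\<dots> \<le> G t N * (((d N)\<^sup>2 / (real N)\<^sup>2 + 1 / real N) / 2)"
          using elim unfolding G_def by (intro mult_right_mono) auto
        finally show ?case .
      qed
    qed
  qed simp
  then show ?thesis by simp
qed

lemma char_shared_independent:
  "(\<lambda>N. H t N (all_edges N) - H t N {}) \<longlonglongrightarrow> 0"
proof -
  define P where "P N = (\<Prod>e\<in>all_edges N. 1 - \<gamma> t N * real_of_int (\<Prod>w\<in>e. y N w))" for N
  \<comment> \<open>This is N^2 times the error of \<open>hybrid_char_step\<close> at s = t / sqrt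
    N, rewritten with N p = b ln N. The factor N^2 bounds the number of edges, and
    \<open>exp (G t N)\<close> below bounds the amplification in
    \<open>perturbed_product\<close>.\<close>
  define r where "r N = 8 * \<bar>t\<bar> ^ 3 * b * (ln (real N) * (4 * b * ln (real N) + 1) / sqrt (real N))
     + 4 * t\<^sup>2 * b * ((sqrt (ln (real N)) * perr N) * (2 * (sqrt (ln (real N)) * k N 0) + sqrt (ln (real N)) * perr N))" for N
  have r: "r \<longlonglongrightarrow> 0"
  proof -
    have 1: "(\<lambda>N. ln (real N) * (4 * b * ln (real N) + 1) / sqrt (real N)) \<longlonglongrightarrow> 0"
      using b by real_asymp
    have "r \<longlonglongrightarrow> 8 * \<bar>t\<bar> ^ 3 * b * 0 + 4 * t\<^sup>2 * b * (0 * (2 * (1 / sqrt (2 * pi * b)) + 0))"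
      unfolding r_def by (intro tendsto_intros 1 perr_limit k_limit)
    then show ?thesis by simp
  qed
  have H1: "norm (H t N A) \<le> 1" if "0 \<le> p N \<and> p N \<le> 1" for N A
    unfolding hybrid_char_def
    using that by (intro norm_subset_mean_bound) (auto simp flip: prod_norm)
  have main: "\<forall>\<^sub>F N in sequentially. norm (H t N (all_edges N) - of_real (P N) * H t N {}) \<le> r N * exp (G t N)"
    using \<gamma>_bounds[of t] ev_large p_bounds
  proof eventually_elim
    case (elim N)
    define s where "s = t / sqrt (real N)"
    define \<delta> where "\<delta> = 8 * \<bar>s\<bar> ^ 3 * p N * (4 * p N * real N + 1)
        + 4 * s\<^sup>2 * p N * (perr N * (2 * k N 0 + perr N))"
    have p: "0 \<le> p N" "p N \<le> 1" using elim by auto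
    have N: "real N > 0" using elim by simp
    have perr0: "0 \<le> perr N" unfolding perr_def pivot_error_def Let_def using p by simp
    have k0: "0 \<le> k N 0" unfolding k_def using balanced_prob_bounds[OF p] by simp
    have \<delta>0: "0 \<le> \<delta>" unfolding \<delta>_def using p perr0 k0 by simp
    have \<delta>r: "(real N)\<^sup>2 * \<delta> = r N"
    proof -
      have s3: "\<bar>s\<bar> ^ 3 * real N = \<bar>t\<bar> ^ 3 / sqrt (real N)" "s\<^sup>2 * real N = t\<^sup>2"
      proof -
        have "sqrt (real N) ^ 3 = real N * sqrt (real N)" using N by (simp add: power3_eq_cube)
        then show "\<bar>s\<bar> ^ 3 * real N = \<bar>t\<bar> ^ 3 / sqrt (real N)"
          using N by (simp add: s_def power_divide)
        show "s\<^sup>2 * real N = t\<^sup>2" using N by (simp add: s_def power_divide)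
      qed
      have Np': "real N * p N = b * ln (real N)" using Np[of N] N by simp
      have "(real N)\<^sup>2 * \<delta> = 8 * (\<bar>s\<bar> ^ 3 * real N) * (real N * p N) * (4 * (real N * p N) + 1)
         + 4 * (s\<^sup>2 * real N) * (real N * p N) * (perr N * (2 * k N 0 + perr N))"
        unfolding \<delta>_def by (simp add: algebra_simps power2_eq_square)
      also have "\<dots> = 8 * (\<bar>t\<bar> ^ 3 / sqrt (real N)) * (b * ln (real N)) * (4 * (b * ln (real N)) + 1)
         + 4 * t\<^sup>2 * b * ((sqrt (ln (real N)) * sqrt (ln (real N))) * (perr N * (2 * k N 0 + perr N)))"
        unfolding s3 Np' using elim by simp
      also have "\<dots> = r N" unfolding r_def by (simp only: algebra_simps times_divide_eq_left times_divide_eq_right add_divide_distrib)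
      finally show ?thesis .
    qed
    have cardE: "real (card (all_edges N)) \<le> (real N)\<^sup>2"
      using card_all_edges_le[of N] by (metis of_nat_le_iff of_nat_power)
    have "norm (H t N (all_edges N) - (\<Prod>e\<in>all_edges N. of_real (1 - \<gamma> t N * real_of_int (\<Prod>w\<in>e. y N w))) * H t N {})
       \<le> real (card (all_edges N)) * \<delta> * (1 + \<gamma> t N) ^ card (all_edges N)"
    proof (rule perturbed_product[OF finite_all_edges \<delta>0])
      show "0 \<le> \<gamma> t N" using elim by simp
      fix e assume e: "e \<in> all_edges N"
      have "\<bar>1 - \<gamma> t N * real_of_int (\<Prod>w\<in>e. y N w)\<bar> \<le> \<bar>1\<bar> + \<bar>\<gamma> t N * real_of_int (\<Prod>w\<in>e. y N w)\<bar>"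
        by (rule abs_triangle_ineq4)
      also have "\<dots> = 1 + \<gamma> t N" unfolding abs_mult edge_sign[OF e] using elim by simp
      finally show "norm (of_real (1 - \<gamma> t N * real_of_int (\<Prod>w\<in>e. y N w)) :: complex) \<le> 1 + \<gamma> t N"
        unfolding norm_of_real .
      fix A assume "e \<notin> A"
      then show "norm (H t N (insert e A) - of_real (1 - \<gamma> t N * real_of_int (\<Prod>w\<in>e. y N w)) * H t N A) \<le> \<delta>"
        using hybrid_char_step[OF y p e, of A s]
        unfolding \<delta>_def \<gamma>_def s_def[symmetric] k_def n_def perr_def by simp
    qed
    also have "\<dots> \<le> ((real N)\<^sup>2 * \<delta>) * exp (G t N)"
    proof (intro mult_mono)
      have "(1 + \<gamma> t N) ^ card (all_edges N) \<le> exp (\<gamma> t N) ^ card (all_edges N)"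
        using elim exp_ge_add_one_self[of "\<gamma> t N"] by (intro power_mono) auto
      also have "\<dots> = exp (real (card (all_edges N)) * \<gamma> t N)" by (simp add: exp_of_nat_mult)
      also have "\<dots> \<le> exp ((real N)\<^sup>2 * \<gamma> t N)"
        using cardE elim by (simp add: mult_right_mono)
      also have "\<dots> \<le> exp (G t N)" using elim by (simp add: G_def mult.commute)
      finally show "(1 + \<gamma> t N) ^ card (all_edges N) \<le> exp (G t N)" .
    qed (use cardE \<delta>0 elim in auto)
    finally show ?case unfolding \<delta>r P_def of_real_prod .
  qed
  show ?thesis
  proof (rule Lim_null_comparison)
    show "(\<lambda>N. r N * exp (G t N) + \<bar>P N - 1\<bar>) \<longlonglongrightarrow> 0"
      using tendsto_add[OF tendsto_mult[OF r tendsto_exp[OF G_limit]]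
          tendsto_rabs[OF tendsto_diff[OF edge_product_limit[of t] tendsto_const[of 1]]]]
      by (simp add: P_def)
    show "\<forall>\<^sub>F N in sequentially. norm (H t N (all_edges N) - H t N {}) \<le> r N * exp (G t N) + \<bar>P N - 1\<bar>"
      using main p_bounds
    proof eventually_elim
      case (elim N)
      have "H t N (all_edges N) - H t N {} = (H t N (all_edges N) - of_real (P N) * H t N {}) + of_real (P N - 1) * H t N {}"
        by (simp add: algebra_simps)
      also have "norm \<dots> \<le> r N * exp (G t N) + \<bar>P N - 1\<bar> * 1"
      proof (rule norm_triangle_mono[OF elim(1)])
        show "norm (of_real (P N - 1) * H t N {}) \<le> \<bar>P N - 1\<bar> * 1"
          unfolding norm_mult norm_of_real using H1[OF elim(2)] by (intro mult_left_mono) auto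
      qed
      finally show ?case by simp
    qed
  qed
qed


text \<open>In \<open>m\<close> and \<open>z\<close> a vertex may be its own neighbour.  This costs only \<open>2 p\<close> and gives all
  vertices the same tally distribution.\<close>

definition \<mu> where
  "\<mu> N w = subset_mean (p N) ({1..N} - {w}) (\<lambda>Z. real_of_int (vote N (y N) Z w))"

definition m where
  "m N = subset_mean (p N) {1..N} (\<lambda>Z. real_of_int (sgn (tally (blue N (y N)) (red N (y N)) Z)))"

definition z where
  "z N = (subset_mean (p N) {1..N} (\<lambda>Z. of_bool (tally (blue N (y N)) (red N (y N)) Z = 0)) :: real)"

section \<open>Means of the votes and the product of independent factors\<close>

lemma abs_vote: "w \<in> {1..N} \<Longrightarrow> \<bar>real_of_int (vote N (y N) Z w)\<bar> = 1"
  using vote_values[OF y, of w N Z] by auto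

text \<open>A tie is resolved in favour of the old colour, which adds \<open>y N w * z N\<close> to
  the mean sign. Over all vertices these terms sum to \<open>d N * z N\<close>, which is negligible
  against sqrt N.\<close>

lemma \<mu>_approx:
  assumes p: "0 \<le> p N" "p N \<le> 1" and w: "w \<in> {1..N}"
  shows "\<bar>\<mu> N w - (m N + y N w * z N)\<bar> \<le> 2 * p N"
proof -
  let ?g = "\<lambda>Z. real_of_int (vote N (y N) Z w)"
  have "subset_mean (p N) {1..N} ?g = m N + y N w * z N"
  proof -
    have "subset_mean (p N) {1..N} ?g = subset_mean (p N) {1..N}
      (\<lambda>Z. real_of_int (sgn (tally (blue N (y N)) (red N (y N)) Z))
         + y N w * of_bool (tally (blue N (y N)) (red N (y N)) Z = 0))"
      by (intro subset_mean_cong) (simp add: vote_def Let_def)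
    then show ?thesis by (simp add: subset_mean_add subset_mean_mult_left m_def z_def)
  qed
  moreover have "\<bar>subset_mean (p N) {1..N} ?g - subset_mean (p N) ({1..N} - {w}) ?g\<bar> \<le> 2 * p N * real (card {w})"
    using w abs_vote[OF w] by (intro subset_mean_remove[OF p]) auto
  ultimately show ?thesis by (simp add: \<mu>_def abs_minus_commute)
qed

lemma m_approx:
  assumes "0 \<le> p N" "p N \<le> 1"
  shows "\<bar>m N - d N * p N * (k N 0 + k N 1)\<bar> \<le> 2 * (d N * p N)\<^sup>2"
  using unbalanced_sgn[OF assms blue_red(1-3)[OF y, of N]] blue_red(4)[OF y, of N]
  by (simp add: m_def k_def n_def d_def bias_def)

lemma z_approx:
  assumes "0 \<le> p N" "p N \<le> 1"
  shows "\<bar>z N - k N 0\<bar> \<le> 2 * (\<bar>d N\<bar> * p N)"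
  using unbalanced_prob[OF assms blue_red(1-3)[OF y, of N], of 0] blue_red(4)[OF y, of N]
  by (simp add: z_def k_def n_def d_def bias_def)

lemma m_null: "m \<longlonglongrightarrow> 0"
proof -
  have "(\<lambda>N. m N - d N * p N * (k N 0 + k N 1)) \<longlonglongrightarrow> 0"
  proof (rule Lim_null_comparison)
    show "(\<lambda>N. 2 * (d N * p N)\<^sup>2) \<longlonglongrightarrow> 0"
      using tendsto_mult[OF tendsto_const tendsto_power[OF dp, of 2], of 2] by simp
    show "\<forall>\<^sub>F N in sequentially. norm (m N - d N * p N * (k N 0 + k N 1)) \<le> 2 * (d N * p N)\<^sup>2"
      using p_bounds by eventually_elim (simp add: m_approx)
  qed
  from tendsto_add[OF this tendsto_mult[OF dp tendsto_add[OF k_null[of 0] k_null[of 1]]]] show ?thesis by simp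
qed

lemma z_null: "z \<longlonglongrightarrow> 0"
proof -
  have "(\<lambda>N. z N - k N 0) \<longlonglongrightarrow> 0"
  proof (rule Lim_null_comparison)
    show "(\<lambda>N. 2 * \<bar>d N * p N\<bar>) \<longlonglongrightarrow> 0"
      using tendsto_mult[OF tendsto_const tendsto_rabs[OF dp], of 2] by simp
    show "\<forall>\<^sub>F N in sequentially. norm (z N - k N 0) \<le> 2 * \<bar>d N * p N\<bar>"
      using p_bounds
    proof eventually_elim
      case (elim N)
      then show ?case using z_approx[of N] by (simp add: abs_mult)
    qed
  qed
  from tendsto_add[OF this k_null[of 0]] show ?thesis by simp
qed

text \<open>The vote of one vertex has mean about \<open>\<Delta> p sqrt (2 / (\<pi> b ln N))\<close>, where \<open>\<Delta>\<close> is the initial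
  bias; this is the origin of the constant in \<^const>\<open>x_start\<close>.\<close>

lemma m_limit: "(\<lambda>N. sqrt (real N) * m N - x_start b N (y N)) \<longlonglongrightarrow> 0"
proof -
  have 1: "(\<lambda>N. sqrt (real N) * (m N - d N * p N * (k N 0 + k N 1))) \<longlonglongrightarrow> 0"
  proof (rule Lim_null_comparison)
    \<comment> \<open>The fourth root of N distributes the factor sqrt N evenly over the two factors
      of (d p)^2.\<close>
    have "(\<lambda>N. d N * (sqrt (sqrt (real N)) * p N)) \<longlonglongrightarrow> 0"
      unfolding p_def edge_prob_def by (rule d_mult_null) real_asymp
    from tendsto_mult[OF tendsto_const tendsto_power[OF this, of 2], of 2]
    show "(\<lambda>N. 2 * (d N * (sqrt (sqrt (real N)) * p N))\<^sup>2) \<longlonglongrightarrow> 0" by simp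
    show "\<forall>\<^sub>F N in sequentially. norm (sqrt (real N) * (m N - d N * p N * (k N 0 + k N 1)))
        \<le> 2 * (d N * (sqrt (sqrt (real N)) * p N))\<^sup>2"
      using p_bounds
    proof eventually_elim
      case (elim N)
      have "sqrt (real N) * \<bar>m N - d N * p N * (k N 0 + k N 1)\<bar> \<le> sqrt (real N) * (2 * (d N * p N)\<^sup>2)"
        using m_approx[of N] elim by (intro mult_left_mono) auto
      then show ?case by (simp add: abs_mult power_mult_distrib mult_ac)
    qed
  qed
  have "(\<lambda>N. b * (sqrt (ln (real N)) * k N 0 + sqrt (ln (real N)) * k N 1) - sqrt (2 * b / pi))
      \<longlonglongrightarrow> b * (1 / sqrt (2 * pi * b) + 1 / sqrt (2 * pi * b)) - sqrt (2 * b / pi)"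
    by (intro tendsto_intros k_limit)
  also have "b * (1 / sqrt (2 * pi * b) + 1 / sqrt (2 * pi * b)) - sqrt (2 * b / pi) = 0"
  proof -
    have "sqrt (2 * b / pi) * sqrt (2 * pi * b) = 2 * b"
    proof -
      have "2 * b / pi * (2 * pi * b) = (2 * b)\<^sup>2" by (simp add: power2_eq_square)
      then show ?thesis using b unfolding real_sqrt_mult[symmetric] by (simp only: real_sqrt_abs)
    qed
    then have "sqrt (2 * b / pi) = 2 * b / sqrt (2 * pi * b)" using b by (simp add: field_simps)
    then show ?thesis by simp
  qed
  finally have 2: "(\<lambda>N. a N * (b * (sqrt (ln (real N)) * k N 0 + sqrt (ln (real N)) * k N 1) - sqrt (2 * b / pi))) \<longlonglongrightarrow> 0"
    by (rule a_mult_null)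
  from tendsto_add[OF 1 2]
  have "(\<lambda>N. sqrt (real N) * (m N - d N * p N * (k N 0 + k N 1))
     + a N * (b * (sqrt (ln (real N)) * k N 0 + sqrt (ln (real N)) * k N 1) - sqrt (2 * b / pi))) \<longlonglongrightarrow> 0" by simp
  then show ?thesis
  proof (rule Lim_transform_eventually)
    show "\<forall>\<^sub>F N in sequentially. sqrt (real N) * (m N - d N * p N * (k N 0 + k N 1))
     + a N * (b * (sqrt (ln (real N)) * k N 0 + sqrt (ln (real N)) * k N 1) - sqrt (2 * b / pi))
     = sqrt (real N) * m N - x_start b N (y N)"
      using ev_large
    proof eventually_elim
      case (elim N)
      have "a N * b * sqrt (ln (real N)) = d N * b * ln (real N) / sqrt (real N)"
        using elim by (simp add: a_def real_sqrt_divide)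
      also have "\<dots> = sqrt (real N) * (d N * p N)"
        using elim by (simp add: p_def edge_prob_def field_simps)
      finally have *: "a N * b * sqrt (ln (real N)) = sqrt (real N) * (d N * p N)" .
      have "a N * (b * (sqrt (ln (real N)) * k N 0 + sqrt (ln (real N)) * k N 1))
         = (a N * b * sqrt (ln (real N))) * (k N 0 + k N 1)" by (simp add: algebra_simps)
      then have "a N * (b * (sqrt (ln (real N)) * k N 0 + sqrt (ln (real N)) * k N 1))
         = sqrt (real N) * (d N * p N) * (k N 0 + k N 1)" unfolding * .
      then show ?case unfolding x_start_a by (simp add: algebra_simps)
    qed
  qed
qed

text \<open>After division by sqrt N the ties contribute d z / sqrt N, and letting each vertex
  consult itself costs at most 2 N p / sqrt N = 2 b ln N / sqrt N; both tend to 0.\<close>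

lemma sum_\<mu>_limit: "(\<lambda>N. (\<Sum>w\<in>{1..N}. \<mu> N w) / sqrt (real N) - x_start b N (y N)) \<longlonglongrightarrow> 0"
proof -
  have 1: "(\<lambda>N. (\<Sum>w\<in>{1..N}. \<mu> N w) / sqrt (real N) - sqrt (real N) * m N) \<longlonglongrightarrow> 0"
  proof (rule Lim_null_comparison)
    have "(\<lambda>N. d N * (1 / sqrt (real N))) \<longlonglongrightarrow> 0" by (rule d_mult_null) real_asymp
    from tendsto_rabs[OF tendsto_mult[OF this z_null]]
    have "(\<lambda>N. \<bar>d N * (1 / sqrt (real N)) * z N\<bar>) \<longlonglongrightarrow> 0" by simp
    moreover have "(\<lambda>N. 2 * b * ln (real N) / sqrt (real N)) \<longlonglongrightarrow> 0" by real_asymp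
    ultimately show "(\<lambda>N. \<bar>d N * (1 / sqrt (real N)) * z N\<bar> + 2 * b * ln (real N) / sqrt (real N)) \<longlonglongrightarrow> 0"
      using tendsto_add by fastforce
    show "\<forall>\<^sub>F N in sequentially. norm ((\<Sum>w\<in>{1..N}. \<mu> N w) / sqrt (real N) - sqrt (real N) * m N)
        \<le> \<bar>d N * (1 / sqrt (real N)) * z N\<bar> + 2 * b * ln (real N) / sqrt (real N)"
      using p_bounds ev_large
    proof eventually_elim
      case (elim N)
      have "(\<Sum>w\<in>{1..N}. m N + y N w * z N) = real N * m N + d N * z N"
        by (simp add: sum.distrib d_def bias_eq_sum[OF y] flip: sum_distrib_right)
      then have "\<bar>(\<Sum>w\<in>{1..N}. \<mu> N w) - (real N * m N + d N * z N)\<bar>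
          = \<bar>\<Sum>w\<in>{1..N}. \<mu> N w - (m N + y N w * z N)\<bar>" by (simp add: sum_subtractf)
      also have "\<dots> \<le> (\<Sum>w\<in>{1..N}. 2 * p N)"
        using \<mu>_approx[of N] elim by (intro order_trans[OF sum_abs sum_mono]) auto
      also have "\<dots> = 2 * b * ln (real N)" using Np[of N] elim by simp
      finally have "\<bar>(\<Sum>w\<in>{1..N}. \<mu> N w) - real N * m N\<bar> \<le> \<bar>d N * z N\<bar> + 2 * b * ln (real N)" by linarith
      then have "\<bar>(\<Sum>w\<in>{1..N}. \<mu> N w) - real N * m N\<bar> / sqrt (real N)
          \<le> (\<bar>d N * z N\<bar> + 2 * b * ln (real N)) / sqrt (real N)"
        by (intro divide_right_mono) auto
      moreover have "(\<Sum>w\<in>{1..N}. \<mu> N w) / sqrt (real N) - sqrt (real N) * m N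
          = ((\<Sum>w\<in>{1..N}. \<mu> N w) - real N * m N) / sqrt (real N)"
        using elim by (simp add: field_simps)
      ultimately show ?case by (simp add: abs_mult add_divide_distrib)
    qed
  qed
  from tendsto_add[OF 1 m_limit] show ?thesis by simp
qed

text \<open>Each of the N factors is replaced by a Gaussian factor with phase s \<mu>. As N s^2 =
  t^2, the errors from \<open>sign_char_approx\<close> sum to O(1 / sqrt N) plus t^2 times the
  largest squared mean, which \<open>\<beta>\<close> controls. The phases add up to t
  \<open>x_start\<close> up to o(1) by \<open>sum_\<mu>_limit\<close>.\<close>

lemma char_independent:
  "(\<lambda>N. H t N {} * cis (- t * x_start b N (y N)))
    \<longlonglongrightarrow> of_real (exp (- t\<^sup>2 / 2))"
proof -
  define s where "s N = t / sqrt (real N)" for N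
  define \<beta> where "\<beta> N = \<bar>m N\<bar> + \<bar>z N\<bar> + 2 * p N" for N
  define \<theta> where "\<theta> N = s N * (\<Sum>w\<in>{1..N}. \<mu> N w) - t * x_start b N (y N)" for N
  define r where "r N = \<bar>t\<bar> ^ 3 * (1 / sqrt (real N)) + t ^ 4 * (1 / real N) + t\<^sup>2 * (\<beta> N)\<^sup>2" for N
  have \<beta>: "\<beta> \<longlonglongrightarrow> 0"
    unfolding \<beta>_def
    using tendsto_add[OF tendsto_add[OF tendsto_rabs[OF m_null] tendsto_rabs[OF z_null]]
        tendsto_mult[OF tendsto_const p_tendsto, of 2]] by simp
  have r: "r \<longlonglongrightarrow> 0"
  proof -
    have "(\<lambda>N. 1 / sqrt (real N)) \<longlonglongrightarrow> 0" "(\<lambda>N. 1 / real N) \<longlonglongrightarrow> 0" by real_asymp+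
    then have "r \<longlonglongrightarrow> \<bar>t\<bar> ^ 3 * 0 + t ^ 4 * 0 + t\<^sup>2 * 0\<^sup>2"
      unfolding r_def by (intro tendsto_intros \<beta>)
    then show ?thesis by simp
  qed
  have \<theta>: "\<theta> \<longlonglongrightarrow> 0"
    using tendsto_mult[OF tendsto_const sum_\<mu>_limit, of t] by (simp add: \<theta>_def[abs_def] s_def algebra_simps)
  have "(\<lambda>N. H t N {} * cis (- t * x_start b N (y N)) - of_real (exp (- t\<^sup>2 / 2))) \<longlonglongrightarrow> 0"
  proof (rule Lim_null_comparison)
    show "(\<lambda>N. r N + \<bar>\<theta> N\<bar>) \<longlonglongrightarrow> 0" using tendsto_add[OF r tendsto_rabs[OF \<theta>]] by simp
    show "\<forall>\<^sub>F N in sequentially. norm (H t N {} * cis (- t * x_start b N (y N))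
        - of_real (exp (- t\<^sup>2 / 2))) \<le> r N + \<bar>\<theta> N\<bar>"
      using p_bounds ev_large
    proof eventually_elim
      case (elim N)
      have N: "real N > 0" and p: "0 \<le> p N" "p N \<le> 1" using elim by auto
      let ?f = "\<lambda>w. of_real (cos (s N)) + \<i> * of_real (\<mu> N w * sin (s N)) :: complex"
      let ?e = "of_real (exp (- (s N)\<^sup>2 / 2)) :: complex"
      have H: "H t N {} = (\<Prod>w\<in>{1..N}. ?f w)"
        unfolding hybrid_char_empty \<mu>_def s_def
        using vote_values[OF y[of N]] by (intro prod.cong refl subset_mean_cis_sign) auto
      have \<mu>1: "\<bar>\<mu> N w\<bar> \<le> 1" if "w \<in> {1..N}" for w
        unfolding \<mu>_def using norm_subset_mean_bound[OF p, of "{1..N} - {w}"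
            "\<lambda>Z. real_of_int (vote N (y N) Z w)" 1] abs_vote[OF that] by simp
      have \<mu>\<beta>: "\<bar>\<mu> N w\<bar> \<le> \<beta> N" if "w \<in> {1..N}" for w
      proof -
        have "\<bar>real_of_int (y N w) * z N\<bar> = \<bar>z N\<bar>"
          using configs_values[OF y that] by (auto simp: abs_mult)
        then show ?thesis using \<mu>_approx[OF p that] unfolding \<beta>_def by linarith
      qed
      have f1: "norm (?f w) \<le> 1" if "w \<in> {1..N}" for w
      proof -
        have "?f w = subset_mean (p N) ({1..N} - {w}) (\<lambda>Z. cis (s N * real_of_int (vote N (y N) Z w)))"
          unfolding \<mu>_def using vote_values[OF y[of N] that] by (intro subset_mean_cis_sign[symmetric]) auto
        then show ?thesis using norm_subset_mean_bound[OF p, of "{1..N} - {w}"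
            "\<lambda>Z. cis (s N * real_of_int (vote N (y N) Z w))" 1] by simp
      qed
      have e1: "norm (?e * cis (\<mu> N w * s N)) \<le> 1" for w by (simp add: norm_mult)
      have s: "(s N)\<^sup>2 = t\<^sup>2 / real N" using N by (simp add: s_def power_divide)
      have prod: "(\<Prod>w\<in>{1..N}. ?e * cis (\<mu> N w * s N)) = of_real (exp (- t\<^sup>2 / 2)) * cis (s N * (\<Sum>w\<in>{1..N}. \<mu> N w))"
      proof -
        have "(\<Prod>w\<in>{1..N}. ?e) = of_real (exp (real N * (- (s N)\<^sup>2 / 2)))"
          unfolding exp_of_nat_mult by simp
        also have "real N * (- (s N)\<^sup>2 / 2) = - t\<^sup>2 / 2" unfolding s using N by simp
        finally show ?thesis unfolding prod.distrib prod_cis sum_distrib_right[symmetric]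
          by (simp add: mult.commute)
      qed
      have "norm ((\<Prod>w\<in>{1..N}. ?f w) - (\<Prod>w\<in>{1..N}. ?e * cis (\<mu> N w * s N)))
          \<le> (\<Sum>w\<in>{1..N}. norm (?f w - ?e * cis (\<mu> N w * s N)))"
        by (rule norm_prod_diff) (use f1 e1 in auto)
      also have "\<dots> \<le> (\<Sum>w\<in>{1..N}. \<bar>s N\<bar> ^ 3 + (s N) ^ 4 + (s N)\<^sup>2 * (\<beta> N)\<^sup>2)"
      proof (rule sum_mono)
        fix w assume w: "w \<in> {1..N}"
        have "(\<mu> N w)\<^sup>2 \<le> (\<beta> N)\<^sup>2" using power_mono[OF \<mu>\<beta>[OF w], of 2] by simp
        then have "(s N)\<^sup>2 * (\<mu> N w)\<^sup>2 \<le> (s N)\<^sup>2 * (\<beta> N)\<^sup>2" by (intro mult_left_mono) auto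
        with sign_char_approx[OF \<mu>1[OF w], of "s N"]
        show "norm (?f w - ?e * cis (\<mu> N w * s N)) \<le> \<bar>s N\<bar> ^ 3 + (s N) ^ 4 + (s N)\<^sup>2 * (\<beta> N)\<^sup>2"
          by linarith
      qed
      also have "\<dots> = r N"
      proof -
        have 3: "real N * \<bar>s N\<bar> ^ 3 = \<bar>t\<bar> ^ 3 * (1 / sqrt (real N))"
        proof -
          have "sqrt (real N) ^ 3 = real N * sqrt (real N)" using N by (simp add: power3_eq_cube)
          then show ?thesis using N by (simp add: s_def power_divide)
        qed
        have "(s N) ^ 4 = ((s N)\<^sup>2)\<^sup>2" by simp
        then have 4: "real N * (s N) ^ 4 = t ^ 4 * (1 / real N)"
          unfolding s using N by (simp add: power_divide power2_eq_square[of "real N"] flip: power_mult)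
        have 2: "real N * (s N)\<^sup>2 = t\<^sup>2" unfolding s using N by simp
        have "(\<Sum>w\<in>{1..N}. \<bar>s N\<bar> ^ 3 + (s N) ^ 4 + (s N)\<^sup>2 * (\<beta> N)\<^sup>2)
           = real N * \<bar>s N\<bar> ^ 3 + real N * (s N) ^ 4 + (real N * (s N)\<^sup>2) * (\<beta> N)\<^sup>2"
          by (simp add: algebra_simps)
        then show ?thesis unfolding 2 3 4 r_def .
      qed
      finally have diff: "norm (H t N {}
          - of_real (exp (- t\<^sup>2 / 2)) * cis (s N * (\<Sum>w\<in>{1..N}. \<mu> N w))) \<le> r N"
        unfolding H prod .
      let ?E = "of_real (exp (- t\<^sup>2 / 2)) :: complex" and ?x = "cis (- t * x_start b N (y N))"
      have cc: "cis (s N * (\<Sum>w\<in>{1..N}. \<mu> N w)) * ?x = cis (\<theta> N)" by (simp add: cis_mult \<theta>_def)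
      have "H t N {} * ?x - ?E
         = (H t N {} - ?E * cis (s N * (\<Sum>w\<in>{1..N}. \<mu> N w))) * ?x
           + ?E * (cis (s N * (\<Sum>w\<in>{1..N}. \<mu> N w)) * ?x - 1)"
        by (simp add: algebra_simps)
      also have "norm \<dots> \<le> r N + \<bar>\<theta> N\<bar>"
      proof (rule norm_triangle_mono)
        show "norm ((H t N {} - ?E * cis (s N * (\<Sum>w\<in>{1..N}. \<mu> N w))) * ?x) \<le> r N"
          using diff by (simp add: norm_mult)
        have "norm (?E * (cis (\<theta> N) - 1)) \<le> 1 * \<bar>\<theta> N\<bar>"
          unfolding norm_mult by (intro mult_mono norm_cis_minus_one_le) auto
        then show "norm (?E * (cis (s N * (\<Sum>w\<in>{1..N}. \<mu> N w)) * ?x - 1)) \<le> \<bar>\<theta> N\<bar>" unfolding cc by simp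
      qed
      finally show ?case .
    qed
  qed
  then show ?thesis by (rule LIM_zero_cancel)
qed

end


section \<open>The law of the dynamics\<close>

definition step_pmf :: "nat \<Rightarrow> real \<Rightarrow> (nat \<Rightarrow> int) \<Rightarrow> (nat \<Rightarrow> int) pmf" where
  "step_pmf N p x = map_pmf (\<lambda>E. majority_step N E x) (ER N p)"

text \<open>The dynamics as a Markov chain on configurations. Conditioning on the first days then
  becomes a bind, with no conditioning on the space of graph sequences; \<open>prob_day\<close>
  translates between the two descriptions.\<close>

primrec law :: "nat \<Rightarrow> real \<Rightarrow> (nat \<Rightarrow> int) \<Rightarrow> nat \<Rightarrow> (nat \<Rightarrow> int) pmf" where
  "law N p x 0 = return_pmf x"
| "law N p x (Suc t) = bind_pmf (law N p x t) (step_pmf N p)"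

lemma law_add: "law N p x (s + t) = bind_pmf (law N p x s) (\<lambda>z. law N p z t)"
  by (induction t) (simp_all add: bind_return_pmf' bind_assoc_pmf)

lemma law_configs: "x \<in> configs N \<Longrightarrow> set_pmf (law N p x t) \<subseteq> configs N"
  by (induction t) (auto simp: step_pmf_def intro: majority_step_configs)

lemma day_configs: "x \<in> configs N \<Longrightarrow> day N x G t \<in> configs N"
  by (induction t) (auto intro: majority_step_configs)

lemma day_cong:
  assumes "\<And>i. i \<in> {1..t} \<Longrightarrow> G i = G' i"
  shows "day N x G t = day N x G' t"
  using assms by (induction t) simp_all

text \<open>There are finitely many configurations, so the event splits into finitely many cylinder
  events. The index set \<open>J\<close> is left free because the lemma is applied both to the whole
  sequence and to its first \<open>t\<close> graphs.\<close>

lemma day_measurable: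
  assumes x: "x \<in> configs N" and J: "{1..t} \<subseteq> J"
  shows "{G \<in> space (\<Pi>\<^sub>M t\<in>J. measure_pmf (ER N p)). day N x G t = z} \<in> sets (\<Pi>\<^sub>M t\<in>J. measure_pmf (ER N p))"
  using J
proof (induction t arbitrary: z)
  case 0
  then show ?case by (cases "x = z") auto
next
  case (Suc t)
  let ?Q = "\<Pi>\<^sub>M t\<in>J. measure_pmf (ER N p)"
  have "{G \<in> space ?Q. day N x G (Suc t) = z} = (\<Union>x'\<in>configs N.
      {G \<in> space ?Q. day N x G t = x'} \<inter> {G \<in> space ?Q. G (Suc t) \<in> {E. majority_step N E x' = z}})"
    using day_configs[OF x] by auto
  also have "\<dots> \<in> sets ?Q"
  proof (intro sets.finite_UN sets.Int)
    show "{G \<in> space ?Q. day N x G t = x'} \<in> sets ?Q" for x'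
      by (rule Suc.IH) (use Suc.prems in auto)
    show "{G \<in> space ?Q. G (Suc t) \<in> {E. majority_step N E x' = z}} \<in> sets ?Q" for x'
      by (rule sets_Collect_single) (use Suc in auto)
  qed simp
  finally show ?case .
qed

lemma prob_space_ER_seq: "prob_space (ER_seq N p)"
  unfolding ER_seq_def by (intro prob_space_PiM measure_pmf.prob_space_axioms)

text \<open>Day \<open>t\<close> is a function of the graphs 1 to t only, and disjoint blocks of
  coordinates of the product measure are independent.\<close>

lemma indep_day_next_graph:
  assumes x: "x \<in> configs N"
  shows "\<P>(G in ER_seq N p. day N x G t = z \<and> G (Suc t) \<in> A)
    = \<P>(G in ER_seq N p. day N x G t = z) * measure (measure_pmf (ER N p)) A"
proof -
  let ?M = "\<lambda>t::nat. measure_pmf (ER N p)"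
  let ?I = "{1::nat..}"
  interpret prob_space "ER_seq N p" by (rule prob_space_ER_seq)
  have Q: "ER_seq N p = PiM ?I ?M" by (simp add: ER_seq_def)
  have comp: "(\<lambda>G. G i) \<in> measurable (ER_seq N p) (?M i)" if "i \<in> ?I" for i
    unfolding Q using that by (rule measurable_component_singleton)
  have distr: "distr (ER_seq N p) (?M i) (\<lambda>G. G i) = ?M i" if "i \<in> ?I" for i
    unfolding Q using that by (intro distr_PiM_component measure_pmf.prob_space_axioms)
  have "indep_vars ?M (\<lambda>i G. G i) ?I"
  proof (subst indep_vars_iff_distr_eq_PiM')
    show "distr (ER_seq N p) (PiM ?I ?M) (\<lambda>G. \<lambda>i\<in>?I. G i) = PiM ?I (\<lambda>i. distr (ER_seq N p) (?M i) (\<lambda>G. G i))"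
    proof -
      have "distr (ER_seq N p) (PiM ?I ?M) (\<lambda>G. \<lambda>i\<in>?I. G i) = distr (PiM ?I ?M) (PiM ?I ?M) (\<lambda>G. G)"
        unfolding Q by (intro distr_cong refl) (auto simp: space_PiM)
      also have "\<dots> = PiM ?I ?M" by (simp add: distr_id2)
      also have "\<dots> = PiM ?I (\<lambda>i. distr (ER_seq N p) (?M i) (\<lambda>G. G i))"
        by (intro PiM_cong refl distr[symmetric])
      finally show ?thesis .
    qed
  qed (use comp in auto)
  then have ind: "indep_var (PiM {1..t} ?M) (\<lambda>G. restrict (\<lambda>i. G i) {1..t}) (PiM {Suc t} ?M) (\<lambda>G. restrict (\<lambda>i. G i) {Suc t})"
    by (rule indep_var_restrict) auto
  define D where "D = {g \<in> space (PiM {1..t} ?M). day N x g t = z}"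
  define C where "C = {g \<in> space (PiM {Suc t} ?M). g (Suc t) \<in> A}"
  have D: "D \<in> sets (PiM {1..t} ?M)" unfolding D_def by (intro day_measurable x) simp
  have C: "C \<in> sets (PiM {Suc t} ?M)" unfolding C_def by (rule sets_Collect_single) auto
  have resD: "restrict G {1..t} \<in> D \<longleftrightarrow> day N x G t = z" for G
    using day_cong[of t "restrict G {1..t}" G N x] by (simp add: D_def space_PiM)
  have resC: "restrict G {Suc t} \<in> C \<longleftrightarrow> G (Suc t) \<in> A" for G
    by (simp add: C_def space_PiM)
  have "prob ((\<lambda>G. (restrict G {1..t}, restrict G {Suc t})) -` (D \<times> C) \<inter> space (ER_seq N p))
     = prob ((\<lambda>G. restrict G {1..t}) -` D \<inter> space (ER_seq N p)) * prob ((\<lambda>G. restrict G {Suc t}) -` C \<inter> space (ER_seq N p))"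
    using indep_varD[OF ind D C] .
  also have "(\<lambda>G. (restrict G {1..t}, restrict G {Suc t})) -` (D \<times> C) \<inter> space (ER_seq N p)
      = {G \<in> space (ER_seq N p). day N x G t = z \<and> G (Suc t) \<in> A}"
    using resD resC by auto
  also have "(\<lambda>G. restrict G {1..t}) -` D \<inter> space (ER_seq N p) = {G \<in> space (ER_seq N p). day N x G t = z}"
    using resD by auto
  also have "prob ((\<lambda>G. restrict G {Suc t}) -` C \<inter> space (ER_seq N p)) = measure (?M (Suc t)) A"
  proof -
    have "measure (?M (Suc t)) A = measure (distr (ER_seq N p) (?M (Suc t)) (\<lambda>G. G (Suc t))) A"
      using distr[of "Suc t"] by simp
    also have "\<dots> = prob ((\<lambda>G. G (Suc t)) -` A \<inter> space (ER_seq N p))"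
      using comp[of "Suc t"] by (intro measure_distr) auto
    also have "(\<lambda>G. G (Suc t)) -` A \<inter> space (ER_seq N p) = (\<lambda>G. restrict G {Suc t}) -` C \<inter> space (ER_seq N p)"
      using resC by auto
    finally show ?thesis ..
  qed
  finally show ?thesis .
qed

lemma prob_day_eq_sum:
  assumes x: "x \<in> configs N"
    and meas: "\<And>z. z \<in> configs N \<Longrightarrow> {G \<in> space (ER_seq N p). day N x G t = z \<and> P G z} \<in> sets (ER_seq N p)"
  shows "\<P>(G in ER_seq N p. P G (day N x G t)) = (\<Sum>z\<in>configs N. \<P>(G in ER_seq N p. day N x G t = z \<and> P G z))"
proof -
  interpret prob_space "ER_seq N p" by (rule prob_space_ER_seq)
  have "{G \<in> space (ER_seq N p). P G (day N x G t)} = (\<Union>z\<in>configs N. {G \<in> space (ER_seq N p). day N x G t = z \<and> P G z})"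
    using day_configs[OF x] by auto
  then show ?thesis
    using meas by (simp only:) (intro finite_measure_finite_Union; auto simp: disjoint_family_on_def)
qed

lemma prob_day_eq:
  assumes x: "x \<in> configs N"
  shows "\<P>(G in ER_seq N p. day N x G t = z) = pmf (law N p x t) z"
proof (induction t arbitrary: z)
  case 0
  interpret prob_space "ER_seq N p" by (rule prob_space_ER_seq)
  show ?case by (cases "x = z") (simp_all add: prob_space)
next
  case (Suc t)
  have sets: "{G \<in> space (ER_seq N p). day N x G t = z' \<and> majority_step N (G (Suc t)) z' = z} \<in> sets (ER_seq N p)" for z'
  proof -
    have "{G \<in> space (ER_seq N p). day N x G t = z' \<and> majority_step N (G (Suc t)) z' = z}
       = {G \<in> space (ER_seq N p). day N x G t = z'} \<inter> {G \<in> space (ER_seq N p). G (Suc t) \<in> {E. majority_step N E z' = z}}"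
      by auto
    also have "\<dots> \<in> sets (ER_seq N p)"
      unfolding ER_seq_def by (intro sets.Int day_measurable[OF x] sets_Collect_single) auto
    finally show ?thesis .
  qed
  have "\<P>(G in ER_seq N p. day N x G (Suc t) = z)
     = (\<Sum>z'\<in>configs N. \<P>(G in ER_seq N p. day N x G t = z' \<and> majority_step N (G (Suc t)) z' = z))"
    using prob_day_eq_sum[OF x, of p t "\<lambda>G z'. majority_step N (G (Suc t)) z' = z"] sets by simp
  also have "\<dots> = (\<Sum>z'\<in>configs N. pmf (law N p x t) z' * pmf (step_pmf N p z') z)"
  proof (rule sum.cong[OF refl])
    fix z' assume "z' \<in> configs N"
    have "\<P>(G in ER_seq N p. day N x G t = z' \<and> majority_step N (G (Suc t)) z' = z)
        = \<P>(G in ER_seq N p. day N x G t = z') * measure (measure_pmf (ER N p)) {E. majority_step N E z' = z}"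
      using indep_day_next_graph[OF x, of p t z' "{E. majority_step N E z' = z}"] by simp
    also have "measure (measure_pmf (ER N p)) {E. majority_step N E z' = z} = pmf (step_pmf N p z') z"
      by (simp add: step_pmf_def pmf_map vimage_def)
    finally show "\<P>(G in ER_seq N p. day N x G t = z' \<and> majority_step N (G (Suc t)) z' = z)
        = pmf (law N p x t) z' * pmf (step_pmf N p z') z" using Suc by simp
  qed
  also have "\<dots> = pmf (law N p x (Suc t)) z"
    unfolding law.simps pmf_bind
    by (subst integral_measure_pmf[OF finite_configs]) (use law_configs[OF x] in \<open>auto simp: mult_ac\<close>)
  finally show ?case .
qed

lemma prob_day:
  assumes x: "x \<in> configs N"
  shows "\<P>(G in ER_seq N p. A (day N x G t)) = measure (measure_pmf (law N p x t)) {z. A z}"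
proof -
  have *: "{G \<in> space (ER_seq N p). day N x G t = z \<and> A z} = (if A z then {G \<in> space (ER_seq N p). day N x G t = z} else {})" for z
    by auto
  have "\<P>(G in ER_seq N p. A (day N x G t)) = (\<Sum>z\<in>configs N. \<P>(G in ER_seq N p. day N x G t = z \<and> A z))"
  proof (rule prob_day_eq_sum[OF x])
    fix z show "{G \<in> space (ER_seq N p). day N x G t = z \<and> A z} \<in> sets (ER_seq N p)"
      unfolding * using day_measurable[OF x, of t "{1..}" p z] by (auto simp: ER_seq_def)
  qed
  also have "\<dots> = (\<Sum>z\<in>configs N \<inter> {z. A z}. pmf (law N p x t) z)"
    unfolding * by (simp add: sum.inter_restrict prob_day_eq[OF x] if_distrib cong: if_cong)
  also have "\<dots> = measure (measure_pmf (law N p x t)) (configs N \<inter> {z. A z})"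
    by (rule measure_measure_pmf_finite[symmetric]) simp
  also have "\<dots> = measure (measure_pmf (law N p x t)) {z. A z}"
    by (rule measure_eq_AE) (use law_configs[OF x] in \<open>auto simp: AE_measure_pmf_iff\<close>)
  finally show ?thesis .
qed


section \<open>The normal approximation of the first day\<close>

lemma Phi_mono: "x \<le> y \<Longrightarrow> Phi x \<le> Phi y"
  unfolding Phi_def
  by (rule finite_borel_measure.cdf_nondecreasing)
    (simp_all add: real_dist_normal_dist real_distribution.finite_borel_measure_M)

lemma Phi_bounds: "0 \<le> Phi x" "Phi x \<le> 1"
  unfolding Phi_def
  by (simp_all add: finite_borel_measure.cdf_nonneg real_distribution.cdf_bounded_prob
      real_dist_normal_dist real_distribution.finite_borel_measure_M)

lemma emeasure_std_normal:
  "A \<in> sets borel \<Longrightarrow> emeasure std_normal_distribution A = (\<integral>\<^sup>+x\<in>A. ennreal (std_normal_density x) \<partial>lborel)"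
  by (simp add: emeasure_density)

text \<open>The normal density is at most 1. Besides continuity this gives the term 1 / h of
  \<open>err\<close>: moving the threshold from 0 to sqrt N / h shifts the argument of
  \<open>Phi\<close> by 1 / h.\<close>

lemma Phi_Lipschitz:
  assumes "x \<le> y"
  shows "Phi y - Phi x \<le> y - x"
proof (cases "x = y")
  case False
  interpret real_distribution std_normal_distribution by (rule real_dist_normal_dist)
  have d1: "std_normal_density u \<le> 1" for u
  proof -
    have "1 \<le> sqrt (2 * pi)" using pi_gt3 by simp
    then have "1 / sqrt (2 * pi) * exp (- u\<^sup>2 / 2) \<le> 1 * 1" by (intro mult_mono) auto
    then show ?thesis by (simp add: std_normal_density_def)
  qed
  have "Phi y - Phi x = measure std_normal_distribution {x<..y}"
    unfolding Phi_def using assms False by (simp add: cdf_diff_eq)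
  moreover have "emeasure std_normal_distribution {x<..y} \<le> ennreal (y - x)"
  proof -
    have "emeasure std_normal_distribution {x<..y} = (\<integral>\<^sup>+u\<in>{x<..y}. ennreal (std_normal_density u) \<partial>lborel)"
      by (rule emeasure_std_normal) simp
    also have "\<dots> \<le> (\<integral>\<^sup>+u\<in>{x<..y}. 1 \<partial>lborel)"
    proof (rule nn_integral_mono)
      fix u
      have "ennreal (std_normal_density u) \<le> ennreal 1" using d1[of u] by (rule ennreal_leI)
      then show "ennreal (std_normal_density u) * indicator {x<..y} u \<le> 1 * indicator {x<..y} u"
        unfolding ennreal_1 by (rule mult_right_mono) (rule zero_le)
    qed
    also have "\<dots> = ennreal (y - x)" using assms by simp
    finally show ?thesis .
  qed
  ultimately show ?thesis using assms by (simp only: emeasure_eq_measure ennreal_le_iff diff_ge_0_iff_ge)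
qed simp

lemma isCont_Phi: "isCont Phi x"
proof -
  have "\<bar>Phi y - Phi x\<bar> \<le> 1 * \<bar>y - x\<bar>" for y
    using Phi_Lipschitz[of x y] Phi_Lipschitz[of y x] Phi_mono[of x y] Phi_mono[of y x]
    by (cases "x \<le> y") auto
  then have "dist (Phi y) (Phi x) \<le> dist y x" for y by (simp add: dist_real_def)
  then show ?thesis
    unfolding continuous_at_eps_delta by (meson le_less_trans)
qed

lemma Phi_limits: "(Phi \<longlongrightarrow> 1) at_top" "(Phi \<longlongrightarrow> 0) at_bot"
proof -
  interpret real_distribution std_normal_distribution by (rule real_dist_normal_dist)
  show "(Phi \<longlongrightarrow> 1) at_top" unfolding Phi_def by (rule cdf_lim_at_top_prob)
  show "(Phi \<longlongrightarrow> 0) at_bot" unfolding Phi_def by (rule cdf_lim_at_bot)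
qed

lemma Phi_uminus: "Phi (- x) = 1 - Phi x"
proof -
  interpret real_distribution std_normal_distribution by (rule real_dist_normal_dist)
  have "emeasure std_normal_distribution {..- x} = (\<integral>\<^sup>+u. ennreal (std_normal_density u) * indicator {..- x} u \<partial>lborel)"
    by (rule emeasure_std_normal) simp
  also have "\<dots> = (\<integral>\<^sup>+u. ennreal (std_normal_density (- u)) * indicator {..- x} (- u) \<partial>lborel)"
    by (subst nn_integral_real_affine[where c = "-1" and t = 0]) auto
  also have "\<dots> = (\<integral>\<^sup>+u. ennreal (std_normal_density u) * indicator {x..} u \<partial>lborel)"
    by (intro nn_integral_cong) (auto simp: std_normal_density_def split: split_indicator)
  also have "\<dots> = emeasure std_normal_distribution {x..}"
    by (rule emeasure_std_normal[symmetric]) simp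
  finally have 1: "measure std_normal_distribution {..- x} = measure std_normal_distribution {x..}"
    by (simp add: emeasure_eq_measure)
  have "emeasure std_normal_distribution {x} = 0"
    by (simp add: emeasure_std_normal nn_integral_cmult_indicator)
  then have "measure std_normal_distribution {x} = 0" by (simp add: measure_def)
  moreover have "{x..} = {x<..} \<union> {x}" by auto
  ultimately have 2: "measure std_normal_distribution {x..} = measure std_normal_distribution {x<..}"
    using finite_measure_Union[of "{x<..}" "{x}"] by simp
  have "measure std_normal_distribution {x<..} = 1 - measure std_normal_distribution {..x}"
    using prob_compl[of "{..x}"] by (simp add: Compl_eq_Diff_UNIV[symmetric] Compl_atMost)
  then show ?thesis using 1 2 by (simp add: Phi_def cdf_def)
qed

lemma Phi_0: "Phi 0 = 1 / 2"
  using Phi_uminus[of 0] by simp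

lemma Phi_surj:
  assumes "0 < q" "q < 1"
  obtains x where "Phi x = q"
proof -
  obtain l where l: "Phi l < q"
    using order_tendstoD(2)[OF Phi_limits(2) assms(1)] unfolding eventually_at_bot_linorder by blast
  obtain u where u: "q < Phi u"
    using order_tendstoD(1)[OF Phi_limits(1) assms(2)] unfolding eventually_at_top_linorder by blast
  have "l \<le> u" using l u Phi_mono[of u l] by (cases "l \<le> u") auto
  with l u IVT[of Phi l q u] show ?thesis using isCont_Phi that by force
qed

text \<open>The theorem of Polya: for monotone functions, convergence at finitely many quantiles of
  the continuous limit controls all points. The losses below are at most 3 / K, and K is chosen with
  4 / K < e.\<close>

lemma Phi_uniform:
  fixes F :: "nat \<Rightarrow> real \<Rightarrow> real"
  assumes mono: "\<And>n x y. x \<le> y \<Longrightarrow> F n x \<le> F n y" and F: "\<And>n x. 0 \<le> F n x \<and> F n x \<le> 1"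
    and lim: "\<And>x. (\<lambda>n. F n x) \<longlonglongrightarrow> Phi x" and e: "e > 0"
  shows "\<forall>\<^sub>F n in sequentially. \<forall>x. \<bar>F n x - Phi x\<bar> \<le> e"
proof -
  obtain K :: nat where "real K > 4 / e" using reals_Archimedean2 by blast
  moreover have "4 / e > 0" using e by simp
  ultimately have K: "real K > 4 / e" "K > 0" by (auto intro: gr0I)
  then have Ke: "4 / real K < e" using e by (simp add: field_simps)
  have "\<exists>x. Phi x = real i / real K" if "i \<in> {1..<K}" for i
  proof -
    have "0 < real i / real K" "real i / real K < 1" using that K by auto
    then show ?thesis by (metis Phi_surj)
  qed
  then obtain g where g: "\<And>i. i \<in> {1..<K} \<Longrightarrow> Phi (g i) = real i / real K" by metis
  have "\<forall>\<^sub>F n in sequentially. \<forall>i\<in>{1..<K}. \<bar>F n (g i) - Phi (g i)\<bar> < 1 / real K"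
  proof (intro eventually_ball_finite ballI)
    fix i
    have "(\<lambda>n. \<bar>F n (g i) - Phi (g i)\<bar>) \<longlonglongrightarrow> 0"
      using tendsto_rabs[OF LIM_zero[OF lim[of "g i"]]] by simp
    then show "\<forall>\<^sub>F n in sequentially. \<bar>F n (g i) - Phi (g i)\<bar> < 1 / real K"
      using K by (intro order_tendstoD(2)) auto
  qed simp
  then show ?thesis
  proof eventually_elim
    case (elim n)
    show ?case
    proof
      fix x
      \<comment> \<open>So i / K \<le> Phi x < (i + 1) / K. The point x is enclosed by the quantiles
        of levels i - 1 and i + 1: monotonicity of \<open>Phi\<close> orders two points only when
        their values differ strictly, and level i may equal Phi x. Near the ends of the range the
        bounds 0 and 1 on \<open>F\<close> take over.\<close>
      define i where "i = nat \<lfloor>real K * Phi x\<rfloor>"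
      have i: "real i \<le> real K * Phi x" "real K * Phi x < real i + 1"
        using Phi_bounds[of x] by (simp_all add: i_def of_nat_nat)
      have K0: "real K > 0" using K by simp
      have upper: "F n x \<le> Phi x + 2 / real K"
      proof (cases "Suc i < K")
        case True
        then have m: "Suc i \<in> {1..<K}" by simp
        have "Phi x < Phi (g (Suc i))" unfolding g[OF m] using i K0 by (simp add: field_simps)
        then have "x \<le> g (Suc i)" using Phi_mono[of "g (Suc i)" x] by (cases "x \<le> g (Suc i)") auto
        then have "F n x \<le> F n (g (Suc i))" by (rule mono)
        also have "\<dots> \<le> real (Suc i) / real K + 1 / real K" using elim m g[OF m] by force
        also have "\<dots> = (real i + 2) / real K" by (simp add: add_divide_distrib)
        also have "\<dots> \<le> (real K * Phi x + 2) / real K" using i K0 by (intro divide_right_mono) auto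
        also have "\<dots> = Phi x + 2 / real K" using K0 by (simp add: add_divide_distrib)
        finally show ?thesis .
      next
        case False
        then have "real K \<le> real i + 1" by linarith
        then have "real K - 1 \<le> real K * Phi x" using i by linarith
        then have "1 \<le> Phi x + 1 / real K" using K0 by (simp add: field_simps)
        moreover have "1 / real K \<le> 2 / real K" using K0 by (simp add: divide_right_mono)
        ultimately show ?thesis using F[of n x] by linarith
      qed
      have lower: "Phi x - 3 / real K \<le> F n x"
      proof (cases "i \<ge> 2")
        case True
        have "real i \<le> real K * 1" using i(1) Phi_bounds(2)[of x] K0
          by (meson mult_left_mono order_trans less_imp_le)
        then have m: "i - 1 \<in> {1..<K}" using True by auto
        have ri: "real (i - 1) = real i - 1" using True by (simp add: of_nat_diff)
        have "Phi (g (i - 1)) < Phi x" unfolding g[OF m] ri using i K0 by (simp add: field_simps)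
        then have "g (i - 1) \<le> x" using Phi_mono[of x "g (i - 1)"] by (cases "g (i - 1) \<le> x") auto
        then have "F n (g (i - 1)) \<le> F n x" by (rule mono)
        moreover have "(real i - 1) / real K - 1 / real K \<le> F n (g (i - 1))" using elim m g[OF m] ri by force
        moreover have "Phi x - 3 / real K \<le> (real i - 1) / real K - 1 / real K"
        proof -
          have "(real K * Phi x - 3) / real K \<le> (real i - 1 - 1) / real K"
            using i by (intro divide_right_mono) auto
          then show ?thesis using K0 by (simp add: diff_divide_distrib)
        qed
        ultimately show ?thesis by linarith
      next
        case False
        then have "real K * Phi x \<le> 3" using i by linarith
        then have "Phi x \<le> 3 / real K" using K0 by (simp add: field_simps)
        then show ?thesis using F[of n x] by linarith
      qed
      have "2 / real K \<le> 4 / real K" "3 / real K \<le> 4 / real K" by (intro divide_right_mono; simp)+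
      then have "2 / real K \<le> e" "3 / real K \<le> e" using Ke by linarith+
      then show "\<bar>F n x - Phi x\<bar> \<le> e" using upper lower by linarith
    qed
  qed
qed


section \<open>Convergence for the first day, uniformly over the starts\<close>

definition day_one_cdf :: "real \<Rightarrow> nat \<Rightarrow> (nat \<Rightarrow> int) \<Rightarrow> real \<Rightarrow> real" where
  "day_one_cdf b N x z = measure (measure_pmf (step_pmf N (edge_prob b N) x)) {x'. bias N x' / sqrt (real N) \<le> z}"

lemma day_one_cdf: "x \<in> configs N \<Longrightarrow>
    \<P>(G in graphs b N. bias N (day N x G 1) / sqrt (real N) \<le> z) = day_one_cdf b N x z"
  using prob_day[of x N "edge_prob b N" "\<lambda>x'. bias N x' / sqrt (real N) \<le> z" 1]
  by (simp add: day_one_cdf_def bind_return_pmf)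

lemma day_one_cdf_bounds: "0 \<le> day_one_cdf b N x z \<and> day_one_cdf b N x z \<le> 1"
  by (simp add: day_one_cdf_def)

lemma day_one_cdf_mono: "z \<le> z' \<Longrightarrow> day_one_cdf b N x z \<le> day_one_cdf b N x z'"
  unfolding day_one_cdf_def by (intro measure_pmf.finite_measure_mono) auto

context start_sequence
begin

text \<open>The continuity theorem of Levy for the first-day bias centred at \<open>x_start\<close>.
  Centring is essential because \<open>x_start\<close> may vary with N without converging.\<close>

lemma day_one_limit: "(\<lambda>N. day_one_cdf b N (y N) (v + x_start b N (y N))) \<longlonglongrightarrow> Phi v"
proof -
  define X where "X N x = bias N x / sqrt (real N) - x_start b N (y N)" for N x
  define M where "M N = distr (measure_pmf (step_pmf N (p N) (y N))) borel (X N)" for N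
  have M: "real_distribution (M N)" for N
    unfolding M_def by (rule prob_space.real_distribution_distr[OF measure_pmf.prob_space_axioms]) simp
  have "weak_conv_m M std_normal_distribution"
  proof (rule levy_continuity[OF M real_dist_normal_dist])
    fix t :: real
    have "(\<lambda>N. (H t N (all_edges N) - H t N {}) * cis (- t * x_start b N (y N))) \<longlonglongrightarrow> 0"
      by (rule tendsto_norm_zero_cancel)
        (use tendsto_norm_zero[OF char_shared_independent[of t]] in \<open>simp add: norm_mult\<close>)
    from tendsto_add[OF this char_independent[of t]]
    have lim: "(\<lambda>N. H t N (all_edges N) * cis (- t * x_start b N (y N)))
        \<longlonglongrightarrow> of_real (exp (- t\<^sup>2 / 2))"
      by (simp add: left_diff_distrib)
    have "(\<lambda>N. char (M N) t) \<longlonglongrightarrow> of_real (exp (- t\<^sup>2 / 2))"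
    proof (rule Lim_transform_eventually[OF lim])
      show "\<forall>\<^sub>F N in sequentially.
        H t N (all_edges N) * cis (- t * x_start b N (y N)) = char (M N) t"
        using p_bounds
      proof eventually_elim
        case (elim N)
        have "char (M N) t = measure_pmf.expectation (step_pmf N (p N) (y N)) (\<lambda>x. cis (t * X N x))"
          unfolding char_def M_def by (subst integral_distr) (simp_all add: cis_conv_exp)
        also have "\<dots> = measure_pmf.expectation (ER N (p N)) (\<lambda>E. cis (t * X N (majority_step N E (y N))))"
          unfolding step_pmf_def by simp
        also have "\<dots> = subset_mean (p N) (all_edges N) (\<lambda>E. cis (t * X N (majority_step N E (y N))))"
          using elim by (intro expectation_ER) auto
        also have "\<dots> = subset_mean (p N) (all_edges N) (\<lambda>E. cis (t / sqrt (real N) * bias N (majority_step N E (y N)))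
             * cis (- t * x_start b N (y N)))"
          by (intro subset_mean_cong) (simp add: X_def cis_mult right_diff_distrib)
        also have "\<dots> = H t N (all_edges N) * cis (- t * x_start b N (y N))"
          unfolding subset_mean_mult_right hybrid_char_all_edges[OF y] ..
        finally show ?case ..
      qed
    qed
    then show "(\<lambda>N. char (M N) t) \<longlonglongrightarrow> char std_normal_distribution t"
      by (simp add: char_std_normal_distribution)
  qed
  then have "(\<lambda>N. cdf (M N) v) \<longlonglongrightarrow> Phi v"
    using isCont_Phi[of v] unfolding weak_conv_m_def weak_conv_def Phi_def[abs_def] by blast
  moreover have "cdf (M N) v = day_one_cdf b N (y N) (v + x_start b N (y N))" for N
    unfolding cdf_def M_def day_one_cdf_def p_def
    by (subst measure_distr) (simp_all add: X_def vimage_def diff_le_eq)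
  ultimately show ?thesis by simp
qed

lemma day_one_uniform:
  assumes "e > 0"
  shows "\<forall>\<^sub>F N in sequentially. \<forall>z. \<bar>day_one_cdf b N (y N) z - Phi (z - x_start b N (y N))\<bar> \<le> e"
proof -
  have "\<forall>\<^sub>F N in sequentially. \<forall>z. \<bar>day_one_cdf b N (y N) (z + x_start b N (y N)) - Phi z\<bar> \<le> e"
    by (rule Phi_uniform[OF _ _ day_one_limit assms]) (auto intro: day_one_cdf_mono simp: day_one_cdf_bounds)
  then show ?thesis
  proof eventually_elim
    case (elim N)
    show ?case
    proof
      fix v
      show "\<bar>day_one_cdf b N (y N) v - Phi (v - x_start b N (y N))\<bar> \<le> e"
        using elim[rule_format, of "v - x_start b N (y N)"] by simp
    qed
  qed
qed

end

definition day_one_error :: "real \<Rightarrow> nat \<Rightarrow> (nat \<Rightarrow> int) \<Rightarrow> real" where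
  "day_one_error b N x = (SUP z. \<bar>day_one_cdf b N x z - Phi (z - x_start b N x)\<bar>)"

lemma day_one_error_bdd: "bdd_above (range (\<lambda>z. \<bar>day_one_cdf b N x z - Phi (z - x_start b N x)\<bar>))"
proof (rule bdd_aboveI2)
  fix z
  show "\<bar>day_one_cdf b N x z - Phi (z - x_start b N x)\<bar> \<le> 1"
    using day_one_cdf_bounds[of b N x z] Phi_bounds[of "z - x_start b N x"] by auto
qed

lemma rho_eq: "rho b N C0 = (SUP x\<in>{x \<in> configs N. \<bar>x_start b N x\<bar> \<le> C0}. day_one_error b N x)"
  unfolding rho_def day_one_error_def by (intro SUP_cong refl) (auto simp: day_one_cdf simp del: One_nat_def)

lemma rho_upper:
  assumes "x \<in> configs N" "\<bar>x_start b N x\<bar> \<le> C0"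
  shows "\<bar>day_one_cdf b N x z - Phi (z - x_start b N x)\<bar> \<le> rho b N C0"
proof -
  have "\<bar>day_one_cdf b N x z - Phi (z - x_start b N x)\<bar> \<le> day_one_error b N x"
    unfolding day_one_error_def by (rule cSUP_upper[OF UNIV_I day_one_error_bdd])
  also have "\<dots> \<le> rho b N C0"
    unfolding rho_eq using assms by (intro cSUP_upper bdd_above_finite) auto
  finally show ?thesis .
qed

text \<open>Alternating colours. This shows that the outer supremum in \<open>rho\<close> eventually
  runs over a nonempty set, and it supplies a default start for the remaining N.\<close>

lemma exists_balanced_config: "\<exists>x\<in>configs N. \<bar>bias N x\<bar> \<le> 1"
proof -
  define x :: "nat \<Rightarrow> int" where "x = (\<lambda>v\<in>{1..N}. if even v then 1 else - 1)"
  have x: "x \<in> configs N" by (auto simp: x_def configs_def)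
  have "(\<Sum>v\<in>{1..n}. if even v then 1 else - 1 :: real) = (if even n then 0 else - 1)" for n :: nat
    by (induction n) auto
  moreover have "bias N x = (\<Sum>v\<in>{1..N}. if even v then 1 else - 1 :: real)"
    unfolding bias_eq_sum[OF x] by (intro sum.cong) (auto simp: x_def)
  ultimately have "\<bar>bias N x\<bar> \<le> 1" by simp
  with x show ?thesis by blast
qed

text \<open>For each N the admissible starts form a finite set, so one of them has the largest
  error. The limit along this sequence of worst starts bounds the supremum.\<close>

theorem rho_tendsto_0:
  assumes b: "b > 0" and C0: "C0 > 0"
  shows "(\<lambda>N. rho b N C0) \<longlonglongrightarrow> 0"
proof -
  define S where "S N = {x \<in> configs N. \<bar>x_start b N x\<bar> \<le> C0}" for N
  have finS: "finite (S N)" for N by (simp add: S_def)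
  have ne: "\<forall>\<^sub>F N in sequentially. S N \<noteq> {}"
  proof -
    have "(\<lambda>N. sqrt (2 * b * ln (real N) / (pi * real N))) \<longlonglongrightarrow> 0" using b by real_asymp
    then have "\<forall>\<^sub>F N in sequentially. sqrt (2 * b * ln (real N) / (pi * real N)) < C0"
      using C0 by (rule order_tendstoD)
    with eventually_ge_at_top[of "1::nat"] show ?thesis
    proof eventually_elim
      case (elim N)
      obtain x where x: "x \<in> configs N" "\<bar>bias N x\<bar> \<le> 1" using exists_balanced_config by blast
      have "\<bar>x_start b N x\<bar> = \<bar>bias N x\<bar> * sqrt (2 * b * ln (real N) / (pi * real N))"
        unfolding x_start_def abs_mult using elim b by simp
      also have "\<dots> \<le> 1 * sqrt (2 * b * ln (real N) / (pi * real N))"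
        using x elim b by (intro mult_right_mono) auto
      finally show ?case using x elim by (auto simp: S_def)
    qed
  qed
  have "\<exists>m. m \<in> configs N \<and> (S N \<noteq> {} \<longrightarrow> m \<in> S N \<and> (\<forall>x\<in>S N. day_one_error b N x \<le> day_one_error b N m))" for N
  proof (cases "S N = {}")
    case True
    then show ?thesis using exists_balanced_config by blast
  next
    case False
    then have "Max (day_one_error b N ` S N) \<in> day_one_error b N ` S N" using finS by simp
    then obtain m where m: "m \<in> S N" "Max (day_one_error b N ` S N) = day_one_error b N m" by blast
    have "day_one_error b N x \<le> day_one_error b N m" if "x \<in> S N" for x
      unfolding m(2)[symmetric] using that finS by (intro Max_ge) auto
    then show ?thesis using m(1) by (auto simp: S_def)
  qed
  then obtain y where yc: "\<And>N. y N \<in> configs N" and yS: "\<And>N. S N \<noteq> {} \<Longrightarrow> y N \<in> S N"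
    and ymax: "\<And>N x. S N \<noteq> {} \<Longrightarrow> x \<in> S N \<Longrightarrow> day_one_error b N x \<le> day_one_error b N (y N)"
    by metis
  interpret start_sequence b C0 y
  proof
    show "\<forall>\<^sub>F N in sequentially. \<bar>x_start b N (y N)\<bar> \<le> C0"
      using ne by eventually_elim (use yS in \<open>auto simp: S_def\<close>)
  qed (use b yc in auto)
  show ?thesis
  proof (rule tendstoI)
    fix e :: real assume e: "e > 0"
    have "\<forall>\<^sub>F N in sequentially. \<forall>z. \<bar>day_one_cdf b N (y N) z - Phi (z - x_start b N (y N))\<bar> \<le> e / 2"
      using e by (intro day_one_uniform) simp
    with ne show "\<forall>\<^sub>F N in sequentially. dist (rho b N C0) 0 < e"
    proof eventually_elim
      case (elim N)
      have "day_one_error b N (y N) \<le> e / 2"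
        unfolding day_one_error_def using elim by (intro cSUP_least) auto
      then have "day_one_error b N x \<le> e / 2" if "x \<in> S N" for x
        using ymax[OF elim(1) that] by linarith
      then have "rho b N C0 \<le> e / 2"
        unfolding rho_eq S_def[symmetric] using elim by (intro cSUP_least)
      moreover have "0 \<le> rho b N C0"
      proof -
        obtain x where "x \<in> S N" using elim by blast
        then show ?thesis using rho_upper[of x N b C0 0] by (auto simp: S_def)
      qed
      ultimately show ?case using e by simp
    qed
  qed
qed


section \<open>From the first day to unanimity\<close>

text \<open>One step of a union bound along the chain: (1 - \<epsilon>) P(S) \<ge> P(S) -
  \<epsilon>, so failure probabilities of successive phases add up.\<close>

lemma measure_bind_pmf_ge:
  fixes f :: "'a \<Rightarrow> 'b pmf"
  assumes "\<And>z. z \<in> S \<Longrightarrow> z \<in> set_pmf M \<Longrightarrow> 1 - \<epsilon> \<le> measure (measure_pmf (f z)) A" "0 \<le> \<epsilon>"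
  shows "measure (measure_pmf M) S - \<epsilon> \<le> measure (measure_pmf (bind_pmf M f)) A"
proof -
  have int: "integrable (measure_pmf M) (\<lambda>z. measure (measure_pmf (f z)) A)"
    by (rule measure_pmf.integrable_const_bound[where B = 1]) auto
  have "measure (measure_pmf M) S - \<epsilon> \<le> (1 - \<epsilon>) * measure (measure_pmf M) S"
    using mult_left_mono[OF measure_pmf.prob_le_1[of M S] assms(2)] by (simp add: algebra_simps)
  also have "\<dots> = (\<integral>z. (1 - \<epsilon>) * indicator S z \<partial>measure_pmf M)" by simp
  also have "\<dots> \<le> (\<integral>z. measure (measure_pmf (f z)) A \<partial>measure_pmf M)"
  proof (rule integral_mono_AE[OF _ int])
    show "AE z in measure_pmf M. (1 - \<epsilon>) * indicator S z \<le> measure (measure_pmf (f z)) A"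
      using assms by (auto simp: AE_measure_pmf_iff split: split_indicator)
  qed (simp add: measure_pmf.emeasure_eq_measure)
  also have "\<dots> = measure (measure_pmf (bind_pmf M f)) A"
  proof -
    have "ennreal (measure (measure_pmf (bind_pmf M f)) A) = (\<integral>\<^sup>+z. ennreal (measure (measure_pmf (f z)) A) \<partial>measure_pmf M)"
      by (simp add: emeasure_bind_pmf flip: measure_pmf.emeasure_eq_measure)
    also have "\<dots> = ennreal (\<integral>z. measure (measure_pmf (f z)) A \<partial>measure_pmf M)"
      by (rule nn_integral_eq_integral[OF int]) simp
    finally show ?thesis by (simp add: integral_nonneg_AE)
  qed
  finally show ?thesis .
qed

abbreviation unanimity_prob where
  "unanimity_prob N p y t \<equiv> measure (measure_pmf (law N p y t)) {z. red N z = {}}"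

lemma red_empty_step:
  assumes "y \<in> configs N" "red N y = {}"
  shows "red N (majority_step N E y) = {}"
proof -
  have "majority_step N E y v = 1" if v: "v \<in> {1..N}" for v
  proof -
    have "v \<notin> red N y" using assms(2) by simp
    then have "y v = 1" using configs_values[OF assms(1) v] v by (auto simp: red_def)
    then show ?thesis using v assms(2) by (auto simp: majority_step_def)
  qed
  then show ?thesis by (force simp: red_def)
qed

lemma red_empty_law:
  assumes "y \<in> configs N" "red N y = {}"
  shows "unanimity_prob N p y t = 1"
proof -
  have "\<forall>z\<in>set_pmf (law N p y t). z \<in> configs N \<and> red N z = {}"
    by (induction t) (use assms red_empty_step majority_step_configs in \<open>fastforce simp: step_pmf_def\<close>)+
  then show ?thesis by (intro measure_pmf.prob_eq_1[THEN iffD2]) (auto simp: AE_measure_pmf_iff)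
qed

lemma red_empty_mono:
  assumes "y \<in> configs N"
  shows "unanimity_prob N p y s \<le> unanimity_prob N p y (s + t)"
proof -
  have "unanimity_prob N p y s - 0
     \<le> measure (measure_pmf (bind_pmf (law N p y s) (\<lambda>z. law N p z t))) {z. red N z = {}}"
    using law_configs[OF assms, THEN subsetD] by (intro measure_bind_pmf_ge) (auto simp: red_empty_law)
  then show ?thesis by (simp add: law_add)
qed

text \<open>The induction follows a guaranteed threshold \<open>s\<close>, not the actual bias:
  after a successful day the new bias is at least \<open>r * s\<close>. If the bias is already
  beyond the range of the amplification, \<open>B\<close> gives unanimity within two days, and
  absorption preserves it until the common deadline.\<close>

lemma unanimity_induct:
  fixes K c r \<epsilon> :: real
  assumes r: "1 \<le> r" and c: "0 \<le> c" and N: "0 \<le> ln (real N)" and \<epsilon>: "0 \<le> \<epsilon>"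
    and A: "\<And>y. y \<in> configs N \<Longrightarrow> sqrt (real N / ln (real N)) \<le> bias N y \<Longrightarrow> bias N y \<le> K * real N / sqrt (ln (real N))
      \<Longrightarrow> 1 - 2 * exp (- c * ((bias N y)\<^sup>2 * ln (real N) / real N))
        \<le> measure (measure_pmf (law N p y 1)) {z. r * bias N y \<le> bias N z}"
    and B: "\<And>y. y \<in> configs N \<Longrightarrow> K * real N / sqrt (ln (real N)) \<le> bias N y
      \<Longrightarrow> 1 - \<epsilon> \<le> unanimity_prob N p y 2"
    and y: "y \<in> configs N" and s: "sqrt (real N / ln (real N)) \<le> s" "s \<le> bias N y"
      "K * real N / sqrt (ln (real N)) \<le> s * r ^ n"
  shows "1 - \<epsilon> - (\<Sum>j<n. 2 * exp (- c * ((s * r ^ j)\<^sup>2 * ln (real N) / real N)))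
    \<le> unanimity_prob N p y (n + 2)"
  using y s
proof (induction n arbitrary: s y)
  case 0
  then show ?case using B[of y] unfolding add_0 by simp
next
  case (Suc n)
  let ?e = "\<lambda>s. 2 * exp (- c * (s\<^sup>2 * ln (real N) / real N))"
  show ?case
  proof (cases "K * real N / sqrt (ln (real N)) \<le> bias N y")
    case True
    have "0 \<le> (\<Sum>j<Suc n. ?e (s * r ^ j))" by (intro sum_nonneg) auto
    then have "1 - \<epsilon> - (\<Sum>j<Suc n. ?e (s * r ^ j)) \<le> unanimity_prob N p y 2"
      using B[OF Suc.prems(1) True] by linarith
    also have "\<dots> \<le> unanimity_prob N p y (2 + Suc n)"
      by (rule red_empty_mono[OF Suc.prems(1)])
    finally show ?thesis by (simp add: add.commute)
  next
    case False
    have s0: "0 \<le> s" using Suc.prems(2) N by (meson order_trans real_sqrt_ge_zero divide_nonneg_nonneg of_nat_0_le_iff)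
    have "?e (bias N y) \<le> ?e s"
    proof -
      have "c * (s\<^sup>2 * ln (real N) / real N) \<le> c * ((bias N y)\<^sup>2 * ln (real N) / real N)"
        using s0 Suc.prems(3) c N by (intro mult_left_mono divide_right_mono mult_right_mono power_mono) auto
      then show ?thesis by simp
    qed
    moreover have "1 - ?e (bias N y) \<le> measure (measure_pmf (law N p y 1)) {z. r * bias N y \<le> bias N z}"
      using A[OF Suc.prems(1) order_trans[OF Suc.prems(2,3)]] False by simp
    ultimately have "1 - ?e s \<le> measure (measure_pmf (law N p y 1)) {z. r * bias N y \<le> bias N z}"
      by linarith
    also have "\<dots> \<le> measure (measure_pmf (law N p y 1)) {z. r * s \<le> bias N z}"
    proof (intro measure_pmf.finite_measure_mono)
      have "r * s \<le> r * bias N y" using Suc.prems(3) r by (intro mult_left_mono) auto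
      then show "{z. r * bias N y \<le> bias N z} \<subseteq> {z. r * s \<le> bias N z}" by auto
    qed simp
    finally have first: "1 - ?e s \<le> measure (measure_pmf (law N p y 1)) {z. r * s \<le> bias N z}" .
    let ?rest = "\<epsilon> + (\<Sum>j<n. ?e (r * s * r ^ j))"
    have "measure (measure_pmf (law N p y 1)) {z. r * s \<le> bias N z} - ?rest
      \<le> measure (measure_pmf (bind_pmf (law N p y 1) (\<lambda>z. law N p z (n + 2)))) {z. red N z = {}}"
    proof (rule measure_bind_pmf_ge)
      fix z assume z: "z \<in> {z. r * s \<le> bias N z}" "z \<in> set_pmf (law N p y 1)"
      have "s * 1 \<le> s * r" using s0 r by (intro mult_left_mono) auto
      then have "sqrt (real N / ln (real N)) \<le> r * s" using Suc.prems(2) by (simp add: mult.commute)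
      moreover have "K * real N / sqrt (ln (real N)) \<le> r * s * r ^ n"
        using Suc.prems(4) by (simp add: mult_ac)
      moreover have "z \<in> configs N" using z(2) law_configs[OF Suc.prems(1)] by blast
      moreover have "r * s \<le> bias N z" using z(1) by simp
      ultimately have "1 - \<epsilon> - (\<Sum>j<n. ?e (r * s * r ^ j))
          \<le> unanimity_prob N p z (n + 2)"
        by (intro Suc.IH)
      then show "1 - ?rest \<le> unanimity_prob N p z (n + 2)"
        by linarith
    qed (auto intro!: add_nonneg_nonneg sum_nonneg \<epsilon>)
    also have "bind_pmf (law N p y 1) (\<lambda>z. law N p z (n + 2)) = law N p y (Suc n + 2)"
      unfolding law_add[symmetric] by simp
    finally have "1 - ?e s - ?rest \<le> unanimity_prob N p y (Suc n + 2)"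
      using first by linarith
    moreover have "(\<Sum>j<Suc n. ?e (s * r ^ j)) = ?e s + (\<Sum>j<n. ?e (r * s * r ^ j))"
      unfolding sum.lessThan_Suc_shift by (simp add: mult_ac)
    ultimately show ?thesis by linarith
  qed
qed

text \<open>As r^(2j) \<ge> j + 1, the terms are dominated by a geometric series with ratio q = exp
  (- w) \<le> 1/2. This gives 4 q, which lies within the 8 q granted by \<open>eta\<close>.\<close>

lemma doubly_exponential_sum:
  fixes w r :: real
  assumes w: "exp (- w) \<le> 1 / 2" "0 \<le> w" and r: "2 \<le> r"
  shows "(\<Sum>j<n. 2 * exp (- (w * (r ^ j)\<^sup>2))) \<le> 8 * exp (- w)"
proof -
  define q where "q = exp (- w)"
  have q: "0 < q" "q \<le> 1 / 2" using w by (auto simp: q_def)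
  have le: "2 * exp (- (w * (r ^ j)\<^sup>2)) \<le> 2 * q * q ^ j" for j
  proof -
    have "real j + 1 \<le> 2 ^ j" by (induction j) auto
    also have "(2::real) ^ j \<le> r ^ j" using r by (intro power_mono) auto
    also have "r ^ j \<le> (r ^ j)\<^sup>2" using r one_le_power[of r j] by (simp add: power2_eq_square)
    finally have "w * (real j + 1) \<le> w * (r ^ j)\<^sup>2" using w by (intro mult_left_mono) auto
    then have "exp (- (w * (r ^ j)\<^sup>2)) \<le> exp (- (w * (real j + 1)))" by simp
    also have "\<dots> = q * q ^ j"
      by (simp add: q_def algebra_simps exp_add[symmetric] exp_of_nat_mult[symmetric])
    finally show ?thesis by simp
  qed
  have "(\<Sum>j<n. 2 * exp (- (w * (r ^ j)\<^sup>2))) \<le> (\<Sum>j<n. 2 * q * q ^ j)" by (intro sum_mono le)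
  also have "\<dots> = 2 * q * (\<Sum>j<n. q ^ j)" by (simp add: sum_distrib_left)
  also have "\<dots> \<le> 2 * q * 2"
  proof (intro mult_left_mono)
    have "(1 - q) * (\<Sum>j<n. q ^ j) = 1 - q ^ n" by (simp add: one_diff_power_eq)
    also have "\<dots> \<le> 1" using q by simp
    finally have "(1 - q) * (\<Sum>j<n. q ^ j) \<le> 1" .
    moreover have "(1 / 2) * (\<Sum>j<n. q ^ j) \<le> (1 - q) * (\<Sum>j<n. q ^ j)"
      using q by (intro mult_right_mono sum_nonneg) auto
    ultimately show "(\<Sum>j<n. q ^ j) \<le> 2" by simp
  qed (use q in auto)
  finally show ?thesis using q by (simp add: q_def[symmetric])
qed

section \<open>Exchanging the colours\<close>

definition flip :: "nat \<Rightarrow> (nat \<Rightarrow> int) \<Rightarrow> nat \<Rightarrow> int" where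
  "flip N y = (\<lambda>v\<in>{1..N}. - y v)"

lemma flip_simps:
  assumes "y \<in> configs N"
  shows "flip N y \<in> configs N" "flip N (flip N y) = y" "blue N (flip N y) = red N y" "red N (flip N y) = blue N y"
    "bias N (flip N y) = - bias N y" "x_start b N (flip N y) = - x_start b N y"
proof -
  show f: "flip N y \<in> configs N"
    using configs_values[OF assms] by (force simp: configs_def flip_def)
  show "flip N (flip N y) = y"
    using assms by (auto simp: flip_def configs_def PiE_def extensional_def)
  show br: "blue N (flip N y) = red N y" "red N (flip N y) = blue N y"
    by (auto simp: flip_def blue_def red_def)
  show "bias N (flip N y) = - bias N y" by (simp add: bias_def br)
  then show "x_start b N (flip N y) = - x_start b N y" by (simp add: x_start_def)
qed

text \<open>The rule treats the colours alike, also for ties: the two strict inequalities are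
  exchanged, and a tie keeps the old colour.\<close>

lemma majority_step_flip:
  assumes "y \<in> configs N"
  shows "majority_step N E (flip N y) = flip N (majority_step N E y)"
  unfolding majority_step_def flip_simps(3,4)[OF assms] by (auto simp: flip_def fun_eq_iff)

lemma law_flip:
  assumes "y \<in> configs N"
  shows "law N p (flip N y) t = map_pmf (flip N) (law N p y t)"
proof (induction t)
  case (Suc t)
  have "law N p (flip N y) (Suc t) = bind_pmf (law N p y t) (\<lambda>z. step_pmf N p (flip N z))"
    by (simp add: Suc bind_map_pmf)
  also have "\<dots> = bind_pmf (law N p y t) (\<lambda>z. map_pmf (flip N) (step_pmf N p z))"
    using law_configs[OF assms, THEN subsetD]
    by (intro bind_pmf_cong refl) (auto simp: step_pmf_def map_pmf_comp majority_step_flip intro!: map_pmf_cong)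
  finally show ?case by (simp add: map_bind_pmf)
qed simp

lemma blue_empty_flip:
  assumes "y \<in> configs N"
  shows "measure (measure_pmf (law N p y t)) {z. blue N z = {}}
    = unanimity_prob N p (flip N y) t"
proof -
  have "unanimity_prob N p (flip N y) t
      = measure (measure_pmf (law N p y t)) (flip N -` {z. red N z = {}})"
    unfolding law_flip[OF assms] by simp
  also have "\<dots> = measure (measure_pmf (law N p y t)) {z. blue N z = {}}"
    by (rule measure_eq_AE) (use law_configs[OF assms, THEN subsetD] flip_simps(4) in \<open>auto simp: AE_measure_pmf_iff\<close>)
  finally show ?thesis ..
qed

text \<open>A vertex has one of the two colours, so the events exclude each other; this needs at
  least one vertex.\<close>

lemma red_blue_empty_le_1:
  assumes "y \<in> configs N" "N > 0"
  shows "unanimity_prob N p y t + measure (measure_pmf (law N p y t)) {z. blue N z = {}} \<le> 1"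
proof -
  let ?M = "measure_pmf (law N p y t)"
  let ?C = "configs N"
  have "measure ?M {z. red N z = {}} = measure ?M {z \<in> ?C. red N z = {}}"
    "measure ?M {z. blue N z = {}} = measure ?M {z \<in> ?C. blue N z = {}}"
    by (rule measure_eq_AE; use law_configs[OF assms(1)] in \<open>auto simp: AE_measure_pmf_iff\<close>)+
  moreover have "{z \<in> ?C. red N z = {}} \<inter> {z \<in> ?C. blue N z = {}} = {}"
    using blue_red(4)[of _ N] assms(2) by fastforce
  then have "measure ?M {z \<in> ?C. red N z = {}} + measure ?M {z \<in> ?C. blue N z = {}}
      = measure ?M ({z \<in> ?C. red N z = {}} \<union> {z \<in> ?C. blue N z = {}})"
    by (intro measure_pmf.finite_measure_Union[symmetric]) auto
  ultimately show ?thesis by simp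
qed

text \<open>Only the case \<open>t = 0\<close> of property (A) is needed: there the conditioning event is certain, and by
  the Markov property every later day is the first day of a new start.\<close>

lemma stepwise_amplification_law:
  assumes "stepwise_amplification b K c1 C2 c"
  shows "\<forall>\<^sub>F N in sequentially. \<forall>y\<in>configs N. sqrt (real N / ln (real N)) \<le> bias N y \<longrightarrow>
    bias N y \<le> K * real N / sqrt (ln (real N)) \<longrightarrow>
    1 - 2 * exp (- c * ((bias N y)\<^sup>2 * ln (real N) / real N))
      \<le> measure (measure_pmf (law N (edge_prob b N) y 1)) {z. (c1 * sqrt (ln (real N))) * bias N y \<le> bias N z}"
  using assms unfolding stepwise_amplification_def
proof eventually_elim
  case (elim N)
  show ?case
  proof (intro ballI impI)
    fix y assume y: "y \<in> configs N" and s: "sqrt (real N / ln (real N)) \<le> bias N y"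
      "bias N y \<le> K * real N / sqrt (ln (real N))"
    interpret prob_space "graphs b N" by (rule prob_space_ER_seq)
    let ?A = "\<lambda>z. c1 * sqrt (ln (real N)) * bias N y \<le> bias N z \<and> bias N z \<le> C2 * sqrt (ln (real N)) * bias N y"
    have one: "\<P>(G in graphs b N. day N y G 0 = y) = 1" by (simp add: prob_space)
    have "1 - 2 * exp (- c * ((bias N y)\<^sup>2 * ln (real N) / real N))
      \<le> \<P>(G in graphs b N. c1 * sqrt (ln (real N)) * bias N (day N y G 0) \<le> bias N (day N y G (0 + 1)) \<and>
             bias N (day N y G (0 + 1)) \<le> C2 * sqrt (ln (real N)) * bias N (day N y G 0) \<bar> day N y G 0 = y)"
      using elim[rule_format, OF y y, of 0] one s by simp
    also have "\<dots> = \<P>(G in graphs b N. ?A (day N y G 1))"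
      unfolding cond_prob_def one by simp
    also have "\<dots> = measure (measure_pmf (law N (edge_prob b N) y 1)) {z. ?A z}"
      by (rule prob_day[OF y])
    also have "\<dots> \<le> measure (measure_pmf (law N (edge_prob b N) y 1)) {z. (c1 * sqrt (ln (real N))) * bias N y \<le> bias N z}"
      by (intro measure_pmf.finite_measure_mono) auto
    finally show "1 - 2 * exp (- c * ((bias N y)\<^sup>2 * ln (real N) / real N))
      \<le> measure (measure_pmf (law N (edge_prob b N) y 1)) {z. (c1 * sqrt (ln (real N))) * bias N y \<le> bias N z}" .
  qed
qed

lemma two_day_unanimity_law:
  assumes "two_day_unanimity b K \<xi>"
  shows "\<forall>\<^sub>F N in sequentially. \<forall>y\<in>configs N. K * real N / sqrt (ln (real N)) \<le> bias N y \<longrightarrow>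
    1 - (2 * exp (- ((ln (real N))\<^sup>2)) + 2 * real N powr (- \<xi>))
      \<le> unanimity_prob N (edge_prob b N) y 2"
  using assms unfolding two_day_unanimity_def
proof eventually_elim
  case (elim N)
  show ?case
  proof (intro ballI impI)
    fix y assume y: "y \<in> configs N" and "K * real N / sqrt (ln (real N)) \<le> bias N y"
    then have "1 - 2 * exp (- ((ln (real N))\<^sup>2)) - 2 * real N powr (- \<xi>)
        \<le> \<P>(G in graphs b N. red N (day N y G 2) = {})"
      using elim by blast
    also have "\<dots> = unanimity_prob N (edge_prob b N) y 2"
      by (rule prob_day[OF y])
    finally show "1 - (2 * exp (- ((ln (real N))\<^sup>2)) + 2 * real N powr (- \<xi>))
      \<le> unanimity_prob N (edge_prob b N) y 2" by simp
  qed
qed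

text \<open>It makes \<open>K\<close> positive, as the logarithm in \<open>T_time\<close> requires.
  From (b - 1)^2 > 0 one gets sqrt (2 b - 1) < b, so r_star lies in (0, 1/2) and the inverse of
  \<open>Phi\<close> is taken above Phi 0 = 1/2.\<close>

lemma K2_ER_pos:
  assumes "b > 1"
  shows "K2_ER b > 0"
proof -
  have "2 * b - 1 < b\<^sup>2"
  proof -
    have "0 < (b - 1)\<^sup>2" using assms by simp
    then show ?thesis by (simp add: power2_eq_square algebra_simps)
  qed
  then have "sqrt (2 * b - 1) < b" using assms real_less_lsqrt[of b "2 * b - 1"] by simp
  moreover have "0 < sqrt (2 * b - 1)" using assms by simp
  ultimately have r: "0 < r_star b" "r_star b < 1 / 2" using assms by (simp_all add: r_star_def)
  obtain x where "Phi x = 1 - r_star b" using Phi_surj[of "1 - r_star b"] r by auto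
  then have "Phi (inv Phi (1 - r_star b)) = 1 - r_star b" by (metis f_inv_into_f rangeI)
  then have "Phi 0 < Phi (inv Phi (1 - r_star b))" using r Phi_0 by simp
  then have "0 < inv Phi (1 - r_star b)" using Phi_mono[of "inv Phi (1 - r_star b)" 0] by linarith
  then show ?thesis using assms by (simp add: K2_ER_def)
qed


text \<open>Choosing the threshold \<open>sqrt N / h\<close> turns the defining inequality of \<^const>\<open>T_time\<close> into
  \<open>(sqrt N / h) (c1 sqrt (ln N))\<^sup>T \<ge> K N / sqrt (ln N)\<close>.\<close>

lemma T_time_power_ge:
  assumes K: "K > 0" and h: "h N > 0" and N: "ln (real N) > 0" "real N > 0" and r: "1 < c1 * sqrt (ln (real N))"
  shows "K * real N / sqrt (ln (real N)) \<le> sqrt (real N) / h N * (c1 * sqrt (ln (real N))) ^ T_time K c1 h N"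
proof -
  define r where "r = c1 * sqrt (ln (real N))"
  define X where "X = K * h N * sqrt (real N / ln (real N))"
  have X: "X > 0" using K h N by (simp add: X_def)
  have lr: "ln r > 0" using r by (simp add: r_def)
  have "ln X / ln r \<le> real_of_int \<lceil>ln X / ln r\<rceil>" by simp
  also have "\<dots> \<le> real (T_time K c1 h N)" by (simp add: T_time_def X_def r_def)
  finally have "ln X \<le> real (T_time K c1 h N) * ln r" using lr by (simp add: pos_divide_le_eq)
  then have "exp (ln X) \<le> exp (real (T_time K c1 h N) * ln r)" by simp
  then have Xr: "X \<le> r ^ T_time K c1 h N" using X r by (simp add: exp_of_nat_mult r_def)
  have "sqrt (real N) * sqrt (real N / ln (real N)) = real N / sqrt (ln (real N))"
    using N by (simp add: real_sqrt_divide)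
  then have "K * real N / sqrt (ln (real N)) = K * (sqrt (real N) * sqrt (real N / ln (real N)))" by simp
  also have "\<dots> = sqrt (real N) / h N * X" using h by (simp add: X_def)
  also have "\<dots> \<le> sqrt (real N) / h N * r ^ T_time K c1 h N"
    using h N Xr by (intro mult_left_mono) auto
  finally show ?thesis by (simp add: r_def)
qed

text \<open>The threshold s = sqrt N / h meets two demands: h \<le> sqrt (ln N) places it in the
  range of the amplification, while the growth of h makes it small on the scale sqrt N of the
  first-day fluctuations.\<close>

lemma unanimity_lower_bound:
  fixes K c c1 C2 :: real
  assumes K: "K > 0" and c1: "c1 > 0" and c: "c > 0"
    and A: "stepwise_amplification b K c1 C2 c" and B: "two_day_unanimity b K \<xi>"
    and h: "filterlim h at_top sequentially" "h \<in> o(\<lambda>N. sqrt (ln (real N)))"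
  shows "\<forall>\<^sub>F N in sequentially. \<forall>y\<in>configs N. \<bar>x_start b N y\<bar> \<le> C0 \<longrightarrow>
    Phi (x_start b N y) - err b c \<xi> h C0 N
      \<le> unanimity_prob N (edge_prob b N) y (T_time K c1 h N + 3)"
proof -
  have "\<forall>\<^sub>F N in sequentially. h N > 0" using h(1) by (simp add: filterlim_at_top_dense)
  moreover have "\<forall>\<^sub>F N in sequentially. norm (h N) \<le> 1 * norm (sqrt (ln (real N)))"
    using landau_o.smallD[OF h(2), of 1] by simp
  moreover have "\<forall>\<^sub>F N in sequentially. real N > 1 \<and> ln (real N) > 0"
    using eventually_gt_at_top[of "1::nat"] by eventually_elim simp
  moreover have "\<forall>\<^sub>F N in sequentially. 2 \<le> c1 * sqrt (ln (real N))"
    using c1 by real_asymp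
  \<comment> \<open>With w = c ln N / h^2 this says w \<ge> ln 2, the condition exp (- w) \<le> 1/2
    of \<open>doubly_exponential_sum\<close>.\<close>
  moreover have "\<forall>\<^sub>F N in sequentially. ln 2 / c \<le> ln (real N) / (h N)\<^sup>2"
  proof -
    have "\<forall>\<^sub>F N in sequentially. norm (h N) \<le> sqrt (c / ln 2) * norm (sqrt (ln (real N)))"
      using c by (intro landau_o.smallD[OF h(2)]) simp
    with calculation(1,3) show ?thesis
    proof eventually_elim
      case (elim N)
      then have "(h N)\<^sup>2 \<le> (sqrt (c / ln 2) * sqrt (ln (real N)))\<^sup>2" by (intro power_mono) auto
      also have "\<dots> = c / ln 2 * ln (real N)" using c elim by (simp add: power_mult_distrib)
      finally show ?case using elim c by (simp add: field_simps)
    qed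
  qed
  ultimately show ?thesis
    using stepwise_amplification_law[OF A] two_day_unanimity_law[OF B]
  proof eventually_elim
    case (elim N)
    show ?case
    proof (intro ballI impI)
      fix y assume y: "y \<in> configs N" and x0: "\<bar>x_start b N y\<bar> \<le> C0"
      define p where "p = edge_prob b N"
      define s where "s = sqrt (real N) / h N"
      define r where "r = c1 * sqrt (ln (real N))"
      define T where "T = T_time K c1 h N"
      define w where "w = c * (s\<^sup>2 * ln (real N) / real N)"
      define \<epsilon> where "\<epsilon> = 2 * exp (- ((ln (real N))\<^sup>2)) + 2 * real N powr (- \<xi>)"
      have N: "real N > 0" "ln (real N) > 0" and hN: "h N > 0" using elim by auto
      have r2: "2 \<le> r" using elim by (simp add: r_def)
      have w_eq: "w = c * (ln (real N) / (h N)\<^sup>2)" using N by (simp add: w_def s_def power_divide)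
      have w0: "0 \<le> w" unfolding w_def using c N by simp
      have w2: "exp (- w) \<le> 1 / 2"
      proof -
        have "c * (ln 2 / c) \<le> w" unfolding w_eq using elim c by (intro mult_left_mono) auto
        then have "ln 2 \<le> w" using c by simp
        then have "exp (- w) \<le> exp (- ln 2)" by simp
        then show ?thesis by (simp add: exp_minus)
      qed
      have s_ge: "sqrt (real N / ln (real N)) \<le> s"
      proof -
        have "h N \<le> sqrt (ln (real N))" using elim by simp
        then show ?thesis unfolding s_def real_sqrt_divide
          using hN N by (intro divide_left_mono) auto
      qed
      have T: "K * real N / sqrt (ln (real N)) \<le> s * r ^ T"
        unfolding s_def r_def T_def using K hN N r2 by (intro T_time_power_ge) (auto simp: r_def)
      have eta: "eta c \<xi> N s = 8 * exp (- w) + \<epsilon>" by (simp add: eta_def w_def \<epsilon>_def)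
      have second: "1 - eta c \<xi> N s \<le> unanimity_prob N p z (T + 2)"
        if z: "z \<in> configs N" "s \<le> bias N z" for z
      proof -
        have "1 - \<epsilon> - (\<Sum>j<T. 2 * exp (- c * ((s * r ^ j)\<^sup>2 * ln (real N) / real N)))
          \<le> unanimity_prob N p z (T + 2)"
        proof (rule unanimity_induct[OF _ _ _ _ _ _ z(1) s_ge z(2) T])
          show "1 \<le> r" "0 \<le> c" "0 \<le> ln (real N)" "0 \<le> \<epsilon>" using r2 c N by (auto simp: \<epsilon>_def)
        next
          fix y assume "y \<in> configs N" "sqrt (real N / ln (real N)) \<le> bias N y"
            "bias N y \<le> K * real N / sqrt (ln (real N))"
          then show "1 - 2 * exp (- c * ((bias N y)\<^sup>2 * ln (real N) / real N))
            \<le> measure (measure_pmf (law N p y 1)) {z. r * bias N y \<le> bias N z}"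
            using elim unfolding p_def r_def by blast
        next
          fix y assume "y \<in> configs N" "K * real N / sqrt (ln (real N)) \<le> bias N y"
          then show "1 - \<epsilon> \<le> unanimity_prob N p y 2"
            using elim unfolding p_def \<epsilon>_def by blast
        qed
        moreover have "(\<Sum>j<T. 2 * exp (- c * ((s * r ^ j)\<^sup>2 * ln (real N) / real N)))
            = (\<Sum>j<T. 2 * exp (- (w * (r ^ j)\<^sup>2)))"
          by (intro sum.cong refl) (simp add: w_def power_mult_distrib mult_ac)
        ultimately show ?thesis
          using doubly_exponential_sum[OF w2 w0 r2, of T] unfolding eta by linarith
      qed
      have eta0: "0 \<le> eta c \<xi> N s" unfolding eta \<epsilon>_def by simp
      have law1: "law N p y 1 = step_pmf N p y" by (simp add: bind_return_pmf)
      \<comment> \<open>Failure means that the bias divided by sqrt N is below 1 / h. The normal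
        approximation bounds its probability by Phi (1 / h - x) + \<open>rho\<close>, and symmetry
        together with the Lipschitz bound turns this into the claim.\<close>
      have first: "Phi (x_start b N y) - 1 / h N - rho b N C0 \<le> measure (measure_pmf (law N p y 1)) {z. s \<le> bias N z}"
      proof -
        have "1 - measure (measure_pmf (law N p y 1)) {z. s \<le> bias N z}
            = measure (measure_pmf (law N p y 1)) (UNIV - {z. s \<le> bias N z})"
          using measure_pmf.prob_compl[of "{z. s \<le> bias N z}" "law N p y 1"] by simp
        also have "\<dots> \<le> measure (measure_pmf (law N p y 1)) {z. bias N z / sqrt (real N) \<le> 1 / h N}"
          using N hN by (intro measure_pmf.finite_measure_mono) (auto simp: s_def field_simps)
        also have "\<dots> = day_one_cdf b N y (1 / h N)" unfolding law1 day_one_cdf_def unfolding p_def ..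
        also have "\<dots> \<le> Phi (1 / h N - x_start b N y) + rho b N C0"
          using rho_upper[OF y x0, of "1 / h N"] by linarith
        also have "Phi (1 / h N - x_start b N y) = 1 - Phi (x_start b N y - 1 / h N)"
          using Phi_uminus[of "x_start b N y - 1 / h N"] by simp
        finally show ?thesis
          using Phi_Lipschitz[of "x_start b N y - 1 / h N" "x_start b N y"] hN by simp
      qed
      have "measure (measure_pmf (law N p y 1)) {z. s \<le> bias N z} - eta c \<xi> N s
        \<le> measure (measure_pmf (bind_pmf (law N p y 1) (\<lambda>z. law N p z (T + 2)))) {z. red N z = {}}"
      proof (rule measure_bind_pmf_ge[OF _ eta0])
        fix z assume z: "z \<in> {z. s \<le> bias N z}" "z \<in> set_pmf (law N p y 1)"
        then have "z \<in> configs N" using law_configs[OF y] by blast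
        with z(1) show "1 - eta c \<xi> N s \<le> unanimity_prob N p z (T + 2)"
          by (intro second) auto
      qed
      also have "bind_pmf (law N p y 1) (\<lambda>z. law N p z (T + 2)) = law N p y (T + 3)"
        unfolding law_add[symmetric] by (simp add: numeral_3_eq_3)
      finally show "Phi (x_start b N y) - err b c \<xi> h C0 N
        \<le> unanimity_prob N (edge_prob b N) y (T_time K c1 h N + 3)"
        using first unfolding err_def s_def p_def T_def by linarith
    qed
  qed
qed

section \<open>Asymptotics of the error term and of the number of days\<close>

lemma err_tendsto_0:
  assumes b: "b > 0" and c: "c > 0" and \<xi>: "\<xi> > 0" and C0: "C0 > 0"
    and h: "filterlim h at_top sequentially" "h \<in> o(\<lambda>N. sqrt (ln (real N)))"
  shows "(\<lambda>N. err b c \<xi> h C0 N) \<longlonglongrightarrow> 0"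
proof -
  have h_inv: "(\<lambda>N. 1 / h N) \<longlonglongrightarrow> 0"
    using h(1) by (intro tendsto_divide_0[OF tendsto_const] filterlim_at_top_imp_at_infinity)
  have hpos: "\<forall>\<^sub>F N in sequentially. h N > 0" using h(1) by (simp add: filterlim_at_top_dense)
  have large: "\<forall>\<^sub>F N in sequentially. real N > 1 \<and> ln (real N) > 0"
    using eventually_gt_at_top[of "1::nat"] by eventually_elim simp
  have ratio: "(\<lambda>N. h N / sqrt (ln (real N))) \<longlonglongrightarrow> 0"
    using h(2) by (rule smalloD_tendsto)
  \<comment> \<open>The first exponential in \<open>eta\<close> has exponent - c ln N / h^2, and ln
    N / h^2 is the inverse square of a quantity that tends to 0 by the growth condition on
    h.\<close>
  have "filterlim (\<lambda>N. inverse ((h N / sqrt (ln (real N)))\<^sup>2)) at_top sequentially"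
  proof (rule filterlim_inverse_at_top)
    show "(\<lambda>N. (h N / sqrt (ln (real N)))\<^sup>2) \<longlonglongrightarrow> 0" using tendsto_power[OF ratio, of 2] by simp
    show "\<forall>\<^sub>F N in sequentially. 0 < (h N / sqrt (ln (real N)))\<^sup>2"
      using hpos large by eventually_elim simp
  qed
  from filterlim_tendsto_pos_mult_at_top[OF tendsto_const c this]
  have "filterlim (\<lambda>N. c * inverse ((h N / sqrt (ln (real N)))\<^sup>2)) at_top sequentially" .
  from filterlim_compose[OF exp_at_bot filterlim_compose[OF filterlim_uminus_at_bot_at_top this]]
  have "(\<lambda>N. exp (- (c * inverse ((h N / sqrt (ln (real N)))\<^sup>2)))) \<longlonglongrightarrow> 0" .
  then have e1: "(\<lambda>N. exp (- c * ((sqrt (real N) / h N)\<^sup>2 * ln (real N) / real N))) \<longlonglongrightarrow> 0"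
  proof (rule Lim_transform_eventually)
    show "\<forall>\<^sub>F N in sequentially. exp (- (c * inverse ((h N / sqrt (ln (real N)))\<^sup>2)))
        = exp (- c * ((sqrt (real N) / h N)\<^sup>2 * ln (real N) / real N))"
      using hpos large by eventually_elim (simp add: power_divide)
  qed
  have e2: "(\<lambda>N. exp (- ((ln (real N))\<^sup>2))) \<longlonglongrightarrow> 0" by real_asymp
  have e3: "(\<lambda>N. real N powr (- \<xi>)) \<longlonglongrightarrow> 0" using \<xi> by real_asymp
  have "(\<lambda>N. rho b N C0 + 1 / h N + (8 * exp (- c * ((sqrt (real N) / h N)\<^sup>2 * ln (real N) / real N))
      + 2 * exp (- ((ln (real N))\<^sup>2)) + 2 * real N powr (- \<xi>))) \<longlonglongrightarrow> 0 + 0 + (8 * 0 + 2 * 0 + 2 * 0)"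
    by (intro tendsto_intros rho_tendsto_0 b C0 h_inv e1 e2 e3)
  then show ?thesis by (simp add: err_def eta_def)
qed

text \<open>The numerator is asymptotic to (ln N) / 2, because ln h = O(ln (ln N)), and the
  denominator to ln (ln N) / 2; the halves cancel. Rounding up and the three extra days add at most
  4, which vanishes after division by ln N / ln (ln N).\<close>

lemma T_time_asymp:
  assumes K: "K > 0" and c1: "c1 > 0"
    and h: "filterlim h at_top sequentially" "h \<in> o(\<lambda>N. sqrt (ln (real N)))"
  shows "(\<lambda>N. real (T_time K c1 h N + 3)) \<sim>[sequentially] (\<lambda>N. ln (real N) / ln (ln (real N)))"
proof -
  define X where "X N = ln (K * h N * sqrt (real N / ln (real N)))" for N
  define r where "r N = ln (c1 * sqrt (ln (real N)))" for N
  define g where "g N = ln (real N) / ln (ln (real N))" for N :: nat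
  have h1: "\<forall>\<^sub>F N in sequentially. h N > 1" using h(1) by (simp add: filterlim_at_top_dense)
  have hL: "\<forall>\<^sub>F N in sequentially. norm (h N) \<le> 1 * norm (sqrt (ln (real N)))"
    using landau_o.smallD[OF h(2), of 1] by simp
  have large: "\<forall>\<^sub>F N in sequentially. 1 < ln (real N) \<and> 1 < ln (ln (real N)) \<and> 1 < real N"
    by (intro eventually_conj; real_asymp)
  have lnh: "(\<lambda>N. ln (h N) / ln (real N)) \<longlonglongrightarrow> 0"
  proof (rule Lim_null_comparison)
    show "(\<lambda>N. ln (ln (real N)) / ln (real N)) \<longlonglongrightarrow> 0" by real_asymp
    show "\<forall>\<^sub>F N in sequentially. norm (ln (h N) / ln (real N)) \<le> ln (ln (real N)) / ln (real N)"
      using h1 hL large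
    proof eventually_elim
      case (elim N)
      then have "ln (h N) \<le> ln (sqrt (ln (real N)))" by (subst ln_le_cancel_iff) auto
      also have "\<dots> = ln (ln (real N)) / 2" using elim by (simp add: ln_sqrt)
      also have "\<dots> \<le> ln (ln (real N))" using elim by simp
      finally have "ln (h N) / ln (real N) \<le> ln (ln (real N)) / ln (real N)"
        using elim by (intro divide_right_mono) auto
      then show ?case using elim by simp
    qed
  qed
  have "(\<lambda>N. ln (K * sqrt (real N / ln (real N))) / ln (real N)) \<longlonglongrightarrow> 1 / 2"
    using K by real_asymp
  from tendsto_add[OF this lnh]
  have "(\<lambda>N. ln (K * sqrt (real N / ln (real N))) / ln (real N) + ln (h N) / ln (real N)) \<longlonglongrightarrow> 1 / 2"
    by simp
  then have XL: "(\<lambda>N. X N / ln (real N)) \<longlonglongrightarrow> 1 / 2"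
  proof (rule Lim_transform_eventually)
    show "\<forall>\<^sub>F N in sequentially. ln (K * sqrt (real N / ln (real N))) / ln (real N) + ln (h N) / ln (real N) = X N / ln (real N)"
      using h1 large
    proof eventually_elim
      case (elim N)
      have "K * h N * sqrt (real N / ln (real N)) = (K * sqrt (real N / ln (real N))) * h N" by simp
      then have "X N = ln (K * sqrt (real N / ln (real N))) + ln (h N)"
        unfolding X_def using K elim by (simp only:) (subst ln_mult_pos; simp)
      then show ?case by (simp add: add_divide_distrib)
    qed
  qed
  have rL: "(\<lambda>N. r N / ln (ln (real N))) \<longlonglongrightarrow> 1 / 2" unfolding r_def using c1 by real_asymp
  have Xr: "(\<lambda>N. X N / r N / g N) \<longlonglongrightarrow> 1"
  proof -
    have "(\<lambda>N. (X N / ln (real N)) / (r N / ln (ln (real N)))) \<longlonglongrightarrow> (1 / 2) / (1 / 2)"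
      by (intro tendsto_divide XL rL) simp
    then have "(\<lambda>N. (X N / ln (real N)) / (r N / ln (ln (real N)))) \<longlonglongrightarrow> 1" by simp
    then show ?thesis
      by (rule Lim_transform_eventually) (use large in eventually_elim, simp add: g_def)
  qed
  have g: "(\<lambda>N. 4 / g N) \<longlonglongrightarrow> 0" "\<forall>\<^sub>F N in sequentially. g N > 0"
    unfolding g_def by real_asymp+
  have X0: "\<forall>\<^sub>F N in sequentially. X N / r N > 0"
    using order_tendstoD(1)[OF Xr zero_less_one] g(2)
  proof eventually_elim
    case (elim N)
    then show ?case by (simp only: zero_less_divide_iff[of _ "g N"]) simp
  qed
  have T: "X N / r N \<le> real (T_time K c1 h N) \<and> real (T_time K c1 h N) \<le> X N / r N + 1" if "X N / r N > 0" for N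
  proof -
    have "real (T_time K c1 h N) = real_of_int \<lceil>X N / r N\<rceil>"
      using that by (simp add: T_time_def X_def r_def)
    then show ?thesis by linarith
  qed
  have "(\<lambda>N. real (T_time K c1 h N + 3) / g N) \<longlonglongrightarrow> 1"
  proof (rule tendsto_sandwich)
    show "(\<lambda>N. X N / r N / g N) \<longlonglongrightarrow> 1" by (rule Xr)
    show "(\<lambda>N. X N / r N / g N + 4 / g N) \<longlonglongrightarrow> 1" using tendsto_add[OF Xr g(1)] by simp
    show "\<forall>\<^sub>F N in sequentially. X N / r N / g N \<le> real (T_time K c1 h N + 3) / g N"
      using X0 g(2)
    proof eventually_elim
      case (elim N)
      then show ?case using T[OF elim(1)] by (intro divide_right_mono) auto
    qed
    show "\<forall>\<^sub>F N in sequentially. real (T_time K c1 h N + 3) / g N \<le> X N / r N / g N + 4 / g N"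
      using X0 g(2)
    proof eventually_elim
      case (elim N)
      then show ?case using T[OF elim(1)] unfolding add_divide_distrib[symmetric]
        by (intro divide_right_mono) auto
    qed
  qed
  then have "(\<lambda>N. real (T_time K c1 h N + 3)) \<sim>[sequentially] g"
    using g(2) by (intro asymp_equivI'_const[where c = 1, simplified]) (auto elim: eventually_mono)
  then show ?thesis by (simp add: g_def[abs_def])
qed

theorem theorem1p7:
  fixes b K c1 C2 c \<xi> C0 :: real and h :: "nat \<Rightarrow> real"
  assumes "b > 1"
    and "K > K2_ER b"
    and "c1 > 0" and "C2 > 0" and "c > 0" and "\<xi> > 0"
    and "stepwise_amplification b K c1 C2 c"
    and "two_day_unanimity b K \<xi>"
    and "filterlim h at_top sequentially"
    and "h \<in> o(\<lambda>N. sqrt (ln (real N)))"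
    and "C0 > 0"
  shows "(\<exists>M. \<forall>\<^sub>F N in sequentially. \<forall>y0 \<in> configs N. \<bar>x_start b N y0\<bar> \<le> C0 \<longrightarrow>
            \<bar>\<P>(G in graphs b N. red N (day N y0 G (T_time K c1 h N + 3)) = {})
              - Phi (x_start b N y0)\<bar> \<le> M * err b c \<xi> h C0 N)
       \<and> (\<exists>M. \<forall>\<^sub>F N in sequentially. \<forall>y0 \<in> configs N. \<bar>x_start b N y0\<bar> \<le> C0 \<longrightarrow>
            \<bar>\<P>(G in graphs b N. blue N (day N y0 G (T_time K c1 h N + 3)) = {})
              - Phi (- x_start b N y0)\<bar> \<le> M * err b c \<xi> h C0 N)
       \<and> (\<lambda>N. err b c \<xi> h C0 N) \<in> o(\<lambda>_. 1)
       \<and> (\<lambda>N. real (T_time K c1 h N + 3)) \<sim>[sequentially] (\<lambda>N. ln (real N) / ln (ln (real N)))"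
proof -
  have K: "K > 0" using K2_ER_pos[OF \<open>b > 1\<close>] \<open>K > K2_ER b\<close> by linarith
  have b: "b > 0" using \<open>b > 1\<close> by simp
  have main: "\<forall>\<^sub>F N in sequentially. \<forall>y0 \<in> configs N. \<bar>x_start b N y0\<bar> \<le> C0 \<longrightarrow>
      \<bar>\<P>(G in graphs b N. red N (day N y0 G (T_time K c1 h N + 3)) = {}) - Phi (x_start b N y0)\<bar> \<le> err b c \<xi> h C0 N
    \<and> \<bar>\<P>(G in graphs b N. blue N (day N y0 G (T_time K c1 h N + 3)) = {}) - Phi (- x_start b N y0)\<bar> \<le> err b c \<xi> h C0 N"
    using unanimity_lower_bound[OF K assms(3,5,7-10), of C0] eventually_gt_at_top[of 0]
  proof eventually_elim
    case (elim N)
    show ?case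
    proof (intro ballI impI)
      fix y assume y: "y \<in> configs N" and x: "\<bar>x_start b N y\<bar> \<le> C0"
      let ?M = "measure_pmf (law N (edge_prob b N) y (T_time K c1 h N + 3))"
      have "Phi (x_start b N y) - err b c \<xi> h C0 N \<le> measure ?M {z. red N z = {}}"
        using elim(1) y x by blast
      moreover have "Phi (- x_start b N y) - err b c \<xi> h C0 N \<le> measure ?M {z. blue N z = {}}"
        using elim(1) flip_simps[OF y] x unfolding blue_empty_flip[OF y] by (metis abs_minus_cancel)
      moreover have "measure ?M {z. red N z = {}} + measure ?M {z. blue N z = {}} \<le> 1"
        by (rule red_blue_empty_le_1[OF y elim(2)])
      ultimately have "\<bar>measure ?M {z. red N z = {}} - Phi (x_start b N y)\<bar> \<le> err b c \<xi> h C0 N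
        \<and> \<bar>measure ?M {z. blue N z = {}} - Phi (- x_start b N y)\<bar> \<le> err b c \<xi> h C0 N"
        using Phi_uminus[of "x_start b N y"] by linarith
      then show "\<bar>\<P>(G in graphs b N. red N (day N y G (T_time K c1 h N + 3)) = {}) - Phi (x_start b N y)\<bar> \<le> err b c \<xi> h C0 N
        \<and> \<bar>\<P>(G in graphs b N. blue N (day N y G (T_time K c1 h N + 3)) = {}) - Phi (- x_start b N y)\<bar> \<le> err b c \<xi> h C0 N"
        unfolding prob_day[OF y, where A = "\<lambda>z. red N z = {}"] prob_day[OF y, where A = "\<lambda>z. blue N z = {}"] .
    qed
  qed
  have "(\<lambda>N. err b c \<xi> h C0 N) \<in> o(\<lambda>_. 1)"
    using err_tendsto_0[OF b assms(5,6,11,9,10)] by (intro smalloI_tendsto) auto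
  then show ?thesis
    using T_time_asymp[OF K assms(3,9,10)]
    by (intro conjI exI[of _ 1]) (use main in \<open>auto elim!: eventually_mono\<close>)
qed

end
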